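(* Let $\Omega\subset\mathbb{R}^N$, $N\ge2$, be either a ball or an annulus centered at the origin. Let $f,g$ be Carathéodory functions on $\Omega\times\mathbb{R}$ such that $f(\cdot,t)$ and $g(\cdot,t)$ are radial for all $t\in\mathbb{R}$, and such that each $q\in\{f,g\}$ satisfies: (i) there are $C>0$, $r>1$, with $r<2N/(N-2)$ if $N\ge3$, such that $|q(x,t)|\le C(|t|^{r-1}+1)$ for a.a. $x\in\Omega$ and all $t\in\mathbb{R}$; (ii) for each $M>0$ there is $C_M>0$ such that $|q(x,s)-q(x,t)|\le C_M|s-t|$ for a.a. $x\in\Omega$ and all $s,t\in[-M,M]$. Let $F(x,t)=\int_0^tf(x,s)\,ds$, $G(x,t)=\int_0^tg(x,s)\,ds$, let $\Phi(u)=\int_\Omega\frac12|\nabla u|^2-F(x,u)$ for $u\in H^1_0(\Omega)$, and let $$\mathcal{M}=\Big\{u\in H^1_0(\Omega):\int_\Omega G(x,u)=1\Big\}.$$ Let $u_0\in C^2(\Omega)\cap C(\overline{\Omega})$ be a minimizer of $\Phi$ on $\mathcal{M}$ with $g(\cdot,u_0(\cdot))\neq0$, and let $\lambda\in\mathbb{R}$ be a Lagrange multiplier for $u_0$, i.e. $u_0$ solves $-\Delta u=f(|x|,u)+\lambda\,g(|x|,u)$ in $\Omega$, $u=0$ on $\partial\Omega$ (such a $\lambda$ exists by the Lagrange multiplier rule). Assume that $f(|x|,\cdot)+\lambda\,g(|x|,\cdot)$ is strictly convex for a.a. $x\in\Omega$ and that $g(\cdot,u_0(\cdot))$ is either positive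 a.e. or negative a.e. in $\Omega$. Then $u_0$ is axially symmetric. If $u_0\ge0$, the strict convexity assumption is needed only on $[0,\infty)$.
   Context: A function on $\Omega$ is axially symmetric if there is a line $\ell$ through the origin such that the function is invariant under every orthogonal transformation of $\mathbb{R}^N$ fixing $\ell$ pointwise (radially symmetric functions are in particular axially symmetric). For a radial function in $x$ we write $f(x,t)=f(|x|,t)$. *)

theory Defs
  imports "HOL-Analysis.Analysis"
begin

text \<open>
  \<open>\<real>\<^sup>N\<close> is rendered as a type of class \<^class>\<open>euclidean_space\<close> with \<open>N = DIM('a)\<close>.
  Functions on \<open>\<Omega>\<close> are total functions of which only the values on \<open>\<Omega>\<close> (on its closure, for
  boundary values) matter; ``almost everywhere'', measurability and integrals refer to
  \<open>lebesgue_on \<Omega>\<close>.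
\<close>

subsection \<open>Domains and symmetry\<close>

definition ball_or_annulus :: "'a::euclidean_space set \<Rightarrow> bool" where
  "ball_or_annulus \<Omega> \<longleftrightarrow>
     (\<exists>R>0. \<Omega> = ball 0 R) \<or>
     (\<exists>R\<^sub>1 R\<^sub>2. 0 < R\<^sub>1 \<and> R\<^sub>1 < R\<^sub>2 \<and> \<Omega> = {x. R\<^sub>1 < norm x \<and> norm x < R\<^sub>2})"

definition radial_on :: "'a::euclidean_space set \<Rightarrow> ('a \<Rightarrow> real) \<Rightarrow> bool" where
  "radial_on \<Omega> h \<longleftrightarrow> (\<forall>x\<in>\<Omega>. \<forall>y\<in>\<Omega>. norm x = norm y \<longrightarrow> h x = h y)"

definition axially_symmetric_on :: "'a::euclidean_space set \<Rightarrow> ('a \<Rightarrow> real) \<Rightarrow> bool" where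
  "axially_symmetric_on \<Omega> u \<longleftrightarrow>
     (\<exists>e. e \<noteq> 0 \<and>
       (\<forall>T. orthogonal_transformation T \<and> (\<forall>y\<in>span {e}. T y = y) \<longrightarrow>
            (\<forall>x\<in>\<Omega>. u (T x) = u x)))"

subsection \<open>Nonlinearities\<close>

definition caratheodory :: "'a::euclidean_space set \<Rightarrow> ('a \<Rightarrow> real \<Rightarrow> real) \<Rightarrow> bool" where
  "caratheodory \<Omega> q \<longleftrightarrow>
     (\<forall>t. (\<lambda>x. q x t) \<in> borel_measurable (lebesgue_on \<Omega>)) \<and>
     (AE x in lebesgue_on \<Omega>. continuous_on UNIV (q x))"

definition subcritical_growth :: "'a::euclidean_space set \<Rightarrow> ('a \<Rightarrow> real \<Rightarrow> real) \<Rightarrow> bool" where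
  "subcritical_growth \<Omega> q \<longleftrightarrow>
     (\<exists>C r. C > 0 \<and> r > 1 \<and>
        (DIM('a) \<ge> 3 \<longrightarrow> r < 2 * real DIM('a) / (real DIM('a) - 2)) \<and>
        (AE x in lebesgue_on \<Omega>. \<forall>t. \<bar>q x t\<bar> \<le> C * (\<bar>t\<bar> powr (r - 1) + 1)))"

definition locally_lipschitz :: "'a::euclidean_space set \<Rightarrow> ('a \<Rightarrow> real \<Rightarrow> real) \<Rightarrow> bool" where
  "locally_lipschitz \<Omega> q \<longleftrightarrow>
     (\<forall>M>0. \<exists>C>0. AE x in lebesgue_on \<Omega>.
        \<forall>s\<in>{-M..M}. \<forall>t\<in>{-M..M}. \<bar>q x s - q x t\<bar> \<le> C * \<bar>s - t\<bar>)"

text \<open>For \<open>t < 0\<close> the interval integral carries the usual sign convention.\<close>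

definition primitive :: "('a \<Rightarrow> real \<Rightarrow> real) \<Rightarrow> 'a \<Rightarrow> real \<Rightarrow> real" where
  "primitive q x t = (LBINT s=0..ereal t. q x s)"

definition strictly_convex_on :: "real set \<Rightarrow> (real \<Rightarrow> real) \<Rightarrow> bool" where
  "strictly_convex_on S h \<longleftrightarrow> convex S \<and>
     (\<forall>s\<in>S. \<forall>t\<in>S. \<forall>a b. s \<noteq> t \<and> 0 < a \<and> 0 < b \<and> a + b = 1 \<longrightarrow>
        h (a * s + b * t) < a * h s + b * h t)"

subsection \<open>Classical derivatives\<close>

definition partial_deriv :: "'a::euclidean_space \<Rightarrow> ('a \<Rightarrow> real) \<Rightarrow> 'a \<Rightarrow> real" where
  "partial_deriv i u x = frechet_derivative u (at x) i"

text \<open>\<open>C\<^sup>k(S)\<close>, for open \<open>S\<close>.\<close>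

primrec Ck_on :: "nat \<Rightarrow> 'a::euclidean_space set \<Rightarrow> ('a \<Rightarrow> real) \<Rightarrow> bool" where
  "Ck_on 0 S u \<longleftrightarrow> continuous_on S u"
| "Ck_on (Suc k) S u \<longleftrightarrow>
     (\<forall>x\<in>S. u differentiable (at x)) \<and> (\<forall>i\<in>Basis. Ck_on k S (partial_deriv i u))"

definition laplacian :: "('a::euclidean_space \<Rightarrow> real) \<Rightarrow> 'a \<Rightarrow> real" where
  "laplacian u x = (\<Sum>i\<in>Basis. partial_deriv i (partial_deriv i u) x)"

subsection \<open>Sobolev spaces\<close>

text \<open>\<open>C\<^sub>c\<^sup>\<infinity>(\<Omega>)\<close>, with its elements extended by zero to the whole space.\<close>

definition test_functions :: "'a::euclidean_space set \<Rightarrow> ('a \<Rightarrow> real) set" where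
  "test_functions \<Omega> =
     {\<phi>. (\<forall>k. Ck_on k UNIV \<phi>) \<and> (\<exists>K. compact K \<and> K \<subseteq> \<Omega> \<and> (\<forall>x. x \<notin> K \<longrightarrow> \<phi> x = 0))}"

definition locally_integrable ::
  "'a::euclidean_space set \<Rightarrow> ('a \<Rightarrow> 'b::{banach, second_countable_topology}) \<Rightarrow> bool" where
  "locally_integrable \<Omega> u \<longleftrightarrow> (\<forall>K. compact K \<and> K \<subseteq> \<Omega> \<longrightarrow> set_integrable lebesgue K u)"

definition square_integrable ::
  "'a::euclidean_space set \<Rightarrow> ('a \<Rightarrow> 'b::{banach, second_countable_topology}) \<Rightarrow> bool" where
  "square_integrable \<Omega> u \<longleftrightarrow>
     u \<in> borel_measurable (lebesgue_on \<Omega>) \<and> integrable (lebesgue_on \<Omega>) (\<lambda>x. (norm (u x))\<^sup>2)"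

definition has_weak_gradient ::
  "'a::euclidean_space set \<Rightarrow> ('a \<Rightarrow> real) \<Rightarrow> ('a \<Rightarrow> 'a) \<Rightarrow> bool" where
  "has_weak_gradient \<Omega> u v \<longleftrightarrow>
     locally_integrable \<Omega> u \<and> locally_integrable \<Omega> v \<and>
     (\<forall>\<phi>\<in>test_functions \<Omega>. \<forall>i\<in>Basis.
        (LINT x|lebesgue_on \<Omega>. u x * partial_deriv i \<phi> x) =
        - (LINT x|lebesgue_on \<Omega>. (v x \<bullet> i) * \<phi> x))"

text \<open>A weak gradient is unique only up to null sets; \<open>weak_gradient\<close> picks a representative.\<close>

definition weak_gradient :: "'a::euclidean_space set \<Rightarrow> ('a \<Rightarrow> real) \<Rightarrow> 'a \<Rightarrow> 'a" where
  "weak_gradient \<Omega> u = (SOME v. has_weak_gradient \<Omega> u v)"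

definition H1 :: "'a::euclidean_space set \<Rightarrow> ('a \<Rightarrow> real) set" where
  "H1 \<Omega> = {u. square_integrable \<Omega> u \<and> (\<exists>v. has_weak_gradient \<Omega> u v \<and> square_integrable \<Omega> v)}"

definition H1_norm :: "'a::euclidean_space set \<Rightarrow> ('a \<Rightarrow> real) \<Rightarrow> real" where
  "H1_norm \<Omega> u = sqrt (LINT x|lebesgue_on \<Omega>. (u x)\<^sup>2 + (norm (weak_gradient \<Omega> u x))\<^sup>2)"

text \<open>\<open>H\<^sup>1\<^sub>0(\<Omega>)\<close> is the closure of \<open>C\<^sub>c\<^sup>\<infinity>(\<Omega>)\<close> in \<open>H\<^sup>1(\<Omega>)\<close>.\<close>

definition H1_0 :: "'a::euclidean_space set \<Rightarrow> ('a \<Rightarrow> real) set" where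
  "H1_0 \<Omega> = {u \<in> H1 \<Omega>. \<forall>\<epsilon>>0. \<exists>\<phi>\<in>test_functions \<Omega>. H1_norm \<Omega> (\<lambda>x. u x - \<phi> x) < \<epsilon>}"

subsection \<open>The constrained variational problem\<close>

definition energy :: "'a::euclidean_space set \<Rightarrow> ('a \<Rightarrow> real \<Rightarrow> real) \<Rightarrow> ('a \<Rightarrow> real) \<Rightarrow> real" where
  "energy \<Omega> f u =
     (LINT x|lebesgue_on \<Omega>. 1/2 * (norm (weak_gradient \<Omega> u x))\<^sup>2 - primitive f x (u x))"

definition constraint_set ::
  "'a::euclidean_space set \<Rightarrow> ('a \<Rightarrow> real \<Rightarrow> real) \<Rightarrow> ('a \<Rightarrow> real) set" where
  "constraint_set \<Omega> g = {u \<in> H1_0 \<Omega>. (LINT x|lebesgue_on \<Omega>. primitive g x (u x)) = 1}"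

text \<open>
  As the nonlinearities are only Caratheodory functions, the equation is required at almost
  every point, while the boundary condition holds pointwise.
\<close>

definition solves_dirichlet ::
  "'a::euclidean_space set \<Rightarrow> ('a \<Rightarrow> real \<Rightarrow> real) \<Rightarrow> ('a \<Rightarrow> real) \<Rightarrow> bool" where
  "solves_dirichlet \<Omega> q u \<longleftrightarrow>
     (AE x in lebesgue_on \<Omega>. - laplacian u x = q x (u x)) \<and> (\<forall>x\<in>frontier \<Omega>. u x = 0)"

end

theory Submission
  imports Defs
begin

text \<open>
  Write \<open>h = f + \<mu> g\<close>, let \<open>\<sigma>\<close> be the reflection in the hyperplane orthogonal to a unit vector \<open>e\<close>,
  and let \<open>t = u - u \<circ> \<sigma>\<close>. The theorem follows from a dichotomy: \<open>t \<le> 0\<close> on the half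
  \<open>\<Omega> \<inter> {x \<bullet> e > 0}\<close>, or \<open>t \<le> 0\<close> on the opposite half (\<open>reflection_dichotomy\<close>).

  Suppose that \<open>t > 0\<close> somewhere on the half of \<open>e\<close>. Both \<open>u\<close> and \<open>u \<circ> \<sigma>\<close> solve the equation, so
  testing with the positive part of \<open>t\<close> on this half, called \<open>\<psi>\<close>, gives
  \<open>\<integral> |\<nabla>\<psi>|\<^sup>2 = \<integral> (h(u) - h(u \<circ> \<sigma>)) \<psi>\<close>. Where \<open>\<psi> > 0\<close> the slope of \<open>h\<close> on the upper half of
  the interval \<open>[u \<circ> \<sigma>, u]\<close> strictly exceeds the slope over the whole interval, by strict convexity.
  Hence the second-order remainder of \<open>\<integral> H(u - \<alpha> \<psi>)\<close>, where \<open>H' = h\<close>, exceeds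
  \<open>\<alpha>\<^sup>2/2 \<integral> |\<nabla>\<psi>|\<^sup>2\<close> by a positive multiple of \<open>\<alpha>\<^sup>2\<close>, for small \<open>\<alpha>\<close> \<^emph>\<open>of either sign\<close>
  (\<open>descent_direction\<close>). If the dichotomy fails, there are two such functions, with disjoint supports.
  As \<open>g(u)\<close> has a strict sign, moving along one of them changes the constraint at first order, so it can
  compensate for a small move along the other one. The result is a competitor on the constraint set with
  smaller energy, a contradiction. No derivative of \<open>h\<close> is involved: one-sided slopes of the convex function
  do the work of a second derivative.

  To keep the perturbations compactly supported and \<open>C\<^sup>1\<close>, \<open>\<psi>\<close> is not the positive part itself but
  \<open>\<eta>(t)\<close> for a cut-off \<open>\<eta>\<close> that vanishes below a level \<open>\<epsilon>\<close> (\<open>soft_cut\<close>). Because \<open>\<eta>'\<^sup>2 \<le> \<eta>'\<close>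
  the identity for the gradient survives as an inequality, and the loss in the other terms is of order \<open>\<epsilon>\<close>.
  Then all competitors are \<open>u\<close> plus a \<open>C\<^sup>1\<close> function of compact support. That these lie in
  \<open>H\<^sup>1\<^sub>0\<close> follows by mollification (\<open>H1_0_add_C1c\<close>), and their weak gradients are the classical
  ones by the fundamental lemma of the calculus of variations (\<open>weak_gradient_AE_grad\<close>).

  It remains to pass from the dichotomy to axial symmetry. The directions \<open>e\<close> of the first kind form a closed
  subset \<open>P\<close> of the sphere with \<open>P \<union> -P\<close> the whole sphere, so every great circle, being connected, meets
  \<open>P \<inter> -P\<close>, the set of directions in which \<open>u\<close> is symmetric. This yields \<open>N - 1\<close> orthonormal
  symmetric directions. The product of the corresponding reflections leaves \<open>u\<close> invariant and is \<open>-1\<close> on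
  their span, so \<open>P\<close> and \<open>-P\<close> agree on this span: \<open>u\<close> is symmetric in all its directions, which is axial
  symmetry (\<open>axially_symmetric_if_dominates\<close>).
\<close>

section \<open>Gradients and functions of class \<open>C\<^sup>1\<close>\<close>

definition grad :: "('a::euclidean_space \<Rightarrow> real) \<Rightarrow> 'a \<Rightarrow> 'a" where
  "grad u x = (\<Sum>i\<in>Basis. partial_deriv i u x *\<^sub>R i)"

lemma grad_inner_Basis: "i \<in> Basis \<Longrightarrow> grad u x \<bullet> i = partial_deriv i u x"
  unfolding grad_def by (simp add: inner_sum_left inner_Basis if_distrib cong: if_cong)

lemma partial_deriv_GDERIV: "GDERIV u x :> d \<Longrightarrow> partial_deriv i u x = d \<bullet> i"
  unfolding gderiv_def partial_deriv_def
  by (metis frechet_derivative_at inner_commute)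

lemma grad_eqI: "GDERIV u x :> d \<Longrightarrow> grad u x = d"
  unfolding grad_def by (simp add: partial_deriv_GDERIV euclidean_representation)

lemma GDERIV_grad: assumes "u differentiable (at x)" shows "GDERIV u x :> grad u x"
proof -
  obtain f where f: "(u has_derivative f) (at x)" using assms differentiable_def by blast
  then have lin: "linear f" using has_derivative_linear by blast
  have "f h = h \<bullet> (\<Sum>i\<in>Basis. f i *\<^sub>R i)" for h
  proof -
    have "f h = f (\<Sum>i\<in>Basis. (h \<bullet> i) *\<^sub>R i)" by (simp add: euclidean_representation)
    also have "\<dots> = (\<Sum>i\<in>Basis. (h \<bullet> i) *\<^sub>R f i)"
      by (simp add: linear_sum[OF lin] linear_cmul[OF lin])
    finally show ?thesis by (simp add: inner_sum_right mult.commute)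
  qed
  then have "GDERIV u x :> (\<Sum>i\<in>Basis. f i *\<^sub>R i)"
    using f unfolding gderiv_def by (metis (no_types, lifting) ext)
  then show ?thesis using grad_eqI by metis
qed

lemma GDERIV_differentiable: "GDERIV u x :> d \<Longrightarrow> u differentiable (at x)"
  unfolding gderiv_def differentiable_def by blast

lemma GDERIV_cmult: "GDERIV u x :> d \<Longrightarrow> GDERIV (\<lambda>x. c * u x) x :> c *\<^sub>R d" for c :: real
  using GDERIV_mult[OF GDERIV_const[of c x], of u d] by simp

lemma GDERIV_cong_open:
  assumes "open S" "x \<in> S" "\<And>y. y \<in> S \<Longrightarrow> u y = v y" "GDERIV u x :> d"
  shows "GDERIV v x :> d"
  using assms unfolding gderiv_def by (metis has_derivative_transform_within_open)

definition C1_on :: "'a::euclidean_space set \<Rightarrow> ('a \<Rightarrow> real) \<Rightarrow> bool" where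
  "C1_on S u \<longleftrightarrow> (\<forall>x\<in>S. u differentiable (at x)) \<and> continuous_on S (grad u)"

lemma C1_onD: "C1_on S u \<Longrightarrow> x \<in> S \<Longrightarrow> GDERIV u x :> grad u x"
  unfolding C1_on_def using GDERIV_grad by blast

lemma C1_on_grad: "C1_on S u \<Longrightarrow> continuous_on S (grad u)"
  unfolding C1_on_def by blast

lemma C1_onI:
  assumes "\<And>x. x \<in> S \<Longrightarrow> GDERIV u x :> g x" "continuous_on S g"
  shows "C1_on S u"
proof -
  have "continuous_on S (grad u)"
    using assms by (metis (no_types, lifting) continuous_on_cong grad_eqI)
  then show ?thesis unfolding C1_on_def using assms(1) GDERIV_differentiable by blast
qed

lemma C1_on_subset: "C1_on S u \<Longrightarrow> T \<subseteq> S \<Longrightarrow> C1_on T u"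
  unfolding C1_on_def using continuous_on_subset by blast

lemma C1_on_continuous: "C1_on S u \<Longrightarrow> continuous_on S u"
  unfolding C1_on_def
  by (meson continuous_at_imp_continuous_on differentiable_imp_continuous_within)

lemma C1_on_open_Un: 
  assumes "C1_on S u" "C1_on T u" "open S" "open T" shows "C1_on (S \<union> T) u"
  using assms unfolding C1_on_def by (auto intro: continuous_on_open_Un)

lemma Ck_on_1_iff: "Ck_on (Suc 0) S u \<longleftrightarrow> C1_on S u"
proof -
  have "continuous_on S (grad u) \<longleftrightarrow> (\<forall>i\<in>Basis. continuous_on S (partial_deriv i u))"
  proof
    assume "continuous_on S (grad u)"
    then have "continuous_on S (\<lambda>x. grad u x \<bullet> i)" for i by (intro continuous_intros)
    then show "\<forall>i\<in>Basis. continuous_on S (partial_deriv i u)"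
      by (metis (no_types, lifting) continuous_on_cong grad_inner_Basis)
  next
    assume "\<forall>i\<in>Basis. continuous_on S (partial_deriv i u)"
    then show "continuous_on S (grad u)" unfolding grad_def by (intro continuous_intros) auto
  qed
  then show ?thesis by (simp add: C1_on_def)
qed

lemma C1_on_cong_open:
  assumes "open S" "\<And>y. y \<in> S \<Longrightarrow> u y = v y" "C1_on S u"
  shows "C1_on S v"
  by (rule C1_onI[where g = "grad u"])
     (use assms C1_onD GDERIV_cong_open C1_on_grad in blast)+

lemma C1_on_add: "C1_on S u \<Longrightarrow> C1_on S v \<Longrightarrow> C1_on S (\<lambda>x. u x + v x)"
  by (rule C1_onI[where g = "\<lambda>x. grad u x + grad v x"])
     (auto intro!: GDERIV_add C1_onD continuous_intros C1_on_grad)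

lemma C1_on_diff: "C1_on S u \<Longrightarrow> C1_on S v \<Longrightarrow> C1_on S (\<lambda>x. u x - v x)"
  by (rule C1_onI[where g = "\<lambda>x. grad u x - grad v x"])
     (auto intro!: GDERIV_diff C1_onD continuous_intros C1_on_grad)

lemma C1_on_cmult: "C1_on S u \<Longrightarrow> C1_on S (\<lambda>x. c * u x)"
  by (rule C1_onI[where g = "\<lambda>x. c *\<^sub>R grad u x"])
     (auto intro!: GDERIV_cmult C1_onD continuous_intros C1_on_grad)

lemma C1_on_mult: "C1_on S u \<Longrightarrow> C1_on S v \<Longrightarrow> C1_on S (\<lambda>x. u x * v x)"
  by (rule C1_onI[where g = "\<lambda>x. u x *\<^sub>R grad v x + v x *\<^sub>R grad u x"])
     (auto intro!: GDERIV_mult C1_onD continuous_intros C1_on_grad C1_on_continuous)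

lemma C1_on_const: "C1_on S (\<lambda>x. c)"
  by (rule C1_onI[where g = "\<lambda>x. 0"]) (auto intro!: GDERIV_const)

lemma grad_add: "u differentiable (at x) \<Longrightarrow> v differentiable (at x) \<Longrightarrow>
    grad (\<lambda>x. u x + v x) x = grad u x + grad v x"
  by (intro grad_eqI GDERIV_add GDERIV_grad)

lemma grad_diff: "u differentiable (at x) \<Longrightarrow> v differentiable (at x) \<Longrightarrow>
    grad (\<lambda>x. u x - v x) x = grad u x - grad v x"
  by (intro grad_eqI GDERIV_diff GDERIV_grad)

lemma grad_cmult: "u differentiable (at x) \<Longrightarrow> grad (\<lambda>x. c * u x) x = c *\<^sub>R grad u x"
  by (intro grad_eqI GDERIV_cmult GDERIV_grad)

lemma grad_mult: "u differentiable (at x) \<Longrightarrow> v differentiable (at x) \<Longrightarrow>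
    grad (\<lambda>x. u x * v x) x = u x *\<^sub>R grad v x + v x *\<^sub>R grad u x"
  by (intro grad_eqI GDERIV_mult GDERIV_grad)

lemma grad_zero_outside:
  assumes "compact K" "\<And>x. x \<notin> K \<Longrightarrow> u x = 0" "x \<notin> K"
  shows "grad u x = 0"
proof -
  have "GDERIV u x :> 0"
    by (rule GDERIV_cong_open[of "- K" x "\<lambda>_. 0"])
       (use assms in \<open>auto simp: GDERIV_const open_Compl compact_imp_closed\<close>)
  then show ?thesis by (rule grad_eqI)
qed

text \<open>
  Functions of class \<open>C\<^sup>1\<close> with compact support in \<open>\<Omega>\<close>.
  Like test functions they are extended by zero, so that integrals over \<open>\<Omega>\<close>
  and over the whole space agree.
\<close>

definition C1c :: "'a::euclidean_space set \<Rightarrow> ('a \<Rightarrow> real) set" where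
  "C1c \<Omega> = {\<psi>. C1_on UNIV \<psi> \<and> (\<exists>K. compact K \<and> K \<subseteq> \<Omega> \<and> (\<forall>x. x \<notin> K \<longrightarrow> \<psi> x = 0))}"

text \<open>
  Off its support a function may be glued with zero, so smoothness on one open neighbourhood of
  the support is enough. This matters as \<open>u\<close> is arbitrary outside
  \<open>\<Omega>\<close>.
\<close>

lemma C1cI:
  assumes "open D" "C1_on D w" "compact K" "K \<subseteq> D" "K \<subseteq> \<Omega>" "\<And>x. x \<notin> K \<Longrightarrow> w x = 0"
  shows "w \<in> C1c \<Omega>"
proof -
  have "C1_on (-K) w"
    by (rule C1_on_cong_open[where u = "\<lambda>_. 0"])
       (use assms C1_on_const in \<open>auto simp: open_Compl compact_imp_closed\<close>)
  then have "C1_on (D \<union> -K) w"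
    using C1_on_open_Un assms by (metis compact_imp_closed open_Compl)
  moreover have "D \<union> - K = UNIV" using assms by blast
  ultimately show ?thesis unfolding C1c_def using assms by auto
qed

lemma C1c_mono: "\<psi> \<in> C1c A \<Longrightarrow> A \<subseteq> B \<Longrightarrow> \<psi> \<in> C1c B"
  unfolding C1c_def by blast

lemma C1c_C1_on: "\<psi> \<in> C1c \<Omega> \<Longrightarrow> C1_on S \<psi>"
  unfolding C1c_def using C1_on_subset by blast

lemma C1c_differentiable: "\<psi> \<in> C1c \<Omega> \<Longrightarrow> \<psi> differentiable (at x)"
  unfolding C1c_def C1_on_def by blast

lemma C1c_outside: "\<psi> \<in> C1c \<Omega> \<Longrightarrow> x \<notin> \<Omega> \<Longrightarrow> \<psi> x = 0"
  unfolding C1c_def by blast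

lemma C1c_grad_outside: "\<psi> \<in> C1c \<Omega> \<Longrightarrow> x \<notin> \<Omega> \<Longrightarrow> grad \<psi> x = 0"
  unfolding C1c_def using grad_zero_outside[of _ \<psi> x] by blast

lemma C1c_add: assumes "\<phi> \<in> C1c \<Omega>" "\<psi> \<in> C1c \<Omega>" shows "(\<lambda>x. \<phi> x + \<psi> x) \<in> C1c \<Omega>"
proof -
  obtain K L where "compact K" "K \<subseteq> \<Omega>" "\<forall>x. x \<notin> K \<longrightarrow> \<phi> x = 0"
     "compact L" "L \<subseteq> \<Omega>" "\<forall>x. x \<notin> L \<longrightarrow> \<psi> x = 0"
    using assms unfolding C1c_def by blast
  then have "compact (K \<union> L) \<and> K \<union> L \<subseteq> \<Omega> \<and> (\<forall>x. x \<notin> K \<union> L \<longrightarrow> \<phi> x + \<psi> x = 0)"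
    by auto
  then show ?thesis using assms C1_on_add unfolding C1c_def by blast
qed

lemma C1c_cmult: "\<phi> \<in> C1c \<Omega> \<Longrightarrow> (\<lambda>x. c * \<phi> x) \<in> C1c \<Omega>"
  unfolding C1c_def mem_Collect_eq using C1_on_cmult[of UNIV \<phi> c] by (metis mult_zero_right)

lemma compact_support_bounded:
  fixes f :: "'a::euclidean_space \<Rightarrow> 'b::real_normed_vector"
  assumes "continuous_on UNIV f" "compact K" "\<And>x. x \<notin> K \<Longrightarrow> f x = 0"
  obtains B where "B > 0" "\<And>x. norm (f x) \<le> B"
proof -
  have "bounded (f ` K)"
    by (intro compact_imp_bounded compact_continuous_image continuous_on_subset[OF assms(1)] assms(2)) simp
  then obtain B where B: "B > 0" "\<And>x. x \<in> K \<Longrightarrow> norm (f x) \<le> B"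
    by (auto simp: bounded_pos)
  have "norm (f x) \<le> B" for x
    using B assms(3)[of x] by (cases "x \<in> K") auto
  then show thesis using that[of B] B(1) by blast
qed

lemma C1c_bounded:
  assumes "\<psi> \<in> C1c \<Omega>"
  obtains B where "B > 0" "\<And>x. \<bar>\<psi> x\<bar> \<le> B" "\<And>x. norm (grad \<psi> x) \<le> B"
proof -
  obtain K where K: "compact K" "\<And>x. x \<notin> K \<Longrightarrow> \<psi> x = 0" using assms unfolding C1c_def by blast
  have c: "continuous_on UNIV \<psi>" "continuous_on UNIV (grad \<psi>)"
    using assms C1c_C1_on C1_on_continuous C1_on_grad by blast+
  obtain B1 where B1: "B1 > 0" "\<And>x. norm (\<psi> x) \<le> B1"
    by (rule compact_support_bounded[OF c(1) K]) auto
  obtain B2 where B2: "B2 > 0" "\<And>x. norm (grad \<psi> x) \<le> B2"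
    by (rule compact_support_bounded[OF c(2) K(1) grad_zero_outside[OF K]]) auto
  have "\<bar>\<psi> x\<bar> \<le> max B1 B2" "norm (grad \<psi> x) \<le> max B1 B2" for x
    using B1(2)[of x] B2(2)[of x] by auto
  then show thesis using that[of "max B1 B2"] B1(1) by auto
qed

lemma integrable_compact_support:
  fixes f :: "'a::euclidean_space \<Rightarrow> 'b::euclidean_space"
  assumes "continuous_on UNIV f" "compact K" "\<And>x. x \<notin> K \<Longrightarrow> f x = 0"
  shows "integrable lborel f"
proof -
  have "integrable lborel (\<lambda>x. indicator K x *\<^sub>R f x)"
    by (rule borel_integrable_compact[OF assms(2) continuous_on_subset[OF assms(1)]]) simp
  moreover have "(\<lambda>x. indicator K x *\<^sub>R f x) = f"
  proof
    fix x show "indicator K x *\<^sub>R f x = f x"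
      by (cases "x \<in> K") (simp, simp add: assms(3)[of x])
  qed
  ultimately show ?thesis by (simp only:)
qed

lemma lborel_integral_translate:
  fixes f :: "'a::euclidean_space \<Rightarrow> real"
  assumes "f \<in> borel_measurable borel"
  shows "(LINT x|lborel. f (x + a)) = (LINT x|lborel. f x)"
proof -
  have "(LINT x|lborel. f x) = (LINT x|distr lborel borel ((+) a). f x)"
    by (simp only: lborel_distr_plus)
  also have "\<dots> = (LINT x|lborel. f (a + x))"
    by (rule integral_distr) (simp, rule assms)
  finally show ?thesis by (simp add: add.commute)
qed

lemma C1_mean_value_bound:
  assumes "C1_on UNIV \<psi>" "\<And>x. norm (grad \<psi> x) \<le> B"
  shows "\<bar>\<psi> y - \<psi> x\<bar> \<le> B * norm (y - x)"
proof -
  have "norm (\<psi> y - \<psi> x) \<le> B * norm (y - x)"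
  proof (rule differentiable_bound[of UNIV \<psi> "\<lambda>z h. h \<bullet> grad \<psi> z"])
    fix z show "(\<psi> has_derivative (\<lambda>h. h \<bullet> grad \<psi> z)) (at z within UNIV)"
      using C1_onD[OF assms(1)] unfolding gderiv_def by simp
    show "onorm (\<lambda>h. h \<bullet> grad \<psi> z) \<le> B"
    proof (rule onorm_le)
      fix h show "norm (h \<bullet> grad \<psi> z) \<le> B * norm h"
        using Cauchy_Schwarz_ineq2[of h "grad \<psi> z"]
          mult_left_mono[OF assms(2)[of z] norm_ge_zero[of h]]
        by (simp add: mult.commute)
    qed
  qed auto
  then show ?thesis by simp
qed

section \<open>Smooth functions and mollification\<close>

text \<open>
  Translation invariance: the difference quotients in the direction \<open>v\<close> have
  integral zero, and they converge boundedly to the directional derivative. All integrations by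
  parts below come from this lemma.
\<close>

lemma integral_grad_eq_0:
  assumes "\<psi> \<in> C1c \<Omega>"
  shows "(LINT x|lborel. grad \<psi> x \<bullet> v) = 0"
proof -
  obtain K where K: "compact K" "\<And>x. x \<notin> K \<Longrightarrow> \<psi> x = 0" using assms unfolding C1c_def by blast
  have C1: "C1_on UNIV \<psi>" using assms C1c_C1_on by blast
  have c: "continuous_on UNIV \<psi>" "continuous_on UNIV (grad \<psi>)"
    using C1 C1_on_continuous C1_on_grad by blast+
  have meas [measurable]: "\<psi> \<in> borel_measurable borel" "grad \<psi> \<in> borel_measurable borel"
    using c borel_measurable_continuous_onI by blast+
  obtain B where B: "B > 0" "\<And>x. norm (grad \<psi> x) \<le> B"
    by (rule C1c_bounded[OF assms]) auto
  obtain R where R: "R > 0" "\<And>x. x \<in> K \<Longrightarrow> norm x \<le> R"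
    using compact_imp_bounded[OF K(1)] by (auto simp: bounded_pos)
  define s where "s n = 1 / real (Suc n)" for n
  define q where "q n x = (\<psi> (x + s n *\<^sub>R v) - \<psi> x) / s n" for n x
  have s0: "s n > 0" "s n \<le> 1" for n by (auto simp: s_def)
  have qm: "(\<lambda>x. q n x) \<in> borel_measurable lborel" "(\<lambda>x. grad \<psi> x \<bullet> v) \<in> borel_measurable lborel" for n
    unfolding q_def by measurable
  have slim: "s \<longlonglongrightarrow> 0" unfolding s_def by (rule LIMSEQ_Suc[OF lim_1_over_n])
  have "(\<lambda>n. q n x) \<longlonglongrightarrow> grad \<psi> x \<bullet> v" for x
  proof -
    have 1: "(\<psi> has_derivative (\<lambda>h. h \<bullet> grad \<psi> x)) (at (x + 0 *\<^sub>R v))"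
      using C1_onD[OF C1] unfolding gderiv_def by simp
    have 2: "((\<lambda>r::real. x + r *\<^sub>R v) has_derivative (\<lambda>r. r *\<^sub>R v)) (at 0)"
      by (auto intro!: derivative_eq_intros)
    have "((\<lambda>r. \<psi> (x + r *\<^sub>R v)) has_derivative (\<lambda>r. (r *\<^sub>R v) \<bullet> grad \<psi> x)) (at 0)"
      by (rule has_derivative_compose[OF 2 1])
    then have "((\<lambda>r. \<psi> (x + r *\<^sub>R v)) has_field_derivative (grad \<psi> x \<bullet> v)) (at 0)"
      unfolding has_field_derivative_def
      by (simp add: inner_commute mult.commute[of _ "v \<bullet> grad \<psi> x"])
    then have "((\<lambda>r. (\<psi> (x + r *\<^sub>R v) - \<psi> x) / r) \<longlongrightarrow> grad \<psi> x \<bullet> v) (at 0)"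
      unfolding has_field_derivative_iff by simp
    moreover have "filterlim s (at 0) sequentially"
      using slim s0 by (auto simp: filterlim_at less_imp_neq[THEN not_sym] intro!: always_eventually)
    ultimately show ?thesis
      unfolding q_def by (rule filterlim_compose)
  qed
  moreover have "norm (q n x) \<le> indicator (cball 0 (R + norm v)) x * (B * norm v)" for n x
  proof (cases "x \<in> cball 0 (R + norm v)")
    case True
    have "\<bar>\<psi> (x + s n *\<^sub>R v) - \<psi> x\<bar> \<le> B * norm (s n *\<^sub>R v)"
      using C1_mean_value_bound[OF C1 B(2), of "x + s n *\<^sub>R v" x] by simp
    then have "\<bar>\<psi> (x + s n *\<^sub>R v) - \<psi> x\<bar> \<le> (B * norm v) * s n"
      using s0[of n] by (simp add: mult_ac)
    then show ?thesis using True s0[of n] unfolding q_def by (simp add: divide_simps)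
  next
    case False
    then have "norm x > R + norm v" by simp
    then have "x \<notin> K" using R(2)[of x] norm_ge_zero[of v] by linarith
    have "norm x \<le> norm (x + s n *\<^sub>R v) + norm (s n *\<^sub>R v)"
      using norm_triangle_ineq4[of "x + s n *\<^sub>R v" "s n *\<^sub>R v"] by simp
    moreover have "norm (s n *\<^sub>R v) \<le> norm v" using s0[of n] by (simp add: mult_left_le_one_le)
    ultimately have "x + s n *\<^sub>R v \<notin> K"
      using \<open>norm x > R + norm v\<close> R(2)[of "x + s n *\<^sub>R v"] by linarith
    then show ?thesis using \<open>x \<notin> K\<close> False K(2) unfolding q_def by simp
  qed
  moreover have "integrable lborel (\<lambda>x::'a. indicator (cball 0 (R + norm v)) x * (B * norm v))"
    by (intro integrable_mult_left integrable_real_indicator emeasure_lborel_cball_finite) auto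
  ultimately have "(\<lambda>n. LINT x|lborel. q n x) \<longlonglongrightarrow> (LINT x|lborel. grad \<psi> x \<bullet> v)"
    by (intro integral_dominated_convergence[where w = "\<lambda>x. indicator (cball 0 (R + norm v)) x * (B * norm v)"] AE_I2 qm)
       simp_all
  moreover have "(LINT x|lborel. q n x) = 0" for n
  proof -
    have i: "integrable lborel \<psi>" using integrable_compact_support[OF c(1) K] .
    have i2: "integrable lborel (\<lambda>x. \<psi> (x + s n *\<^sub>R v))"
    proof (rule integrable_compact_support[of _ "(\<lambda>x. x - s n *\<^sub>R v) ` K"])
      show "continuous_on UNIV (\<lambda>x. \<psi> (x + s n *\<^sub>R v))"
        by (intro continuous_on_compose2[OF c(1)] continuous_intros) auto
      show "compact ((\<lambda>x. x - s n *\<^sub>R v) ` K)"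
        by (intro compact_continuous_image K continuous_intros)
      fix x assume "x \<notin> (\<lambda>x. x - s n *\<^sub>R v) ` K"
      then have "x + s n *\<^sub>R v \<notin> K" by (metis add_diff_cancel image_eqI)
      then show "\<psi> (x + s n *\<^sub>R v) = 0" using K(2) by blast
    qed
    have "(LINT x|lborel. q n x) = ((LINT x|lborel. \<psi> (x + s n *\<^sub>R v)) - (LINT x|lborel. \<psi> x)) / s n"
      unfolding q_def using i i2 by simp
    then show ?thesis using lborel_integral_translate[OF meas(1)] by simp
  qed
  ultimately show ?thesis by (simp add: LIMSEQ_const_iff)
qed

lemma Ck_on_SucD: "Ck_on (Suc k) S u \<Longrightarrow> Ck_on k S u"
proof (induction k arbitrary: u)
  case 0
  then show ?case
    by (simp add: continuous_at_imp_continuous_on differentiable_imp_continuous_within)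
next
  case (Suc k)
  then show ?case by simp
qed

text \<open>
  Together with the closure rules for sums and products below, this reduces the recursive
  definition of \<open>Ck_on\<close> to a calculus of gradients.
\<close>

lemma Ck_on_UNIV_SucI:
  assumes "\<And>x. GDERIV u x :> g x" "\<And>i. i \<in> Basis \<Longrightarrow> Ck_on k UNIV (\<lambda>x. g x \<bullet> i)"
  shows "Ck_on (Suc k) UNIV u"
proof -
  have "partial_deriv i u = (\<lambda>x. g x \<bullet> i)" for i
    using assms(1) partial_deriv_GDERIV by blast
  moreover have "u differentiable (at x)" for x
    using GDERIV_differentiable[OF assms(1)] .
  ultimately show ?thesis using assms(2) by simp
qed

lemma Ck_on_SucD_GDERIV: "Ck_on (Suc k) S u \<Longrightarrow> x \<in> S \<Longrightarrow> GDERIV u x :> grad u x"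
  by (simp add: GDERIV_grad)

lemma Ck_on_SucD_grad:
  "Ck_on (Suc k) S u \<Longrightarrow> i \<in> Basis \<Longrightarrow> Ck_on k S (\<lambda>x. grad u x \<bullet> i)"
  by (simp add: grad_inner_Basis cong: Ck_on.simps)

lemma Ck_on_const: "Ck_on k UNIV (\<lambda>x. c)"
  by (induction k arbitrary: c) (auto intro!: Ck_on_UNIV_SucI[where g = "\<lambda>x. 0"] GDERIV_const
      simp del: Ck_on.simps(2))

lemma Ck_on_add: "Ck_on k UNIV u \<Longrightarrow> Ck_on k UNIV v \<Longrightarrow> Ck_on k UNIV (\<lambda>x. u x + v x)"
proof (induction k arbitrary: u v)
  case 0
  then show ?case by (auto intro: continuous_intros)
next
  case (Suc k)
  show ?case
    by (rule Ck_on_UNIV_SucI[where g = "\<lambda>x. grad u x + grad v x"])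
       (auto intro!: GDERIV_add Ck_on_SucD_GDERIV[OF Suc.prems(1)] Ck_on_SucD_GDERIV[OF Suc.prems(2)]
         Suc.IH Ck_on_SucD_grad[OF Suc.prems(1)] Ck_on_SucD_grad[OF Suc.prems(2)] simp: inner_add_left)
qed

lemma Ck_on_mult: "Ck_on k UNIV u \<Longrightarrow> Ck_on k UNIV v \<Longrightarrow> Ck_on k UNIV (\<lambda>x. u x * v x)"
proof (induction k arbitrary: u v)
  case 0
  then show ?case by (auto intro: continuous_intros)
next
  case (Suc k)
  show ?case
    by (rule Ck_on_UNIV_SucI[where g = "\<lambda>x. u x *\<^sub>R grad v x + v x *\<^sub>R grad u x"])
       (auto intro!: GDERIV_mult Ck_on_SucD_GDERIV[OF Suc.prems(1)] Ck_on_SucD_GDERIV[OF Suc.prems(2)]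
         Ck_on_add Suc.IH Ck_on_SucD_grad[OF Suc.prems(1)] Ck_on_SucD_grad[OF Suc.prems(2)]
         Ck_on_SucD[OF Suc.prems(1)] Ck_on_SucD[OF Suc.prems(2)] simp: inner_add_left)
qed

definition smooth :: "('a::euclidean_space \<Rightarrow> real) \<Rightarrow> bool" where
  "smooth u \<longleftrightarrow> (\<forall>k. Ck_on k UNIV u)"

lemma smooth_C1_on: "smooth u \<Longrightarrow> C1_on S u"
  unfolding smooth_def using Ck_on_1_iff C1_on_subset by blast

lemma smooth_partial_deriv: "smooth u \<Longrightarrow> i \<in> Basis \<Longrightarrow> smooth (partial_deriv i u)"
  unfolding smooth_def by (meson Ck_on.simps(2))

lemma test_functions_iff:
  "\<phi> \<in> test_functions \<Omega> \<longleftrightarrow> smooth \<phi> \<and> (\<exists>K. compact K \<and> K \<subseteq> \<Omega> \<and> (\<forall>x. x \<notin> K \<longrightarrow> \<phi> x = 0))"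
  unfolding test_functions_def smooth_def by auto

lemma test_functions_C1c: "\<phi> \<in> test_functions \<Omega> \<Longrightarrow> \<phi> \<in> C1c \<Omega>"
  unfolding test_functions_iff C1c_def using smooth_C1_on by blast

lemma test_functions_add:
  assumes "\<phi> \<in> test_functions \<Omega>" "\<psi> \<in> test_functions \<Omega>"
  shows "(\<lambda>x. \<phi> x + \<psi> x) \<in> test_functions \<Omega>"
proof -
  obtain K L where "compact K" "K \<subseteq> \<Omega>" "\<forall>x. x \<notin> K \<longrightarrow> \<phi> x = 0"
     "compact L" "L \<subseteq> \<Omega>" "\<forall>x. x \<notin> L \<longrightarrow> \<psi> x = 0"
    using assms unfolding test_functions_iff by blast
  then have "compact (K \<union> L) \<and> K \<union> L \<subseteq> \<Omega> \<and> (\<forall>x. x \<notin> K \<union> L \<longrightarrow> \<phi> x + \<psi> x = 0)"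
    by auto
  then show ?thesis using assms Ck_on_add unfolding test_functions_def by blast
qed

text \<open>
  The flat functions \<open>s\<^sup>-\<^sup>n exp(-1/s)\<close>. Their derivatives are again
  combinations of functions of this family, which makes them smooth by induction.
\<close>

definition flat :: "nat \<Rightarrow> real \<Rightarrow> real" where
  "flat n s = (if s \<le> 0 then 0 else (1 / s) ^ n * exp (- (1 / s)))"

text \<open>
  The only delicate point is \<open>s = 0\<close>, where the right difference quotient is
  \<open>flat (n + 1)\<close>, which tends to zero.
\<close>

lemma DERIV_flat: "(flat n has_real_derivative (flat (n + 2) s - real n * flat (n + 1) s)) (at s)"
proof -
  consider "s > 0" | "s < 0" | "s = 0" by linarith
  then show ?thesis
  proof cases
    case 1
    have "((\<lambda>s. (1 / s) ^ n * exp (- (1 / s))) has_real_derivative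
          (flat (n + 2) s - real n * flat (n + 1) s)) (at s)"
      using 1 by (auto intro!: derivative_eq_intros simp: flat_def power2_eq_square field_simps)
        (cases n; simp add: field_simps)
    then show ?thesis
      by (rule has_field_derivative_transform_within_open[where S = "{0<..}"])
         (use 1 in \<open>auto simp: flat_def\<close>)
  next
    case 2
    have "((\<lambda>s. 0) has_real_derivative (flat (n + 2) s - real n * flat (n + 1) s)) (at s)"
      using 2 by (auto simp: flat_def)
    then show ?thesis
      by (rule has_field_derivative_transform_within_open[where S = "{..<0}"])
         (use 2 in \<open>auto simp: flat_def\<close>)
  next
    case 3
    have "((\<lambda>h. (flat n (0 + h) - flat n 0) / h) \<longlongrightarrow> 0) (at 0)"
    proof (rule filterlim_split_at)
      show "((\<lambda>h. (flat n (0 + h) - flat n 0) / h) \<longlongrightarrow> 0) (at_left 0)"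
        by (rule tendsto_eventually)
           (auto simp: flat_def eventually_at_filter intro!: always_eventually)
      have "((\<lambda>h. inverse h ^ (Suc n) / exp (inverse h)) \<longlongrightarrow> 0) (at_right (0::real))"
        by (rule filterlim_compose[OF tendsto_power_div_exp_0 filterlim_inverse_at_top_right])
      moreover have "\<forall>\<^sub>F h in at_right (0::real).
          inverse h ^ (Suc n) / exp (inverse h) = (flat n (0 + h) - flat n 0) / h"
        unfolding eventually_at_filter
        by (rule always_eventually) (auto simp: flat_def exp_minus field_simps)
      ultimately show "((\<lambda>h. (flat n (0 + h) - flat n 0) / h) \<longlongrightarrow> 0) (at_right 0)"
        by (rule Lim_transform_eventually)
    qed
    moreover have "flat k 0 = 0" for k by (simp add: flat_def)
    ultimately show ?thesis using 3 by (simp add: DERIV_def)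
  qed
qed

lemma Ck_on_flat_compose: assumes "smooth q" shows "Ck_on k UNIV (\<lambda>x. flat n (q x))"
proof (induction k arbitrary: n)
  case 0
  have "continuous_on UNIV (flat n)"
    using DERIV_flat by (meson DERIV_isCont continuous_at_imp_continuous_on)
  moreover have "continuous_on UNIV q" using assms unfolding smooth_def by (metis Ck_on.simps(1))
  ultimately show ?case by (simp add: continuous_on_compose2)
next
  case (Suc k)
  define g where "g x = (flat (n + 2) (q x) + - real n * flat (n + 1) (q x)) *\<^sub>R grad q x" for x
  have q: "Ck_on j UNIV q" for j using assms unfolding smooth_def by blast
  show ?case
  proof (rule Ck_on_UNIV_SucI[where g = g])
    fix x
    show "GDERIV (\<lambda>x. flat n (q x)) x :> g x"
      unfolding g_def using GDERIV_DERIV_compose[OF Ck_on_SucD_GDERIV[OF q] DERIV_flat] by simp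
    fix i :: 'a assume i: "i \<in> Basis"
    have "Ck_on k UNIV (\<lambda>x. (flat (n + 2) (q x) + - real n * flat (n + 1) (q x)) * (grad q x \<bullet> i))"
      by (intro Ck_on_mult Ck_on_add Ck_on_const Suc Ck_on_SucD_grad[OF q i])
    then show "Ck_on k UNIV (\<lambda>x. g x \<bullet> i)" by (simp add: g_def)
  qed
qed

text \<open>
  An even, nonnegative smooth kernel that is positive exactly on the open ball of radius
  \<open>r\<close>. It is normalised only where it is used.
\<close>

definition bump :: "real \<Rightarrow> 'a::euclidean_space \<Rightarrow> real" where
  "bump r z = flat 0 (r\<^sup>2 - z \<bullet> z)"

lemma smooth_bump: "smooth (bump r)"
proof -
  have 1: "Ck_on k UNIV (\<lambda>z. z \<bullet> i)" for k and i :: 'a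
    by (cases k) (auto simp del: Ck_on.simps(2) intro!: continuous_intros
        Ck_on_UNIV_SucI[where g = "\<lambda>_. i"] Ck_on_const simp: gderiv_def bounded_linear_imp_has_derivative bounded_linear_inner_left)
  have "smooth (\<lambda>z::'a. r\<^sup>2 - z \<bullet> z)"
    unfolding smooth_def
  proof
    fix k
    show "Ck_on k UNIV (\<lambda>z::'a. r\<^sup>2 - z \<bullet> z)"
    proof (cases k)
      case (Suc j)
      have "Ck_on (Suc j) UNIV (\<lambda>z::'a. r\<^sup>2 - z \<bullet> z)"
      proof (rule Ck_on_UNIV_SucI[where g = "\<lambda>z. (-2) *\<^sub>R z"])
        fix x :: 'a
        show "GDERIV (\<lambda>z. r\<^sup>2 - z \<bullet> z) x :> (-2) *\<^sub>R x"
          unfolding gderiv_def by (auto intro!: derivative_eq_intros simp: inner_commute)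
        fix i :: 'a
        have "Ck_on j UNIV (\<lambda>x. (-2) * (x \<bullet> i))" by (intro Ck_on_mult Ck_on_const 1)
        then show "Ck_on j UNIV (\<lambda>x. (-2) *\<^sub>R x \<bullet> i)" by simp
      qed
      then show ?thesis by (simp only: Suc)
    qed (simp, intro continuous_intros)
  qed
  then show ?thesis
    unfolding smooth_def[of "bump r"] bump_def by (intro allI Ck_on_flat_compose)
qed

lemma bump_nonneg: "bump r z \<ge> 0"
  by (simp add: bump_def flat_def)

lemma bump_minus: "bump r (- z) = bump r z"
  by (simp add: bump_def)

lemma bump_outside: "z \<notin> cball 0 r \<Longrightarrow> r > 0 \<Longrightarrow> bump r z = 0"
  by (auto simp: bump_def flat_def dot_square_norm intro!: power_mono)

lemma bump_integral_pos: 
  assumes "r > 0" shows "(LINT z|lborel. bump r (z::'a::euclidean_space)) > 0"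
proof -
  have c: "continuous_on UNIV (bump r :: 'a \<Rightarrow> real)"
    using smooth_bump C1_on_continuous smooth_C1_on by blast
  have i: "integrable lborel (bump r :: 'a \<Rightarrow> real)"
    by (rule integrable_compact_support[OF c compact_cball[of 0 r]]) (use bump_outside assms in blast)
  have "(LINT z|lborel. bump r (z::'a)) \<noteq> 0"
  proof
    assume "(LINT z|lborel. bump r (z::'a)) = 0"
    then have "AE z in lborel. bump r (z::'a) = 0"
      using integral_nonneg_eq_0_iff_AE[OF i] bump_nonneg by auto
    then have "AE z::'a in lborel. z \<notin> ball 0 r"
    proof eventually_elim
      case (elim z)
      show ?case
      proof
        assume "z \<in> ball 0 r"
        then have "z \<bullet> z < r\<^sup>2" using assms
          by (simp add: dot_square_norm power_strict_mono)
        then show False using elim by (simp add: bump_def flat_def)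
      qed
    qed
    then have "emeasure lborel (ball (0::'a) r) = 0"
      by (subst (asm) AE_iff_measurable[OF _ refl]) (auto simp: ball_def)
    then show False using content_ball_pos[OF assms, of "0::'a"] by (simp add: measure_def)
  qed
  then show ?thesis
    by (metis bump_nonneg integral_nonneg_AE AE_I2 order_less_le)
qed

definition conv :: "('a::euclidean_space \<Rightarrow> real) \<Rightarrow> ('a \<Rightarrow> real) \<Rightarrow> 'a \<Rightarrow> real" where
  "conv \<psi> K x = (LINT y|lborel. \<psi> y * K (x - y))"

lemma integral_compact_support:
  fixes f :: "'a::euclidean_space \<Rightarrow> real"
  assumes "continuous_on UNIV f" "\<And>x. x \<notin> cbox a b \<Longrightarrow> f x = 0"
  shows "(LINT x|lborel. f x) = integral (cbox a b) f"
proof -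
  have "(LINT x|lborel. f x) = integral UNIV f"
    using integral_lborel[OF integrable_compact_support[OF assms(1) compact_cbox assms(2)]] by simp
  also have "\<dots> = integral UNIV (\<lambda>x. if x \<in> cbox a b then f x else 0)"
    by (rule arg_cong[where f = "integral UNIV"]) (use assms(2) in auto)
  also have "\<dots> = integral (cbox a b) f" by (rule integral_restrict_UNIV)
  finally show ?thesis .
qed

text \<open>
  The derivative falls on the kernel, so continuity of \<open>\<psi>\<close> suffices.
\<close>

lemma conv_derivative:
  assumes \<psi>: "continuous_on UNIV \<psi>" "compact S" "\<And>x. x \<notin> S \<Longrightarrow> \<psi> x = 0" and K: "C1_on UNIV K"
  shows "conv \<psi> K differentiable (at x)"
    and "i \<in> Basis \<Longrightarrow> partial_deriv i (conv \<psi> K) x = conv \<psi> (partial_deriv i K) x"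
proof -
  obtain a b where ab: "S \<subseteq> cbox a b"
    using bounded_subset_cbox_symmetric compact_imp_bounded \<psi>(2) by metis
  have \<psi>0: "\<psi> y = 0" if "y \<notin> cbox a b" for y using \<psi>(3) ab that by blast
  have Kc: "continuous_on UNIV K" "continuous_on UNIV (grad K)"
    using K C1_on_continuous C1_on_grad by blast+
  have *: "conv \<psi> L z = integral (cbox a b) (\<lambda>y. \<psi> y * L (z - y))" if "continuous_on UNIV L" for L z
    unfolding conv_def
    by (rule integral_compact_support)
       (auto intro!: continuous_intros \<psi>(1) continuous_on_compose2[OF that] simp: \<psi>0)
  let ?fx = "\<lambda>x y. \<psi> y *\<^sub>R blinfun_inner_left (grad K (x - y))"
  have cfx: "continuous_on (UNIV \<times> cbox a b) (\<lambda>(x, y). ?fx x y)"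
    unfolding split_beta
    by (intro continuous_on_scaleR bounded_linear.continuous_on[OF bounded_linear_blinfun_inner_left]
         continuous_on_compose2[OF \<psi>(1)] continuous_on_compose2[OF Kc(2)] continuous_intros) auto
  have D: "((\<lambda>x. integral (cbox a b) (\<lambda>y. \<psi> y * K (x - y))) has_derivative
      integral (cbox a b) (?fx x)) (at x within UNIV)"
  proof (rule leibniz_rule[where fx = ?fx])
    fix x y :: 'a
    have 1: "(K has_derivative (\<lambda>h. h \<bullet> grad K (x - y))) (at (x - y))"
      using C1_onD[OF K] unfolding gderiv_def by simp
    have 2: "((\<lambda>x. x - y) has_derivative (\<lambda>h. h)) (at x)"
      by (auto intro!: derivative_eq_intros)
    have "((\<lambda>x. K (x - y)) has_derivative (\<lambda>h. h \<bullet> grad K (x - y))) (at x)"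
      by (rule has_derivative_compose[OF 2 1])
    then have "((\<lambda>x. \<psi> y * K (x - y)) has_derivative (\<lambda>h. \<psi> y * (h \<bullet> grad K (x - y)))) (at x)"
      by (rule has_derivative_mult_right)
    then show "((\<lambda>x. \<psi> y * K (x - y)) has_derivative blinfun_apply (?fx x y)) (at x within UNIV)"
      by (rule has_derivative_eq_rhs) (auto simp: scaleR_blinfun.rep_eq)
    show "(\<lambda>y. \<psi> y * K (x - y)) integrable_on cbox a b"
      by (intro integrable_continuous continuous_intros continuous_on_subset[OF \<psi>(1)]
           continuous_on_compose2[OF Kc(1)]) auto
  qed (use cfx in auto)
  have eq: "conv \<psi> K = (\<lambda>x. integral (cbox a b) (\<lambda>y. \<psi> y * K (x - y)))"
    using *[OF Kc(1)] by blast
  have D': "(conv \<psi> K has_derivative integral (cbox a b) (?fx x)) (at x)"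
    using D unfolding eq by simp
  then show "conv \<psi> K differentiable (at x)" unfolding differentiable_def by blast
  assume i: "i \<in> Basis"
  have pc: "continuous_on UNIV (partial_deriv i K)"
    using K i by (simp flip: Ck_on_1_iff)
  have "?fx x integrable_on cbox a b"
    by (intro integrable_continuous continuous_on_scaleR continuous_on_subset[OF \<psi>(1)]
         bounded_linear.continuous_on[OF bounded_linear_blinfun_inner_left]
         continuous_on_compose2[OF Kc(2)] continuous_intros) auto
  then have "blinfun_apply (integral (cbox a b) (?fx x)) i
      = integral (cbox a b) (\<lambda>y. blinfun_apply (?fx x y) i)"
    by (rule blinfun_apply_integral)
  also have "\<dots> = integral (cbox a b) (\<lambda>y. \<psi> y * partial_deriv i K (x - y))"
    by (intro integral_cong) (simp add: scaleR_blinfun.rep_eq inner_commute[of i] grad_inner_Basis i)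
  also have "\<dots> = conv \<psi> (partial_deriv i K) x" using *[OF pc] by simp
  finally show "partial_deriv i (conv \<psi> K) x = conv \<psi> (partial_deriv i K) x"
    unfolding partial_deriv_def by (metis D' frechet_derivative_at)
qed

lemma smooth_conv:
  assumes \<psi>: "continuous_on UNIV \<psi>" "compact S" "\<And>x. x \<notin> S \<Longrightarrow> \<psi> x = 0" and K: "smooth K"
  shows "smooth (conv \<psi> K)"
proof -
  have "Ck_on k UNIV (conv \<psi> K)" for k
    using K
  proof (induction k arbitrary: K)
    case 0
    then show ?case
      using conv_derivative(1)[OF \<psi> smooth_C1_on]
      by (simp add: continuous_at_imp_continuous_on differentiable_imp_continuous_within)
  next
    case (Suc k)
    have "partial_deriv i (conv \<psi> K) = conv \<psi> (partial_deriv i K)" if "i \<in> Basis" for i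
      using conv_derivative(2)[OF \<psi> smooth_C1_on[OF Suc.prems] that] by blast
    then show ?case
      using conv_derivative(1)[OF \<psi> smooth_C1_on[OF Suc.prems]] Suc.IH
        smooth_partial_deriv[OF Suc.prems] by simp
  qed
  then show ?thesis unfolding smooth_def by blast
qed

text \<open>
  If \<open>\<psi>\<close> is differentiable, the derivative can be moved back from the kernel
  to \<open>\<psi>\<close>. Hence the derivatives of a mollification are mollifications of the
  derivatives.
\<close>

lemma conv_partial_deriv_swap:
  assumes \<psi>: "\<psi> \<in> C1c \<Omega>" and K: "C1_on UNIV K" and i: "i \<in> Basis"
  shows "conv \<psi> (partial_deriv i K) x = conv (partial_deriv i \<psi>) K x"
proof -
  obtain S where S: "compact S" "S \<subseteq> \<Omega>" "\<And>x. x \<notin> S \<Longrightarrow> \<psi> x = 0" using \<psi> unfolding C1c_def by blast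
  let ?w = "\<lambda>y. \<psi> y * K (x - y)"
  let ?g = "\<lambda>y. \<psi> y *\<^sub>R (- grad K (x - y)) + K (x - y) *\<^sub>R grad \<psi> y"
  have \<psi>c: "continuous_on UNIV \<psi>" "continuous_on UNIV (grad \<psi>)"
    using \<psi> C1c_C1_on C1_on_continuous C1_on_grad by blast+
  have Kc: "continuous_on UNIV K" "continuous_on UNIV (grad K)"
    using K C1_on_continuous C1_on_grad by blast+
  have wd: "GDERIV ?w y :> ?g y" for y
  proof (rule GDERIV_mult)
    show "GDERIV \<psi> y :> grad \<psi> y" using \<psi> C1c_differentiable GDERIV_grad by blast
    have 1: "(K has_derivative (\<lambda>h. h \<bullet> grad K (x - y))) (at (x - y))"
      using C1_onD[OF K] unfolding gderiv_def by simp
    have 2: "((\<lambda>y. x - y) has_derivative (\<lambda>h. - h)) (at y)"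
      by (auto intro!: derivative_eq_intros)
    show "GDERIV (\<lambda>y. K (x - y)) y :> - grad K (x - y)"
      using has_derivative_compose[OF 2 1] unfolding gderiv_def by simp
  qed
  have cc: "continuous_on UNIV (\<lambda>y. grad K (x - y))" "continuous_on UNIV (\<lambda>y. K (x - y))"
    by (intro continuous_on_compose2[OF Kc(2)] continuous_on_compose2[OF Kc(1)] continuous_intros; simp)+
  have "C1_on UNIV ?w"
    by (rule C1_onI[OF wd]) (intro continuous_intros \<psi>c cc)
  then have w: "?w \<in> C1c UNIV"
    unfolding C1c_def using S by auto
  have "(LINT y|lborel. ?g y \<bullet> i) = 0"
    using integral_grad_eq_0[OF w, of i] grad_eqI[OF wd] by simp
  moreover have "?g y \<bullet> i = partial_deriv i \<psi> y * K (x - y) - \<psi> y * partial_deriv i K (x - y)" for y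
    by (simp add: inner_diff_left grad_inner_Basis i)
  moreover have "integrable lborel (\<lambda>y. partial_deriv i \<psi> y * K (x - y))"
    by (rule integrable_compact_support[OF _ S(1)])
       (auto intro!: continuous_intros cc \<psi>c simp: grad_zero_outside[OF S(1,3)] simp flip: grad_inner_Basis[OF i])
  moreover have "integrable lborel (\<lambda>y. \<psi> y * partial_deriv i K (x - y))"
    by (rule integrable_compact_support[OF _ S(1)])
       (auto intro!: continuous_intros cc \<psi>c simp: S(3) simp flip: grad_inner_Basis[OF i])
  ultimately show ?thesis unfolding conv_def by simp
qed

lemma conv_bump_approx:
  fixes \<psi> :: "'a::euclidean_space \<Rightarrow> real"
  assumes \<psi>: "continuous_on UNIV \<psi>" "compact S" "\<And>x. x \<notin> S \<Longrightarrow> \<psi> x = 0" and r: "r > 0"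
    and \<epsilon>: "\<And>y. norm (y - x) \<le> r \<Longrightarrow> \<bar>\<psi> y - \<psi> x\<bar> \<le> \<epsilon>"
  defines "c \<equiv> (LINT z|lborel. bump r (z::'a))"
  shows "\<bar>conv \<psi> (bump r) x - c * \<psi> x\<bar> \<le> \<epsilon> * c"
proof -
  have Kc: "continuous_on UNIV (bump r :: 'a \<Rightarrow> real)"
    using smooth_bump C1_on_continuous smooth_C1_on by blast
  have cc: "continuous_on UNIV (\<lambda>y. bump r (x - y))"
    by (intro continuous_on_compose2[OF Kc] continuous_intros; simp)
  have out: "bump r (x - y) = 0" if "y \<notin> cball x r" for y
    by (rule bump_outside[OF _ r]) (use that in \<open>simp add: dist_norm norm_minus_commute\<close>)
  have i1: "integrable lborel (\<lambda>y. bump r (x - y))"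
    by (rule integrable_compact_support[OF cc compact_cball out])
  have i2: "integrable lborel (\<lambda>y. \<psi> y * bump r (x - y))"
    by (rule integrable_compact_support[OF _ \<psi>(2)]) (auto intro!: continuous_intros cc \<psi>(1) simp: \<psi>(3))
  have "(LINT y|lborel. bump r (x - y)) = (LINT y|lborel. bump r (y + (- x)))"
    by (intro Bochner_Integration.integral_cong refl) (metis bump_minus minus_diff_eq uminus_add_conv_diff add.commute)
  also have "\<dots> = c"
    unfolding c_def by (rule lborel_integral_translate) (rule borel_measurable_continuous_onI[OF Kc])
  finally have c: "(LINT y|lborel. bump r (x - y)) = c" .
  have "conv \<psi> (bump r) x - c * \<psi> x = (LINT y|lborel. (\<psi> y - \<psi> x) * bump r (x - y))"
    unfolding conv_def c[symmetric] using i1 i2 by (simp add: left_diff_distrib mult.commute)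
  also have "\<bar>\<dots>\<bar> \<le> (LINT y|lborel. \<epsilon> * bump r (x - y))"
  proof (rule integral_abs_bound_integral)
    show "integrable lborel (\<lambda>y. (\<psi> y - \<psi> x) * bump r (x - y))"
      using i1 i2 by (simp add: left_diff_distrib)
    show "integrable lborel (\<lambda>y. \<epsilon> * bump r (x - y))" using i1 by simp
    fix y
    show "\<bar>(\<psi> y - \<psi> x) * bump r (x - y)\<bar> \<le> \<epsilon> * bump r (x - y)"
    proof (cases "y \<in> cball x r")
      case True
      then have "\<bar>\<psi> y - \<psi> x\<bar> \<le> \<epsilon>" by (intro \<epsilon>) (simp add: dist_norm norm_minus_commute)
      then show ?thesis by (simp add: abs_mult bump_nonneg mult_right_mono)
    qed (simp add: out)
  qed
  also have "\<dots> = \<epsilon> * c" using c by simp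
  finally show ?thesis .
qed

lemma mem_sums_cballI:
  fixes x y :: "'a::real_normed_vector"
  assumes "x \<in> S" "norm (y - x) \<le> r"
  shows "y \<in> (\<Union>x\<in>S. \<Union>y\<in>cball 0 r. {x + y})"
proof -
  have "y = x + (y - x)" "y - x \<in> cball 0 r" using assms(2) by auto
  then show ?thesis using assms(1) by blast
qed

text \<open>
  Continuity is uniform near the support, and two points that are both off the support have the
  same value.
\<close>

lemma compact_support_uniformly_continuous:
  fixes \<psi> :: "'a::euclidean_space \<Rightarrow> real"
  assumes \<psi>: "continuous_on UNIV \<psi>" "compact S" "\<And>x. x \<notin> S \<Longrightarrow> \<psi> x = 0" and "\<epsilon> > 0"
  obtains \<delta> where "\<delta> > 0" "\<And>x y. norm (y - x) \<le> \<delta> \<Longrightarrow> \<bar>\<psi> y - \<psi> x\<bar> \<le> \<epsilon>"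
proof -
  let ?T = "\<Union>x\<in>S. \<Union>y\<in>cball 0 1. {x + y}"
  have "uniformly_continuous_on ?T \<psi>"
    by (intro compact_uniformly_continuous compact_sums' \<psi>(2) compact_cball continuous_on_subset[OF \<psi>(1)]) simp
  then obtain d where d: "d > 0" "\<And>x y. x \<in> ?T \<Longrightarrow> y \<in> ?T \<Longrightarrow> dist y x < d \<Longrightarrow> dist (\<psi> y) (\<psi> x) < \<epsilon>"
    unfolding uniformly_continuous_on_def using \<open>\<epsilon> > 0\<close> by meson
  have near: "\<bar>\<psi> y - \<psi> x\<bar> \<le> \<epsilon>" if "norm (y - x) \<le> min 1 (d/2)" "x \<in> S" for x y
  proof -
    have "x \<in> ?T" using that by (intro mem_sums_cballI[of x]) auto
    moreover have "y \<in> ?T" using that by (intro mem_sums_cballI[of x]) auto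
    moreover have "dist y x < d" using that d(1) by (simp add: dist_norm)
    ultimately show ?thesis using d(2)[of x y] by (simp add: dist_norm)
  qed
  have "\<bar>\<psi> y - \<psi> x\<bar> \<le> \<epsilon>" if "norm (y - x) \<le> min 1 (d/2)" for x y
    using near[of y x] near[of x y] that \<psi>(3)[of x] \<psi>(3)[of y] \<open>\<epsilon> > 0\<close>
    by (cases "x \<in> S"; cases "y \<in> S") (auto simp: norm_minus_commute abs_minus_commute)
  then show thesis using that[of "min 1 (d/2)"] d(1) by simp
qed

text \<open>
  Mollify with a kernel whose radius is below the distance from the support to the complement of
  \<open>\<Omega>\<close> and below the moduli of continuity of \<open>\<psi>\<close> and of its
  first derivatives. The second part of the conclusion is conditional so that one lemma serves
  continuous and continuously differentiable functions.
\<close>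

lemma test_function_approximation:
  fixes \<psi> :: "'a::euclidean_space \<Rightarrow> real"
  assumes \<psi>: "continuous_on UNIV \<psi>" "compact S" "\<And>x. x \<notin> S \<Longrightarrow> \<psi> x = 0"
    and \<Omega>: "open \<Omega>" "S \<subseteq> \<Omega>"
    and \<epsilon>: "\<epsilon> > 0"
  shows "\<exists>\<phi>\<in>test_functions \<Omega>. (\<forall>x. \<bar>\<phi> x - \<psi> x\<bar> \<le> \<epsilon>) \<and>
      (C1_on UNIV \<psi> \<longrightarrow> (\<forall>i\<in>Basis. \<forall>x. \<bar>partial_deriv i \<phi> x - partial_deriv i \<psi> x\<bar> \<le> \<epsilon>))"
proof -
  obtain \<rho> where \<rho>: "\<rho> > 0" "(\<Union>x\<in>S. cball x \<rho>) \<subseteq> \<Omega>"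
    using compact_subset_open_imp_cball_epsilon_subset[OF \<psi>(2) \<Omega>] by blast
  let ?T = "\<Union>x\<in>S. \<Union>y\<in>cball 0 \<rho>. {x + y}"
  have T: "compact ?T" by (intro compact_sums' \<psi>(2) compact_cball)
  have T\<Omega>: "?T \<subseteq> \<Omega>"
  proof
    fix z assume "z \<in> ?T"
    then obtain x y where "z = x + y" "x \<in> S" "y \<in> cball 0 \<rho>" by blast
    then have "z \<in> cball x \<rho>" by (simp add: dist_norm)
    then show "z \<in> \<Omega>" using \<rho>(2) \<open>x \<in> S\<close> by blast
  qed
  obtain \<delta>0 where \<delta>0: "\<delta>0 > 0" "\<And>x y. norm (y - x) \<le> \<delta>0 \<Longrightarrow> \<bar>\<psi> y - \<psi> x\<bar> \<le> \<epsilon>"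
    by (rule compact_support_uniformly_continuous[OF \<psi> \<epsilon>]) auto
  have "\<exists>\<delta>>0. C1_on UNIV \<psi> \<longrightarrow> (\<forall>x y. norm (y - x) \<le> \<delta> \<longrightarrow> \<bar>partial_deriv i \<psi> y - partial_deriv i \<psi> x\<bar> \<le> \<epsilon>)"
    if i: "i \<in> Basis" for i
  proof (cases "C1_on UNIV \<psi>")
    case True
    then have c: "continuous_on UNIV (partial_deriv i \<psi>)" using i by (simp flip: Ck_on_1_iff)
    have p0: "partial_deriv i \<psi> x = 0" if "x \<notin> S" for x
      using grad_zero_outside[OF \<psi>(2,3) that] grad_inner_Basis[OF i, of \<psi> x] by simp
    show ?thesis by (rule compact_support_uniformly_continuous[OF c \<psi>(2) p0 \<epsilon>]) blast+
  qed (auto intro: exI[of _ 1])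
  then obtain \<delta> where \<delta>: "\<And>i. i \<in> Basis \<Longrightarrow> \<delta> i > 0" "\<And>i x y. i \<in> Basis \<Longrightarrow> C1_on UNIV \<psi> \<Longrightarrow>
      norm (y - x) \<le> \<delta> i \<Longrightarrow> \<bar>partial_deriv i \<psi> y - partial_deriv i \<psi> x\<bar> \<le> \<epsilon>"
    by metis
  define r where "r = Min ({\<rho>, \<delta>0} \<union> \<delta> ` Basis)"
  have "r > 0" unfolding r_def using \<rho>(1) \<delta>0(1) \<delta>(1) by auto
  moreover have "r \<le> k" if "k \<in> {\<rho>, \<delta>0} \<union> \<delta> ` Basis" for k
    unfolding r_def by (rule Min_le[OF _ that]) simp
  ultimately have r: "r > 0" "r \<le> \<rho>" "r \<le> \<delta>0" "\<And>i. i \<in> Basis \<Longrightarrow> r \<le> \<delta> i"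
    by auto
  define c where "c = (LINT z|lborel. bump r (z::'a))"
  have c: "c > 0" unfolding c_def by (rule bump_integral_pos[OF r(1)])
  let ?v = "conv \<psi> (bump r)"
  define \<phi> where "\<phi> x = (1/c) * ?v x" for x
  have sv: "smooth ?v" by (rule smooth_conv[OF \<psi> smooth_bump])
  have "smooth \<phi>" unfolding smooth_def \<phi>_def
    using sv unfolding smooth_def by (intro allI Ck_on_mult Ck_on_const) auto
  moreover have "\<phi> x = 0" if "x \<notin> ?T" for x
  proof -
    have "\<psi> y * bump r (x - y) = 0" for y
    proof (cases "y \<in> S")
      case True
      have "x - y \<notin> cball 0 r"
      proof
        assume "x - y \<in> cball 0 r"
        then have "x - y \<in> cball 0 \<rho>" using r(2) by auto
        then have "x \<in> ?T" using True by (intro mem_sums_cballI[of y]) auto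
        then show False using that by blast
      qed
      then show ?thesis using bump_outside[OF _ r(1)] by (metis mult_zero_right)
    qed (simp add: \<psi>(3))
    then have "(\<lambda>y. \<psi> y * bump r (x - y)) = (\<lambda>y. 0)" by (rule ext)
    then show ?thesis unfolding \<phi>_def conv_def by (simp only: integral_zero mult_zero_right)
  qed
  ultimately have "\<phi> \<in> test_functions \<Omega>" unfolding test_functions_iff
    by (intro conjI exI[of _ ?T] T T\<Omega> allI impI) auto
  moreover have "\<bar>\<phi> x - \<psi> x\<bar> \<le> \<epsilon>" for x
  proof -
    have "\<bar>?v x - c * \<psi> x\<bar> \<le> \<epsilon> * c"
      unfolding c_def by (rule conv_bump_approx[OF \<psi> r(1)]) (use r(3) \<delta>0(2) in auto)
    moreover have "\<phi> x - \<psi> x = (?v x - c * \<psi> x) / c" using c by (simp add: \<phi>_def field_simps)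
    ultimately show ?thesis using c by (simp add: abs_divide pos_divide_le_eq)
  qed
  moreover have "\<bar>partial_deriv i \<phi> x - partial_deriv i \<psi> x\<bar> \<le> \<epsilon>"
    if C1: "C1_on UNIV \<psi>" and i: "i \<in> Basis" for i x
  proof -
    have \<psi>': "\<psi> \<in> C1c \<Omega>" unfolding C1c_def using C1 \<psi> \<Omega> by blast
    have pc: "continuous_on UNIV (partial_deriv i \<psi>)" using C1 i by (simp flip: Ck_on_1_iff)
    have p0: "partial_deriv i \<psi> x = 0" if "x \<notin> S" for x
      using grad_zero_outside[OF \<psi>(2,3) that] grad_inner_Basis[OF i, of \<psi> x] by simp
    have "grad \<phi> x = (1/c) *\<^sub>R grad ?v x"
      unfolding \<phi>_def by (rule grad_cmult) (rule conv_derivative(1)[OF \<psi> smooth_C1_on[OF smooth_bump]])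
    then have "partial_deriv i \<phi> x = (1/c) * partial_deriv i ?v x"
      by (simp flip: grad_inner_Basis[OF i])
    also have "partial_deriv i ?v x = conv (partial_deriv i \<psi>) (bump r) x"
      using conv_derivative(2)[OF \<psi> smooth_C1_on[OF smooth_bump] i]
        conv_partial_deriv_swap[OF \<psi>' smooth_C1_on[OF smooth_bump] i] by simp
    finally have 1: "partial_deriv i \<phi> x = (1/c) * conv (partial_deriv i \<psi>) (bump r) x" .
    have "\<bar>conv (partial_deriv i \<psi>) (bump r) x - c * partial_deriv i \<psi> x\<bar> \<le> \<epsilon> * c"
      unfolding c_def by (rule conv_bump_approx[OF pc \<psi>(2) p0 r(1)]) (use r(4)[OF i] \<delta>(2)[OF i C1] in auto)
    moreover have "partial_deriv i \<phi> x - partial_deriv i \<psi> x =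
        (conv (partial_deriv i \<psi>) (bump r) x - c * partial_deriv i \<psi> x) / c"
      using c by (simp add: 1 field_simps)
    ultimately show ?thesis using c by (simp add: abs_divide pos_divide_le_eq)
  qed
  ultimately show ?thesis by (intro bexI[of _ \<phi>]) auto
qed

section \<open>Weak gradients of functions of class \<open>C\<^sup>1\<close>\<close>

lemma complete_lebesgue_on:
  assumes "\<Omega> \<in> sets lebesgue" shows "complete_measure (lebesgue_on \<Omega>)"
proof
  fix A B assume B: "B \<subseteq> A" and A: "A \<in> null_sets (lebesgue_on \<Omega>)"
  have "A \<subseteq> \<Omega>" "A \<in> null_sets lebesgue"
    using A null_sets_restrict_space[OF assms] by auto
  then have "B \<in> null_sets lebesgue" "B \<subseteq> \<Omega>" using B completion.complete2 by blast+
  then show "B \<in> sets (lebesgue_on \<Omega>)"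
    using assms by (simp add: sets_restrict_space_iff null_setsD2)
qed

text \<open>
  This gives measurability of \<open>weak_gradient\<close>, whose representative is an arbitrary
  choice.
\<close>

lemma AE_eq_measurable_lebesgue_on:
  fixes f g :: "'a::euclidean_space \<Rightarrow> 'b::topological_space"
  assumes \<Omega>: "\<Omega> \<in> sets lebesgue" and f: "f \<in> borel_measurable (lebesgue_on \<Omega>)"
    and ae: "AE x in lebesgue_on \<Omega>. f x = g x"
  shows "g \<in> borel_measurable (lebesgue_on \<Omega>)"
proof (rule measurableI)
  fix S :: "'b set" assume S: "S \<in> sets borel"
  show "g -` S \<inter> space (lebesgue_on \<Omega>) \<in> sets (lebesgue_on \<Omega>)"
  proof (rule complete_measure.in_sets_AE[OF complete_lebesgue_on[OF \<Omega>]])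
    show "f -` S \<inter> space (lebesgue_on \<Omega>) \<in> sets (lebesgue_on \<Omega>)"
      using f S by (rule measurable_sets)
    show "AE x in lebesgue_on \<Omega>. x \<in> f -` S \<inter> space (lebesgue_on \<Omega>) \<longleftrightarrow> x \<in> g -` S \<inter> space (lebesgue_on \<Omega>)"
      using ae by eventually_elim simp
  qed auto
qed auto

lemma open_sets_lebesgue: "open \<Omega> \<Longrightarrow> \<Omega> \<in> sets lebesgue"
  by (simp add: borel_open sets_completionI_sets)

lemma continuous_lebesgue_measurable:
  fixes f :: "'a::euclidean_space \<Rightarrow> 'b::euclidean_space"
  assumes "continuous_on UNIV f" shows "f \<in> borel_measurable lebesgue"
proof -
  have "f \<in> borel_measurable lborel" using borel_measurable_continuous_onI[OF assms] by simp
  then show ?thesis by (rule measurable_completion)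
qed

lemma lebesgue_on_integral_eq_lborel:
  fixes f :: "'a::euclidean_space \<Rightarrow> 'b::euclidean_space"
  assumes \<Omega>: "\<Omega> \<in> sets lebesgue" and f: "f \<in> borel_measurable borel" and 0: "\<And>x. x \<notin> \<Omega> \<Longrightarrow> f x = 0"
  shows "(LINT x|lebesgue_on \<Omega>. f x) = (LINT x|lborel. f x)"
    and "integrable lborel f \<Longrightarrow> integrable (lebesgue_on \<Omega>) f"
proof -
  have eq: "(\<lambda>x. indicator \<Omega> x *\<^sub>R f x) = f"
  proof
    fix x show "indicator \<Omega> x *\<^sub>R f x = f x" by (cases "x \<in> \<Omega>") (simp, simp add: 0)
  qed
  have sp: "\<Omega> \<inter> space lebesgue \<in> sets lebesgue" using \<Omega> by simp
  have fm: "f \<in> borel_measurable lborel" using f by simp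
  show "(LINT x|lebesgue_on \<Omega>. f x) = (LINT x|lborel. f x)"
    unfolding integral_restrict_space[OF sp] eq using integral_completion[OF fm] by simp
  assume "integrable lborel f"
  then have "integrable lebesgue f" using integrable_completion[OF fm] by simp
  then show "integrable (lebesgue_on \<Omega>) f"
    unfolding integrable_restrict_space[OF sp] eq .
qed

lemma continuous_locally_integrable:
  fixes f :: "'a::euclidean_space \<Rightarrow> 'b::euclidean_space"
  assumes "continuous_on \<Omega> f" shows "locally_integrable \<Omega> f"
  unfolding locally_integrable_def set_integrable_def
proof (intro allI impI)
  fix K assume K: "compact K \<and> K \<subseteq> \<Omega>"
  have i: "integrable lborel (\<lambda>x. indicator K x *\<^sub>R f x)"
    by (rule borel_integrable_compact) (use K continuous_on_subset[OF assms] in blast)+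
  show "integrable lebesgue (\<lambda>x. indicator K x *\<^sub>R f x)"
    by (rule iffD2[OF integrable_completion[OF borel_measurable_integrable[OF i]] i])
qed

lemma locally_integrable_mult_compact:
  fixes w \<phi> :: "'a::euclidean_space \<Rightarrow> real"
  assumes w: "locally_integrable \<Omega> w" and \<Omega>: "\<Omega> \<in> sets lebesgue"
    and \<phi>: "continuous_on UNIV \<phi>" "compact K" "K \<subseteq> \<Omega>" "\<And>x. x \<notin> K \<Longrightarrow> \<phi> x = 0"
  shows "integrable (lebesgue_on \<Omega>) (\<lambda>x. w x * \<phi> x)"
proof -
  have wi: "integrable lebesgue (\<lambda>x. indicator K x *\<^sub>R w x)"
    using w \<phi> unfolding locally_integrable_def set_integrable_def by blast
  obtain B where B: "B > 0" "\<And>x. norm (\<phi> x) \<le> B"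
    by (rule compact_support_bounded[OF \<phi>(1,2,4)]) auto
  have \<phi>m: "\<phi> \<in> borel_measurable lebesgue"
    by (rule continuous_lebesgue_measurable[OF \<phi>(1)])
  have "integrable lebesgue (\<lambda>x. (indicator K x *\<^sub>R w x) * \<phi> x)"
  proof (rule Bochner_Integration.integrable_bound[of lebesgue "\<lambda>x. B * (indicator K x *\<^sub>R w x)"])
    show "integrable lebesgue (\<lambda>x. B * (indicator K x *\<^sub>R w x))"
      using wi by (rule integrable_mult_right)
    show "(\<lambda>x. (indicator K x *\<^sub>R w x) * \<phi> x) \<in> borel_measurable lebesgue"
      by (rule borel_measurable_times[OF borel_measurable_integrable[OF wi] \<phi>m])
    show "AE x in lebesgue. norm ((indicator K x *\<^sub>R w x) * \<phi> x) \<le> norm (B * (indicator K x *\<^sub>R w x))"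
    proof (rule AE_I2)
      fix x show "norm ((indicator K x *\<^sub>R w x) * \<phi> x) \<le> norm (B * (indicator K x *\<^sub>R w x))"
        using mult_left_mono[OF B(2)[of x], of "\<bar>indicator K x *\<^sub>R w x\<bar>"] B(1)
        by (simp add: abs_mult mult.commute)
    qed
  qed
  moreover have "(\<lambda>x. (indicator K x *\<^sub>R w x) * \<phi> x) = (\<lambda>x. indicator \<Omega> x *\<^sub>R (w x * \<phi> x))"
  proof
    fix x show "(indicator K x *\<^sub>R w x) * \<phi> x = indicator \<Omega> x *\<^sub>R (w x * \<phi> x)"
      using \<phi>(3) by (cases "x \<in> K") (auto simp: \<phi>(4))
  qed
  ultimately show ?thesis using \<Omega> by (simp add: integrable_restrict_space)
qed

text \<open>
  The product \<open>u \<psi>\<close> has compact support, so its gradient has integral zero,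
  whatever \<open>u\<close> does near the boundary.
\<close>

lemma C1_integration_by_parts:
  fixes u \<psi> :: "'a::euclidean_space \<Rightarrow> real"
  assumes \<Omega>: "open \<Omega>" and u: "C1_on \<Omega> u" and \<psi>: "\<psi> \<in> C1c \<Omega>"
  shows "integrable (lebesgue_on \<Omega>) (\<lambda>x. u x * (grad \<psi> x \<bullet> v))"
    and "integrable (lebesgue_on \<Omega>) (\<lambda>x. (grad u x \<bullet> v) * \<psi> x)"
    and "(LINT x|lebesgue_on \<Omega>. u x * (grad \<psi> x \<bullet> v)) = - (LINT x|lebesgue_on \<Omega>. (grad u x \<bullet> v) * \<psi> x)"
proof -
  note \<Omega>m = open_sets_lebesgue[OF \<Omega>]
  obtain K where K: "compact K" "K \<subseteq> \<Omega>" "\<And>x. x \<notin> K \<Longrightarrow> \<psi> x = 0" using \<psi> unfolding C1c_def by blast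
  have c: "continuous_on UNIV \<psi>" "continuous_on UNIV (\<lambda>x. grad \<psi> x \<bullet> v)"
    using C1_on_continuous[OF C1c_C1_on[OF \<psi>]] C1_on_grad[OF C1c_C1_on[OF \<psi>]]
    by (auto intro: continuous_intros)
  have uc: "continuous_on \<Omega> u" "continuous_on \<Omega> (\<lambda>x. grad u x \<bullet> v)"
    using C1_on_continuous[OF u] C1_on_grad[OF u] by (auto intro: continuous_intros)
  show i1: "integrable (lebesgue_on \<Omega>) (\<lambda>x. u x * (grad \<psi> x \<bullet> v))"
    by (rule locally_integrable_mult_compact[OF continuous_locally_integrable[OF uc(1)] \<Omega>m c(2) K(1,2)])
       (simp add: grad_zero_outside[OF K(1,3)])
  show i2: "integrable (lebesgue_on \<Omega>) (\<lambda>x. (grad u x \<bullet> v) * \<psi> x)"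
    by (rule locally_integrable_mult_compact[OF continuous_locally_integrable[OF uc(2)] \<Omega>m c(1) K(1,2,3)])
  let ?w = "\<lambda>x. u x * \<psi> x"
  have w: "?w \<in> C1c \<Omega>"
    by (rule C1cI[OF \<Omega> C1_on_mult[OF u C1c_C1_on[OF \<psi>]] K(1,2,2)]) (simp add: K(3))
  have g: "grad ?w x \<bullet> v = u x * (grad \<psi> x \<bullet> v) + (grad u x \<bullet> v) * \<psi> x" if "x \<in> \<Omega>" for x
  proof -
    have "u differentiable (at x)" using u that unfolding C1_on_def by blast
    then show ?thesis
      by (simp add: grad_mult[OF _ C1c_differentiable[OF \<psi>]] inner_add_left)
  qed
  have "(LINT x|lebesgue_on \<Omega>. grad ?w x \<bullet> v) = (LINT x|lborel. grad ?w x \<bullet> v)"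
    by (rule lebesgue_on_integral_eq_lborel(1)[OF \<Omega>m])
       (auto intro!: borel_measurable_continuous_onI continuous_intros C1_on_grad[OF C1c_C1_on[OF w]]
          simp: C1c_grad_outside[OF w])
  also have "\<dots> = 0" by (rule integral_grad_eq_0[OF w])
  finally have "(LINT x|lebesgue_on \<Omega>. u x * (grad \<psi> x \<bullet> v) + (grad u x \<bullet> v) * \<psi> x) = 0"
    by (subst (asm) Bochner_Integration.integral_cong[OF refl g]) simp_all
  then show "(LINT x|lebesgue_on \<Omega>. u x * (grad \<psi> x \<bullet> v)) = - (LINT x|lebesgue_on \<Omega>. (grad u x \<bullet> v) * \<psi> x)"
    using i1 i2 by simp
qed

lemma has_weak_gradient_C1:
  assumes "open \<Omega>" "C1_on \<Omega> u" shows "has_weak_gradient \<Omega> u (grad u)"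
  unfolding has_weak_gradient_def
  using continuous_locally_integrable[OF C1_on_continuous[OF assms(2)]]
    continuous_locally_integrable[OF C1_on_grad[OF assms(2)]]
    C1_integration_by_parts(3)[OF assms test_functions_C1c]
  by (simp add: grad_inner_Basis[symmetric])

text \<open>
  The indicator of \<open>K\<close> is the pointwise limit of continuous cut-offs of the
  distance to \<open>K\<close>, and these are uniformly close to test functions that live in a
  fixed compact neighbourhood of \<open>K\<close>; so dominated convergence applies.
\<close>

lemma locally_integrable_compact_integral_0:
  fixes w :: "'a::euclidean_space \<Rightarrow> real"
  assumes \<Omega>: "open \<Omega>" and w: "locally_integrable \<Omega> w"
    and 0: "\<And>\<phi>. \<phi> \<in> test_functions \<Omega> \<Longrightarrow> (LINT x|lebesgue_on \<Omega>. w x * \<phi> x) = 0"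
    and K: "compact K" "K \<subseteq> \<Omega>"
  shows "(LINT x|lebesgue. indicator K x * w x) = 0"
proof (cases "K = {}")
  case False
  note \<Omega>m = open_sets_lebesgue[OF \<Omega>]
  obtain \<rho> where \<rho>: "\<rho> > 0" "(\<Union>x\<in>K. cball x \<rho>) \<subseteq> \<Omega>"
    by (rule compact_subset_open_imp_cball_epsilon_subset[OF K(1) \<Omega> K(2)]) auto
  define U where "U = {x. infdist x K < \<rho>}"
  define T where "T = {x. infdist x K \<le> \<rho>}"
  have T: "compact T" unfolding T_def by (rule compact_infdist_le[OF False K(1) \<rho>(1)])
  have T\<Omega>: "T \<subseteq> \<Omega>"
  proof
    fix x assume "x \<in> T"
    obtain k where "k \<in> K" "infdist x K = dist x k"
      using infdist_attains_inf[OF compact_imp_closed[OF K(1)] False] by blast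
    then have "x \<in> cball k \<rho>" using \<open>x \<in> T\<close> by (simp add: T_def dist_commute)
    then show "x \<in> \<Omega>" using \<rho>(2) \<open>k \<in> K\<close> by blast
  qed
  have U: "open U" unfolding U_def
    by (intro open_Collect_less continuous_intros)
  define \<psi> where "\<psi> n x = max 0 (1 - (real n + 2) / \<rho> * infdist x K)" for n x
  have \<psi>c: "continuous_on UNIV (\<psi> n)" for n unfolding \<psi>_def by (intro continuous_intros)
  have S: "compact {x. infdist x K \<le> \<rho>/2}" using compact_infdist_le[OF False K(1), of "\<rho>/2"] \<rho>(1) by simp
  have "\<psi> n x = 0" if "x \<notin> {x. infdist x K \<le> \<rho>/2}" for n x
  proof -
    have "infdist x K \<ge> \<rho>/2" using that by simp
    have "1 \<le> (real n + 2) / 2" by simp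
    also have "\<dots> = (real n + 2) / \<rho> * (\<rho>/2)" using \<rho>(1) by simp
    also have "\<dots> \<le> (real n + 2) / \<rho> * infdist x K"
      by (rule mult_left_mono[OF \<open>infdist x K \<ge> \<rho>/2\<close>]) (use \<rho>(1) in simp)
    finally show ?thesis unfolding \<psi>_def by simp
  qed
  note \<psi>0 = this
  have SU: "{x. infdist x K \<le> \<rho>/2} \<subseteq> U" using \<rho>(1) by (auto simp: U_def)
  have "\<exists>\<phi>. \<phi> \<in> test_functions U \<and> (\<forall>x. \<bar>\<phi> x - \<psi> n x\<bar> \<le> 1 / real (Suc n))" for n
    using test_function_approximation[OF \<psi>c S \<psi>0 U SU, of "1 / real (Suc n)" n] by auto
  then have "\<exists>\<phi>. \<forall>n. \<phi> n \<in> test_functions U \<and> (\<forall>x. \<bar>\<phi> n x - \<psi> n x\<bar> \<le> 1 / real (Suc n))"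
    by (intro choice allI)
  then obtain \<phi> where \<phi>: "\<And>n. \<phi> n \<in> test_functions U" "\<And>n x. \<bar>\<phi> n x - \<psi> n x\<bar> \<le> 1 / real (Suc n)"
    by blast
  have UT: "U \<subseteq> T" by (auto simp: U_def T_def)
  have \<phi>0: "\<phi> n x = 0" if "x \<notin> T" for n x
    using C1c_outside[OF test_functions_C1c[OF \<phi>(1)]] that UT by blast
  have \<phi>\<Omega>: "\<phi> n \<in> test_functions \<Omega>" for n
    using \<phi>(1)[of n] UT T\<Omega> unfolding test_functions_def by blast
  have \<phi>m: "\<phi> n \<in> borel_measurable lebesgue" for n
    by (rule continuous_lebesgue_measurable[OF C1_on_continuous[OF C1c_C1_on[OF test_functions_C1c[OF \<phi>(1)]]]])
  have wi: "integrable lebesgue (\<lambda>x. indicator T x * w x)"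
    using w T T\<Omega> unfolding locally_integrable_def set_integrable_def by simp
  have b: "\<bar>\<phi> n x\<bar> \<le> 2" for n x
  proof -
    have "\<bar>\<psi> n x\<bar> \<le> 1" using infdist_nonneg[of x K] \<rho>(1) by (simp add: \<psi>_def)
    moreover have "1 / real (Suc n) \<le> 1" by simp
    ultimately show ?thesis using \<phi>(2)[of n x] by linarith
  qed
  have "(\<lambda>n. LINT x|lebesgue. (indicator T x * w x) * \<phi> n x) \<longlonglongrightarrow> (LINT x|lebesgue. indicator K x * w x)"
  proof (rule integral_dominated_convergence[where w = "\<lambda>x. 2 * \<bar>indicator T x * w x\<bar>"])
    have "integrable lebesgue (\<lambda>x. indicator K x * w x)"
      using w K unfolding locally_integrable_def set_integrable_def by simp
    then show "(\<lambda>x. indicator K x * w x) \<in> borel_measurable lebesgue" by (rule borel_measurable_integrable)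
    show "(\<lambda>x. (indicator T x * w x) * \<phi> n x) \<in> borel_measurable lebesgue" for n
      by (rule borel_measurable_times[OF borel_measurable_integrable[OF wi] \<phi>m])
    show "integrable lebesgue (\<lambda>x. 2 * \<bar>indicator T x * w x\<bar>)" using wi by simp
    show "AE x in lebesgue. norm (indicator T x * w x * \<phi> n x) \<le> 2 * \<bar>indicator T x * w x\<bar>" for n
    proof (rule AE_I2)
      fix x show "norm (indicator T x * w x * \<phi> n x) \<le> 2 * \<bar>indicator T x * w x\<bar>"
        using mult_left_mono[OF b[of n x] abs_ge_zero[of "indicator T x * w x"]]
        by (simp only: real_norm_def abs_mult mult.commute)
    qed
    have lim: "(\<lambda>n. \<phi> n x) \<longlonglongrightarrow> indicator K x" for x
    proof -
      have "(\<lambda>n. \<phi> n x - \<psi> n x) \<longlonglongrightarrow> 0"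
        by (rule Lim_null_comparison[OF _ LIMSEQ_Suc[OF lim_1_over_n]]) (use \<phi>(2) in auto)
      moreover have "(\<lambda>n. \<psi> n x) \<longlonglongrightarrow> indicator K x"
      proof (cases "x \<in> K")
        case True then show ?thesis by (simp add: \<psi>_def)
      next
        case False
        then have p: "infdist x K > 0"
          using in_closed_iff_infdist_zero[OF compact_imp_closed[OF K(1)] \<open>K \<noteq> {}\<close>] infdist_nonneg[of x K]
          by (simp add: less_le)
        obtain N where N: "real N > \<rho> / infdist x K" using reals_Archimedean2 by blast
        have "\<psi> n x = 0" if "n \<ge> N" for n
        proof -
          have "real n + 2 \<ge> \<rho> / infdist x K" using N that by linarith
          then have "(real n + 2) / \<rho> * infdist x K \<ge> 1" using p \<rho>(1) by (simp add: field_simps)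
          then show ?thesis by (simp add: \<psi>_def)
        qed
        then have "(\<lambda>n. \<psi> n x) \<longlonglongrightarrow> 0"
          by (intro tendsto_eventually) (auto simp: eventually_sequentially)
        then show ?thesis using False by simp
      qed
      ultimately have "(\<lambda>n. (\<phi> n x - \<psi> n x) + \<psi> n x) \<longlonglongrightarrow> 0 + indicator K x" by (rule tendsto_add)
      then show ?thesis by simp
    qed
    have "(\<lambda>n. indicator T x * w x * \<phi> n x) \<longlonglongrightarrow> indicator T x * w x * indicator K x" for x
      by (intro tendsto_mult lim tendsto_const)
    moreover have "indicator T x * w x * indicator K x = indicator K x * w x" for x
      using \<rho>(1) by (auto simp: indicator_def T_def)
    ultimately show "AE x in lebesgue. (\<lambda>n. indicator T x * w x * \<phi> n x) \<longlonglongrightarrow> indicator K x * w x" by simp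
  qed
  moreover have "(LINT x|lebesgue. (indicator T x * w x) * \<phi> n x) = 0" for n
  proof -
    have "(LINT x|lebesgue. (indicator T x * w x) * \<phi> n x) = (LINT x|lebesgue. indicator \<Omega> x *\<^sub>R (w x * \<phi> n x))"
      by (rule Bochner_Integration.integral_cong) (use T\<Omega> \<phi>0 in \<open>auto simp: indicator_def\<close>)
    also have "\<dots> = (LINT x|lebesgue_on \<Omega>. w x * \<phi> n x)"
      using \<Omega>m by (simp add: integral_restrict_space)
    finally show ?thesis using 0[OF \<phi>\<Omega>] by simp
  qed
  ultimately show ?thesis by (simp add: LIMSEQ_const_iff)
qed simp

text \<open>
  If \<open>w\<close> were positive on a set of positive measure, inner regularity would give a
  compact subset on which its integral is positive.
\<close>

lemma AE_nonpos_if_compact_integrals_0: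
  fixes w :: "'a::euclidean_space \<Rightarrow> real"
  assumes C: "compact C" and wi: "integrable lebesgue (\<lambda>x. indicator C x * w x)"
    and 0: "\<And>K. compact K \<Longrightarrow> K \<subseteq> C \<Longrightarrow> (LINT x|lebesgue. indicator K x * w x) = 0"
  shows "AE x in lebesgue. x \<in> C \<longrightarrow> w x \<le> 0"
proof -
  define E where "E = {x. indicator C x * w x > 0}"
  have E: "E \<in> sets lebesgue"
  proof -
    have "(\<lambda>x. indicator C x * w x) -` {0<..} \<inter> space lebesgue \<in> sets lebesgue"
      by (rule measurable_sets[OF borel_measurable_integrable[OF wi]]) simp
    moreover have "(\<lambda>x. indicator C x * w x) -` {0<..} \<inter> space lebesgue = E"
      by (auto simp: E_def)
    ultimately show ?thesis by simp
  qed
  have EC: "x \<in> C" "w x > 0" if "x \<in> E" for x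
    using that by (cases "x \<in> C"; simp add: E_def)+
  have "emeasure lebesgue E \<le> ennreal e" if "e > 0" for e
  proof -
    obtain T where T: "closed T" "T \<subseteq> E" "E - T \<in> lmeasurable" "emeasure lebesgue (E - T) < ennreal e"
      using sets_lebesgue_inner_closed[OF E \<open>e > 0\<close>] by blast
    have TC: "T \<subseteq> C" using T(2) EC(1) by blast
    then have cT: "compact T" using C T(1) compact_Int_closed[OF C T(1)] by (simp add: Int_absorb1)
    have Tm: "T \<in> sets lebesgue" using T(1) by (simp add: borel_closed sets_completionI_sets)
    have eq: "(\<lambda>x. indicator T x * w x) = (\<lambda>x. indicator T x *\<^sub>R (indicator C x * w x))"
      using TC by (intro ext) (auto split: split_indicator)
    have "integrable lebesgue (\<lambda>x. indicator T x * w x)"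
      unfolding eq using integrable_mult_indicator[OF Tm wi] .
    moreover have nn: "indicator T x * w x \<ge> 0" for x
      using T(2) EC(2)[of x] by (cases "x \<in> T") auto
    ultimately have "AE x in lebesgue. indicator T x * w x = 0"
      using integral_nonneg_eq_0_iff_AE[of lebesgue "\<lambda>x. indicator T x * w x"] 0[OF cT TC] by simp
    then have "AE x in lebesgue. x \<notin> T"
    proof eventually_elim
      case (elim x)
      then show ?case using T(2) EC(2)[of x] by (cases "x \<in> T") auto
    qed
    then have "T \<in> null_sets lebesgue" using Tm using AE_iff_null_sets[OF Tm] by simp
    have "emeasure lebesgue E \<le> emeasure lebesgue (T \<union> (E - T))"
      by (rule emeasure_mono) (use Tm E in auto)
    also have "\<dots> \<le> emeasure lebesgue T + emeasure lebesgue (E - T)"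
      by (rule emeasure_subadditive) (use Tm E in auto)
    also have "\<dots> \<le> ennreal e" using \<open>T \<in> null_sets lebesgue\<close> T(4) by (simp add: null_setsD1)
    finally show ?thesis .
  qed
  note le = this
  have "emeasure lebesgue E \<le> 0"
  proof (rule ennreal_le_epsilon)
    fix e :: real assume "0 < e"
    show "emeasure lebesgue E \<le> 0 + ennreal e" unfolding add_0_left by (rule le[OF \<open>0 < e\<close>])
  qed
  then have "emeasure lebesgue E = 0" by (simp only: le_zero_eq)
  then have "E \<in> null_sets lebesgue" using E by (rule null_setsI)
  then have "AE x in lebesgue. x \<notin> E" using AE_iff_null_sets[OF E] by blast
  then show ?thesis
  proof eventually_elim
    case (elim x)
    then show ?case by (cases "x \<in> C") (auto simp: E_def)
  qed
qed

lemma fundamental_lemma_calculus_of_variations: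
  fixes w :: "'a::euclidean_space \<Rightarrow> real"
  assumes \<Omega>: "open \<Omega>" and w: "locally_integrable \<Omega> w"
    and 0: "\<And>\<phi>. \<phi> \<in> test_functions \<Omega> \<Longrightarrow> (LINT x|lebesgue_on \<Omega>. w x * \<phi> x) = 0"
  shows "AE x in lebesgue_on \<Omega>. w x = 0"
proof -
  have *: "AE x in lebesgue. x \<in> C \<longrightarrow> w x = 0" if C: "compact C" "C \<subseteq> \<Omega>" for C
  proof -
    have wi: "integrable lebesgue (\<lambda>x. indicator C x * w x)"
      using w C unfolding locally_integrable_def set_integrable_def by simp
    have z: "(LINT x|lebesgue. indicator K x * w x) = 0" if "compact K" "K \<subseteq> C" for K
      by (rule locally_integrable_compact_integral_0[OF \<Omega> w 0 that(1)]) (use that C in auto)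
    have 1: "AE x in lebesgue. x \<in> C \<longrightarrow> w x \<le> 0"
      by (rule AE_nonpos_if_compact_integrals_0[OF C(1) wi z])
    have 2: "AE x in lebesgue. x \<in> C \<longrightarrow> - w x \<le> 0"
      by (rule AE_nonpos_if_compact_integrals_0[OF C(1)]) (use wi z in auto)
    show ?thesis using 1 2 by eventually_elim auto
  qed
  obtain D where D: "countable D" "D \<subseteq> Pow \<Omega>" "\<And>X. X \<in> D \<Longrightarrow> \<exists>a b. X = cbox a b" "\<Union>D = \<Omega>"
    by (rule open_countable_Union_open_cbox[OF \<Omega>]) auto
  have "AE x in lebesgue. \<forall>C\<in>D. x \<in> C \<longrightarrow> w x = 0"
    unfolding AE_ball_countable[OF D(1)] 
  proof
    fix C assume "C \<in> D"
    then have "C \<subseteq> \<Omega>" "compact C" using D(2) D(3)[of C] compact_cbox by auto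
    then show "AE x in lebesgue. x \<in> C \<longrightarrow> w x = 0" using * by blast
  qed
  then have "AE x in lebesgue. x \<in> \<Omega> \<longrightarrow> w x = 0"
    by eventually_elim (use D(4) in auto)
  then show ?thesis using open_sets_lebesgue[OF \<Omega>] by (simp add: AE_restrict_space_iff)
qed

text \<open>
  Apply the fundamental lemma to each component of the difference.
\<close>

lemma weak_gradient_unique:
  fixes u :: "'a::euclidean_space \<Rightarrow> real"
  assumes \<Omega>: "open \<Omega>" and v: "has_weak_gradient \<Omega> u v" "has_weak_gradient \<Omega> u v'"
  shows "AE x in lebesgue_on \<Omega>. v x = v' x"
proof -
  note \<Omega>m = open_sets_lebesgue[OF \<Omega>]
  have "AE x in lebesgue_on \<Omega>. v x \<bullet> i - v' x \<bullet> i = 0" if i: "i \<in> Basis" for i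
  proof (rule fundamental_lemma_calculus_of_variations[OF \<Omega>])
    have l: "locally_integrable \<Omega> (\<lambda>x. v x \<bullet> i)" "locally_integrable \<Omega> (\<lambda>x. v' x \<bullet> i)"
      using v unfolding has_weak_gradient_def locally_integrable_def set_integrable_def
      by (auto simp flip: inner_scaleR_left simp del: inner_scaleR_left)
    then show "locally_integrable \<Omega> (\<lambda>x. v x \<bullet> i - v' x \<bullet> i)"
      unfolding locally_integrable_def by (auto intro: set_integral_diff)
    fix \<phi> assume \<phi>: "\<phi> \<in> test_functions \<Omega>"
    then obtain K where K: "compact K" "K \<subseteq> \<Omega>" "\<And>x. x \<notin> K \<Longrightarrow> \<phi> x = 0" unfolding test_functions_iff by blast
    have c: "continuous_on UNIV \<phi>" using C1_on_continuous[OF C1c_C1_on[OF test_functions_C1c[OF \<phi>]]] .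
    have "integrable (lebesgue_on \<Omega>) (\<lambda>x. (v x \<bullet> i) * \<phi> x)" "integrable (lebesgue_on \<Omega>) (\<lambda>x. (v' x \<bullet> i) * \<phi> x)"
      using locally_integrable_mult_compact[OF l(1) \<Omega>m c K] locally_integrable_mult_compact[OF l(2) \<Omega>m c K] by auto
    moreover have "(LINT x|lebesgue_on \<Omega>. (v x \<bullet> i) * \<phi> x) = (LINT x|lebesgue_on \<Omega>. (v' x \<bullet> i) * \<phi> x)"
    proof -
      have "(LINT x|lebesgue_on \<Omega>. u x * partial_deriv i \<phi> x) = - (LINT x|lebesgue_on \<Omega>. (v x \<bullet> i) * \<phi> x)"
        "(LINT x|lebesgue_on \<Omega>. u x * partial_deriv i \<phi> x) = - (LINT x|lebesgue_on \<Omega>. (v' x \<bullet> i) * \<phi> x)"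
        using v \<phi> i unfolding has_weak_gradient_def by blast+
      then show ?thesis by linarith
    qed
    ultimately show "(LINT x|lebesgue_on \<Omega>. (v x \<bullet> i - v' x \<bullet> i) * \<phi> x) = 0"
      by (simp add: left_diff_distrib)
  qed
  then have "AE x in lebesgue_on \<Omega>. \<forall>i\<in>Basis. v x \<bullet> i - v' x \<bullet> i = 0"
    by (simp add: AE_finite_all)
  then show ?thesis by eventually_elim (auto intro: euclidean_eqI)
qed

lemma continuous_measurable_lebesgue_on:
  fixes f :: "'a::euclidean_space \<Rightarrow> 'b::euclidean_space"
  assumes "open \<Omega>" "continuous_on \<Omega> f" shows "f \<in> borel_measurable (lebesgue_on \<Omega>)"
  by (rule continuous_imp_measurable_on_sets_lebesgue[OF assms(2) open_sets_lebesgue[OF assms(1)]])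

lemma finite_lebesgue_on: "open \<Omega> \<Longrightarrow> bounded \<Omega> \<Longrightarrow> finite_measure (lebesgue_on (\<Omega>::'a::euclidean_space set))"
  by (intro finite_measure_lebesgue_on bounded_set_imp_lmeasurable open_sets_lebesgue)

lemma integrable_lebesgue_on_bounded:
  fixes f :: "'a::euclidean_space \<Rightarrow> real"
  assumes "open \<Omega>" "bounded \<Omega>" "f \<in> borel_measurable (lebesgue_on \<Omega>)"
    and "AE x in lebesgue_on \<Omega>. \<bar>f x\<bar> \<le> B"
  shows "integrable (lebesgue_on \<Omega>) f"
  by (rule finite_measure.integrable_const_bound[OF finite_lebesgue_on[OF assms(1,2)], of f B])
     (use assms(3,4) in simp_all)

lemma has_weak_gradient_weak_gradient:
  assumes "open \<Omega>" "C1_on \<Omega> u" shows "has_weak_gradient \<Omega> u (weak_gradient \<Omega> u)"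
  unfolding weak_gradient_def by (rule someI[of "has_weak_gradient \<Omega> u", OF has_weak_gradient_C1[OF assms]])

text \<open>
  The energy and the \<open>H\<^sup>1\<close> norm are defined with an arbitrary choice of weak
  gradient; this lemma reduces them to classical gradients.
\<close>

lemma weak_gradient_AE_grad:
  assumes "open \<Omega>" "C1_on \<Omega> u"
  shows "AE x in lebesgue_on \<Omega>. weak_gradient \<Omega> u x = grad u x"
  by (rule weak_gradient_unique[OF assms(1) has_weak_gradient_weak_gradient[OF assms] has_weak_gradient_C1[OF assms]])

lemma weak_gradient_measurable:
  assumes "open \<Omega>" "C1_on \<Omega> u"
  shows "weak_gradient \<Omega> u \<in> borel_measurable (lebesgue_on \<Omega>)"
proof (rule AE_eq_measurable_lebesgue_on[OF open_sets_lebesgue[OF assms(1)]])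
  show "grad u \<in> borel_measurable (lebesgue_on \<Omega>)"
    by (rule continuous_measurable_lebesgue_on[OF assms(1) C1_on_grad[OF assms(2)]])
  show "AE x in lebesgue_on \<Omega>. grad u x = weak_gradient \<Omega> u x"
    using weak_gradient_AE_grad[OF assms] by eventually_elim simp
qed

section \<open>Perturbations inside the Sobolev space\<close>

text \<open>
  The integrand of the squared \<open>H\<^sup>1\<close> norm, with the classical gradient.
\<close>

definition H1_density :: "('a::euclidean_space \<Rightarrow> real) \<Rightarrow> 'a \<Rightarrow> real" where
  "H1_density u x = (u x)\<^sup>2 + (norm (grad u x))\<^sup>2"

lemma H1_density_continuous: "C1_on \<Omega> u \<Longrightarrow> continuous_on \<Omega> (H1_density u)"
  unfolding H1_density_def by (intro continuous_intros C1_on_continuous C1_on_grad)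

lemma H1_norm_C1:
  assumes "open \<Omega>" "C1_on \<Omega> u"
  shows "H1_norm \<Omega> u = sqrt (LINT x|lebesgue_on \<Omega>. H1_density u x)"
proof -
  have m: "weak_gradient \<Omega> u \<in> borel_measurable (lebesgue_on \<Omega>)" "u \<in> borel_measurable (lebesgue_on \<Omega>)"
    "grad u \<in> borel_measurable (lebesgue_on \<Omega>)"
    by (intro weak_gradient_measurable continuous_measurable_lebesgue_on C1_on_continuous C1_on_grad assms)+
  have "(LINT x|lebesgue_on \<Omega>. (u x)\<^sup>2 + (norm (weak_gradient \<Omega> u x))\<^sup>2) = (LINT x|lebesgue_on \<Omega>. H1_density u x)"
    unfolding H1_density_def
  proof (rule integral_cong_AE)
    show "AE x in lebesgue_on \<Omega>. (u x)\<^sup>2 + (norm (weak_gradient \<Omega> u x))\<^sup>2 = (u x)\<^sup>2 + (norm (grad u x))\<^sup>2"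
      using weak_gradient_AE_grad[OF assms] by eventually_elim simp
  qed (use m in measurable)
  then show ?thesis unfolding H1_norm_def by simp
qed

lemma H1_C1_iff:
  assumes "open \<Omega>" "C1_on \<Omega> u"
  shows "u \<in> H1 \<Omega> \<longleftrightarrow> integrable (lebesgue_on \<Omega>) (H1_density u)"
proof
  have m: "u \<in> borel_measurable (lebesgue_on \<Omega>)" "grad u \<in> borel_measurable (lebesgue_on \<Omega>)"
    by (intro continuous_measurable_lebesgue_on C1_on_continuous C1_on_grad assms)+
  {
    assume "u \<in> H1 \<Omega>"
    then obtain v where u: "square_integrable \<Omega> u" and v: "has_weak_gradient \<Omega> u v" "square_integrable \<Omega> v"
      unfolding H1_def by blast
    have "integrable (lebesgue_on \<Omega>) (\<lambda>x. (norm (grad u x))\<^sup>2)"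
    proof (rule integrable_cong_AE_imp)
      show "integrable (lebesgue_on \<Omega>) (\<lambda>x. (norm (v x))\<^sup>2)" using v(2) unfolding square_integrable_def by simp
      show "(\<lambda>x. (norm (grad u x))\<^sup>2) \<in> borel_measurable (lebesgue_on \<Omega>)" using m by measurable
      show "AE x in lebesgue_on \<Omega>. (norm (v x))\<^sup>2 = (norm (grad u x))\<^sup>2"
        using weak_gradient_unique[OF assms(1) v(1) has_weak_gradient_C1[OF assms]] by eventually_elim simp
    qed
    then show "integrable (lebesgue_on \<Omega>) (H1_density u)"
      using u unfolding H1_density_def square_integrable_def by simp
  }
  assume i: "integrable (lebesgue_on \<Omega>) (H1_density u)"
  have "integrable (lebesgue_on \<Omega>) (\<lambda>x. (u x)\<^sup>2)"
    by (rule Bochner_Integration.integrable_bound[OF i])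
       (use m in \<open>auto simp: H1_density_def\<close>)
  moreover have "integrable (lebesgue_on \<Omega>) (\<lambda>x. (norm (grad u x))\<^sup>2)"
    by (rule Bochner_Integration.integrable_bound[OF i])
       (use m in \<open>auto simp: H1_density_def\<close>)
  ultimately have "square_integrable \<Omega> u" "square_integrable \<Omega> (grad u)"
    using m unfolding square_integrable_def by auto
  then show "u \<in> H1 \<Omega>" unfolding H1_def using has_weak_gradient_C1[OF assms] by blast
qed

lemma norm_add_sq_le: "(norm (p + q))\<^sup>2 \<le> 2 * (norm p)\<^sup>2 + 2 * (norm q)\<^sup>2" for p q :: "'a::real_inner"
  using inner_ge_zero[of "p - q"]
  by (simp add: power2_norm_eq_inner inner_simps inner_commute)

lemma H1_density_add:
  assumes \<Omega>: "open \<Omega>" and a: "C1_on \<Omega> a" "integrable (lebesgue_on \<Omega>) (H1_density a)"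
    and b: "C1_on \<Omega> b" "integrable (lebesgue_on \<Omega>) (H1_density b)"
  shows "integrable (lebesgue_on \<Omega>) (H1_density (\<lambda>x. a x + b x))"
    and "(LINT x|lebesgue_on \<Omega>. H1_density (\<lambda>x. a x + b x) x)
      \<le> 2 * (LINT x|lebesgue_on \<Omega>. H1_density a x) + 2 * (LINT x|lebesgue_on \<Omega>. H1_density b x)"
proof -
  let ?s = "\<lambda>x. 2 * H1_density a x + 2 * H1_density b x"
  have le: "H1_density (\<lambda>x. a x + b x) x \<le> ?s x" if "x \<in> \<Omega>" for x
  proof -
    have "grad (\<lambda>x. a x + b x) x = grad a x + grad b x"
      using a(1) b(1) that unfolding C1_on_def by (intro grad_add) auto
    moreover have "(a x + b x)\<^sup>2 \<le> 2 * (a x)\<^sup>2 + 2 * (b x)\<^sup>2"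
      using norm_add_sq_le[of "a x" "b x"] by simp
    ultimately show ?thesis
      using norm_add_sq_le[of "grad a x" "grad b x"] by (simp add: H1_density_def)
  qed
  have i: "integrable (lebesgue_on \<Omega>) ?s" using a(2) b(2) by simp
  have m: "H1_density (\<lambda>x. a x + b x) \<in> borel_measurable (lebesgue_on \<Omega>)"
    by (intro continuous_measurable_lebesgue_on H1_density_continuous C1_on_add \<Omega> a b)
  show j: "integrable (lebesgue_on \<Omega>) (H1_density (\<lambda>x. a x + b x))"
  proof (rule Bochner_Integration.integrable_bound[OF i m], rule AE_I2)
    fix x assume "x \<in> space (lebesgue_on \<Omega>)"
    then have "x \<in> \<Omega>" by simp
    moreover have "H1_density (\<lambda>x. a x + b x) x \<ge> 0" by (simp add: H1_density_def)
    ultimately show "norm (H1_density (\<lambda>x. a x + b x) x) \<le> norm (?s x)" using le[of x] by simp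
  qed
  have "(LINT x|lebesgue_on \<Omega>. H1_density (\<lambda>x. a x + b x) x) \<le> (LINT x|lebesgue_on \<Omega>. ?s x)"
    by (rule integral_mono[OF j i]) (use le in simp)
  also have "\<dots> = 2 * (LINT x|lebesgue_on \<Omega>. H1_density a x) + 2 * (LINT x|lebesgue_on \<Omega>. H1_density b x)"
    using a(2) b(2) by simp
  finally show "(LINT x|lebesgue_on \<Omega>. H1_density (\<lambda>x. a x + b x) x)
      \<le> 2 * (LINT x|lebesgue_on \<Omega>. H1_density a x) + 2 * (LINT x|lebesgue_on \<Omega>. H1_density b x)" .
qed

lemma H1_density_C1c_integrable:
  assumes \<Omega>: "open \<Omega>" "bounded \<Omega>" and \<xi>: "\<xi> \<in> C1c \<Omega>"
  shows "integrable (lebesgue_on \<Omega>) (H1_density \<xi>)"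
proof -
  obtain B where B: "B > 0" "\<And>x. \<bar>\<xi> x\<bar> \<le> B" "\<And>x. norm (grad \<xi> x) \<le> B"
    by (rule C1c_bounded[OF \<xi>]) auto
  have "\<bar>H1_density \<xi> x\<bar> \<le> B\<^sup>2 + B\<^sup>2" for x
  proof -
    have "(\<xi> x)\<^sup>2 \<le> B\<^sup>2" using power_mono[OF B(2)[of x] abs_ge_zero, of 2] by simp
    moreover have "(norm (grad \<xi> x))\<^sup>2 \<le> B\<^sup>2" using B(3)[of x] by (intro power_mono) auto
    ultimately show ?thesis unfolding H1_density_def by simp
  qed
  then show ?thesis
    by (intro integrable_lebesgue_on_bounded[OF \<Omega>, of _ "B\<^sup>2 + B\<^sup>2"] AE_I2 continuous_measurable_lebesgue_on
        H1_density_continuous \<Omega> C1c_C1_on[OF \<xi>]) auto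
qed

text \<open>
  If \<open>\<phi>\<close> approximates \<open>u\<close> and \<open>\<phi>'\<close> approximates
  \<open>\<xi>\<close> uniformly with its first derivatives, then \<open>\<phi> +
  \<phi>'\<close> approximates \<open>u + \<xi>\<close> in \<open>H\<^sup>1\<close>, because
  \<open>\<Omega>\<close> is bounded.
\<close>

lemma H1_0_add_C1c:
  assumes \<Omega>: "open \<Omega>" "bounded \<Omega>" and u: "u \<in> H1_0 \<Omega>" "C1_on \<Omega> u" and \<xi>: "\<xi> \<in> C1c \<Omega>"
  shows "(\<lambda>x. u x + \<xi> x) \<in> H1_0 \<Omega>"
  unfolding H1_0_def
proof (intro CollectI conjI allI impI)
  note \<xi>1 = C1c_C1_on[OF \<xi>]
  have uH: "u \<in> H1 \<Omega>" using u(1) unfolding H1_0_def by blast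
  have ui: "integrable (lebesgue_on \<Omega>) (H1_density u)" using uH H1_C1_iff[OF \<Omega>(1) u(2)] by simp
  show "(\<lambda>x. u x + \<xi> x) \<in> H1 \<Omega>"
    using H1_density_add(1)[OF \<Omega>(1) u(2) ui \<xi>1 H1_density_C1c_integrable[OF \<Omega> \<xi>]]
      H1_C1_iff[OF \<Omega>(1) C1_on_add[OF u(2) \<xi>1]] by simp
  fix \<epsilon> :: real assume \<epsilon>: "\<epsilon> > 0"
  obtain \<phi> where \<phi>: "\<phi> \<in> test_functions \<Omega>" "H1_norm \<Omega> (\<lambda>x. u x - \<phi> x) < \<epsilon> / 2"
    using u(1) half_gt_zero[OF \<epsilon>] unfolding H1_0_def by blast
  note \<phi>c = test_functions_C1c[OF \<phi>(1)]
  let ?a = "\<lambda>x. u x - \<phi> x"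
  have a1: "C1_on \<Omega> ?a" by (rule C1_on_diff[OF u(2) C1c_C1_on[OF \<phi>c]])
  have ai: "integrable (lebesgue_on \<Omega>) (H1_density ?a)"
    using H1_density_add(1)[OF \<Omega>(1) u(2) ui C1c_C1_on[OF C1c_cmult[OF \<phi>c, of "-1"]]
        H1_density_C1c_integrable[OF \<Omega> C1c_cmult[OF \<phi>c, of "-1"]]] by simp
  have Ea: "(LINT x|lebesgue_on \<Omega>. H1_density ?a x) < (\<epsilon>/2)\<^sup>2"
  proof -
    have "(LINT x|lebesgue_on \<Omega>. H1_density ?a x) \<ge> 0"
      by (rule Bochner_Integration.integral_nonneg_AE) (simp add: H1_density_def)
    moreover have "sqrt (LINT x|lebesgue_on \<Omega>. H1_density ?a x) < \<epsilon>/2"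
      using \<phi>(2) H1_norm_C1[OF \<Omega>(1) a1] by simp
    ultimately show ?thesis
      using real_less_rsqrt[of "\<epsilon>/2"] sqrt_le_D \<epsilon> by (metis abs_of_pos half_gt_zero less_eq_real_def not_le real_sqrt_abs real_sqrt_less_iff)
  qed
  \<comment> \<open>The summand 1 keeps \<open>c\<close> positive; with \<open>\<delta> =
    \<epsilon>/(2 c)\<close> the \<open>H\<^sup>1\<close> norm of the difference of
    \<open>\<xi>\<close> and its approximation is at most \<open>\<epsilon>/2\<close>.\<close>
  define c where "c = measure (lebesgue_on \<Omega>) \<Omega> * (1 + real DIM('a)) + 1"
  have c: "c \<ge> 1" unfolding c_def by simp
  define \<delta> where "\<delta> = \<epsilon> / (2 * c)"
  have \<delta>: "\<delta> > 0" using \<epsilon> c by (simp add: \<delta>_def)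
  obtain K where K: "compact K" "K \<subseteq> \<Omega>" "\<And>x. x \<notin> K \<Longrightarrow> \<xi> x = 0" using \<xi> unfolding C1c_def by blast
  obtain \<phi>' where \<phi>': "\<phi>' \<in> test_functions \<Omega>" "\<And>x. \<bar>\<phi>' x - \<xi> x\<bar> \<le> \<delta>"
      "\<And>i x. i \<in> Basis \<Longrightarrow> \<bar>partial_deriv i \<phi>' x - partial_deriv i \<xi> x\<bar> \<le> \<delta>"
    using test_function_approximation[OF C1_on_continuous[OF \<xi>1] K(1,3) \<Omega>(1) K(2) \<delta>] \<xi>1 by blast
  note \<phi>'c = test_functions_C1c[OF \<phi>'(1)]
  let ?b = "\<lambda>x. \<xi> x - \<phi>' x"
  have b1: "C1_on \<Omega> ?b" by (rule C1_on_diff[OF \<xi>1 C1c_C1_on[OF \<phi>'c]])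
  have bi: "integrable (lebesgue_on \<Omega>) (H1_density ?b)"
    using H1_density_C1c_integrable[OF \<Omega> C1c_add[OF \<xi> C1c_cmult[OF \<phi>'c, of "-1"]]] by simp
  have bd: "H1_density ?b x \<le> (1 + real DIM('a)) * \<delta>\<^sup>2" for x
  proof -
    have g: "grad ?b x = grad \<xi> x - grad \<phi>' x"
      by (rule grad_diff[OF C1c_differentiable[OF \<xi>] C1c_differentiable[OF \<phi>'c]])
    have "(norm (grad ?b x))\<^sup>2 = (\<Sum>i\<in>Basis. (grad ?b x \<bullet> i)\<^sup>2)"
      unfolding power2_norm_eq_inner by (subst euclidean_inner) (simp only: power2_eq_square)
    also have "\<dots> \<le> (\<Sum>i\<in>(Basis::'a set). \<delta>\<^sup>2)"
    proof (rule sum_mono)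
      fix i :: 'a assume i: "i \<in> Basis"
      have "\<bar>grad ?b x \<bullet> i\<bar> \<le> \<bar>\<delta>\<bar>"
        using \<phi>'(3)[OF i, of x] \<delta> by (simp add: g inner_diff_left grad_inner_Basis[OF i] abs_minus_commute)
      then show "(grad ?b x \<bullet> i)\<^sup>2 \<le> \<delta>\<^sup>2" by (simp add: abs_le_square_iff)
    qed
    also have "\<dots> = real DIM('a) * \<delta>\<^sup>2" by simp
    finally have "(norm (grad ?b x))\<^sup>2 \<le> real DIM('a) * \<delta>\<^sup>2" .
    moreover have "(?b x)\<^sup>2 \<le> \<delta>\<^sup>2"
      using power_mono[OF \<phi>'(2)[of x] abs_ge_zero, of 2] by (simp add: power2_commute)
    ultimately show ?thesis unfolding H1_density_def by (simp add: distrib_right)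
  qed
  have "(LINT x|lebesgue_on \<Omega>. H1_density ?b x) \<le> (LINT x|lebesgue_on \<Omega>. (1 + real DIM('a)) * \<delta>\<^sup>2)"
    by (rule integral_mono[OF bi]) (use bd finite_measure.integrable_const[OF finite_lebesgue_on[OF \<Omega>]] in auto)
  also have "\<dots> = (c - 1) * \<delta>\<^sup>2" by (simp add: c_def)
  finally have Eb: "(LINT x|lebesgue_on \<Omega>. H1_density ?b x) \<le> (c - 1) * \<delta>\<^sup>2" .
  have "(c - 1) * \<delta>\<^sup>2 \<le> c * \<delta>\<^sup>2" by (simp add: mult_right_mono)
  also have "\<dots> = (\<epsilon>/2)\<^sup>2 / c" using c by (simp add: \<delta>_def power2_eq_square field_simps)
  also have "\<dots> \<le> (\<epsilon>/2)\<^sup>2" using c by (simp add: divide_le_eq mult_left_mono[of 1 c "(\<epsilon>/2)\<^sup>2", simplified])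
  finally have d: "(c - 1) * \<delta>\<^sup>2 \<le> (\<epsilon>/2)\<^sup>2" .
  have ab: "(\<lambda>x. ?a x + ?b x) = (\<lambda>x. u x + \<xi> x - (\<phi> x + \<phi>' x))" by auto
  have "H1_norm \<Omega> (\<lambda>x. ?a x + ?b x) = sqrt (LINT x|lebesgue_on \<Omega>. H1_density (\<lambda>x. ?a x + ?b x) x)"
    by (rule H1_norm_C1[OF \<Omega>(1) C1_on_add[OF a1 b1]])
  also have "\<dots> < sqrt (\<epsilon>\<^sup>2)"
  proof (rule real_sqrt_less_mono)
    have "(LINT x|lebesgue_on \<Omega>. H1_density (\<lambda>x. ?a x + ?b x) x)
      \<le> 2 * (LINT x|lebesgue_on \<Omega>. H1_density ?a x) + 2 * (LINT x|lebesgue_on \<Omega>. H1_density ?b x)"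
      by (rule H1_density_add(2)[OF \<Omega>(1) a1 ai b1 bi])
    also have "\<dots> < 2 * (\<epsilon>/2)\<^sup>2 + 2 * (\<epsilon>/2)\<^sup>2" using Ea Eb d by linarith
    also have "\<dots> = \<epsilon>\<^sup>2" by (simp add: power2_eq_square)
    finally show "(LINT x|lebesgue_on \<Omega>. H1_density (\<lambda>x. ?a x + ?b x) x) < \<epsilon>\<^sup>2" .
  qed
  also have "\<dots> = \<epsilon>" using \<epsilon> by simp
  finally have "H1_norm \<Omega> (\<lambda>x. u x + \<xi> x - (\<phi> x + \<phi>' x)) < \<epsilon>" unfolding ab .
  then show "\<exists>\<phi>\<in>test_functions \<Omega>. H1_norm \<Omega> (\<lambda>x. u x + \<xi> x - \<phi> x) < \<epsilon>"
    by (rule bexI[OF _ test_functions_add[OF \<phi>(1) \<phi>'(1)]])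
qed

section \<open>Superposition operators and primitives\<close>

lemma floor_approx_LIMSEQ: "(\<lambda>n. of_int \<lfloor>real (Suc n) * t\<rfloor> / real (Suc n)) \<longlonglongrightarrow> t"
proof -
  let ?r = "\<lambda>n. of_int \<lfloor>real (Suc n) * t\<rfloor> / real (Suc n)"
  have "\<bar>?r n - t\<bar> \<le> 1 / real (Suc n)" for n
  proof -
    have "\<bar>of_int \<lfloor>real (Suc n) * t\<rfloor> - real (Suc n) * t\<bar> \<le> 1" by linarith
    moreover have "?r n - t = (of_int \<lfloor>real (Suc n) * t\<rfloor> - real (Suc n) * t) / real (Suc n)"
      by (simp add: field_simps)
    ultimately show ?thesis by (simp add: abs_divide divide_right_mono)
  qed
  then have "(\<lambda>n. ?r n - t) \<longlonglongrightarrow> 0"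
    by (intro Lim_null_comparison[OF _ LIMSEQ_Suc[OF lim_1_over_n]]) auto
  then show ?thesis by (simp add: LIM_zero_iff)
qed

text \<open>
  Approximate \<open>u\<close> by functions with countably many values; for these the
  superposition is measurable piece by piece.
\<close>

lemma caratheodory_measurable:
  fixes u :: "'a::euclidean_space \<Rightarrow> real"
  assumes \<Omega>: "\<Omega> \<in> sets lebesgue" and q: "caratheodory \<Omega> q" and u: "u \<in> borel_measurable (lebesgue_on \<Omega>)"
  shows "(\<lambda>x. q x (u x)) \<in> borel_measurable (lebesgue_on \<Omega>)"
proof -
  define r where "r n t = of_int \<lfloor>real (Suc n) * t\<rfloor> / real (Suc n)" for n t
  define U where "U n x = q x (r n (u x))" for n x
  have Um: "U n \<in> borel_measurable (lebesgue_on \<Omega>)" for n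
    unfolding U_def r_def
  proof (rule measurable_compose_countable'[where I = "UNIV :: int set"
        and f = "\<lambda>k x. q x (of_int k / real (Suc n))" and g = "\<lambda>x. \<lfloor>real (Suc n) * u x\<rfloor>"])
    show "(\<lambda>x. q x (of_int k / real (Suc n))) \<in> borel_measurable (lebesgue_on \<Omega>)" for k
      using q unfolding caratheodory_def by blast
    show "(\<lambda>x. \<lfloor>real (Suc n) * u x\<rfloor>) \<in> measurable (lebesgue_on \<Omega>) (count_space UNIV)"
      using u by measurable
  qed simp
  have rl: "(\<lambda>n. r n t) \<longlonglongrightarrow> t" for t
    unfolding r_def by (rule floor_approx_LIMSEQ)
  show ?thesis
  proof (rule AE_eq_measurable_lebesgue_on[OF \<Omega>])
    show "(\<lambda>x. lim (\<lambda>n. U n x)) \<in> borel_measurable (lebesgue_on \<Omega>)"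
      by (rule borel_measurable_lim_metric[OF Um])
    have "AE x in lebesgue_on \<Omega>. continuous_on UNIV (q x)" using q unfolding caratheodory_def by blast
    then show "AE x in lebesgue_on \<Omega>. lim (\<lambda>n. U n x) = q x (u x)"
    proof eventually_elim
      case (elim x)
      then have "isCont (q x) (u x)" by (simp add: continuous_on_eq_continuous_at)
      then have "(\<lambda>n. q x (r n (u x))) \<longlonglongrightarrow> q x (u x)"
        using rl by (rule isCont_tendsto_compose)
      then show ?case unfolding U_def by (rule limI)
    qed
  qed
qed

lemma DERIV_primitive:
  assumes "continuous_on UNIV (q x)"
  shows "(primitive q x has_real_derivative q x t) (at t)"
proof -
  let ?a = "- \<bar>t\<bar> - 1" and ?b = "\<bar>t\<bar> + 1"
  have "((\<lambda>u. LBINT y=ereal 0..ereal u. q x y) has_vector_derivative (q x t)) (at t within {?a..?b})"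
    by (rule interval_integral_FTC2) (use assms continuous_on_subset in auto)
  moreover have "at t within {?a..?b} = at t"
    by (rule at_within_interior) (simp, linarith)
  ultimately have "((\<lambda>u. LBINT y=ereal 0..ereal u. q x y) has_vector_derivative (q x t)) (at t)"
    by simp
  moreover have "primitive q x = (\<lambda>u. LBINT y=ereal 0..ereal u. q x y)"
    by (rule ext) (simp add: primitive_def zero_ereal_def)
  ultimately show ?thesis by (simp add: has_real_derivative_iff_has_vector_derivative)
qed

lemma primitive_0: "primitive q x 0 = 0"
  unfolding primitive_def zero_ereal_def by (rule interval_integral_endpoints_same)

text \<open>
  The approximations of \<open>q\<close> that are piecewise constant in \<open>s\<close> are
  jointly measurable in \<open>(x, s)\<close>. Hence so is their limit, which agrees with
  \<open>q\<close> at almost every \<open>x\<close>, and its integrals in \<open>s\<close> are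
  measurable in \<open>x\<close>. With \<open>caratheodory_measurable\<close> the integrands of
  the energy and of the constraint are measurable.
\<close>

lemma caratheodory_primitive:
  fixes q :: "'a::euclidean_space \<Rightarrow> real \<Rightarrow> real"
  assumes \<Omega>: "\<Omega> \<in> sets lebesgue" and q: "caratheodory \<Omega> q"
  shows "caratheodory \<Omega> (primitive q)"
proof -
  let ?M = "lebesgue_on \<Omega>"
  define r where "r n t = of_int \<lfloor>real (Suc n) * t\<rfloor> / real (Suc n)" for n t
  define U where "U n z = q (fst z) (r n (snd z))" for n z
  define Q where "Q z = lim (\<lambda>n. U n z)" for z
  have Um: "U n \<in> borel_measurable (?M \<Otimes>\<^sub>M lborel)" for n
    unfolding U_def r_def
  proof (rule measurable_compose_countable'[where I = "UNIV :: int set"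
        and f = "\<lambda>k z. q (fst z) (of_int k / real (Suc n))" and g = "\<lambda>z. \<lfloor>real (Suc n) * snd z\<rfloor>"])
    show "(\<lambda>z. q (fst z) (of_int k / real (Suc n))) \<in> borel_measurable (?M \<Otimes>\<^sub>M lborel)" for k
      by (rule measurable_compose[OF measurable_fst]) (use q in \<open>simp add: caratheodory_def\<close>)
    show "(\<lambda>z. \<lfloor>real (Suc n) * snd z\<rfloor>) \<in> measurable (?M \<Otimes>\<^sub>M lborel) (count_space UNIV)"
      by measurable
  qed simp
  have Qm: "Q \<in> borel_measurable (?M \<Otimes>\<^sub>M lborel)"
    unfolding Q_def by (rule borel_measurable_lim_metric[OF Um])
  have rl: "(\<lambda>n. r n t) \<longlonglongrightarrow> t" for t
    unfolding r_def by (rule floor_approx_LIMSEQ)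
  have ae: "AE x in ?M. continuous_on UNIV (q x)" using q unfolding caratheodory_def by blast
  have Qq: "Q (x, s) = q x s" if "continuous_on UNIV (q x)" for x s
  proof -
    have "isCont (q x) s" using that by (simp add: continuous_on_eq_continuous_at)
    then have "(\<lambda>n. q x (r n s)) \<longlonglongrightarrow> q x s" using rl by (rule isCont_tendsto_compose)
    then show ?thesis unfolding Q_def U_def by (simp add: limI)
  qed
  have Lm: "(\<lambda>x. LINT s|lborel. indicator E s *\<^sub>R Q (x, s)) \<in> borel_measurable ?M" if E: "E \<in> sets borel" for E
  proof (rule lborel.borel_measurable_lebesgue_integral)
    have "(\<lambda>z. indicator E (snd z) *\<^sub>R Q z) \<in> borel_measurable (?M \<Otimes>\<^sub>M lborel)"
      using Qm E by measurable
    then show "(\<lambda>(x, s). indicator E s *\<^sub>R Q (x, s)) \<in> borel_measurable (?M \<Otimes>\<^sub>M lborel)"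
      by (simp add: split_beta')
  qed
  have "(\<lambda>x. primitive q x t) \<in> borel_measurable ?M" for t
  proof -
    define c where "c = (if (0::ereal) \<le> ereal t then 1 else (-1::real))"
    define E where "E = (if (0::ereal) \<le> ereal t then einterval 0 (ereal t) else einterval (ereal t) 0)"
    have E: "E \<in> sets borel" unfolding E_def by simp
    have p: "primitive q x t = c * (LINT s|lborel. indicator E s *\<^sub>R q x s)" for x
      unfolding primitive_def interval_lebesgue_integral_def set_lebesgue_integral_def c_def E_def by simp
    show ?thesis
    proof (rule AE_eq_measurable_lebesgue_on[OF \<Omega>])
      show "(\<lambda>x. c * (LINT s|lborel. indicator E s *\<^sub>R Q (x, s))) \<in> borel_measurable ?M"
        using Lm[OF E] by measurable
      show "AE x in ?M. c * (LINT s|lborel. indicator E s *\<^sub>R Q (x, s)) = primitive q x t"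
        using ae by eventually_elim (simp add: p Qq)
    qed
  qed
  moreover have "AE x in ?M. continuous_on UNIV (primitive q x)"
    using ae
  proof eventually_elim
    case (elim x)
    then show ?case
      using DERIV_primitive[of q x] by (meson DERIV_isCont continuous_at_imp_continuous_on)
  qed
  ultimately show ?thesis unfolding caratheodory_def by blast
qed

lemma subcritical_growth_bounded:
  assumes "subcritical_growth \<Omega> q"
  obtains B where "B > 0" "AE x in lebesgue_on \<Omega>. \<forall>t\<in>{-M..M}. \<bar>q x t\<bar> \<le> B"
proof -
  obtain C r where C: "C > 0" "r > 1"
      and ae: "AE x in lebesgue_on \<Omega>. \<forall>t. \<bar>q x t\<bar> \<le> C * (\<bar>t\<bar> powr (r - 1) + 1)"
    using assms unfolding subcritical_growth_def by blast
  have "AE x in lebesgue_on \<Omega>. \<forall>t\<in>{-M..M}. \<bar>q x t\<bar> \<le> C * (\<bar>M\<bar> powr (r - 1) + 1)"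
    using ae
  proof eventually_elim
    case (elim x)
    show ?case
    proof
      fix t assume "t \<in> {-M..M}"
      then have "\<bar>t\<bar> \<le> \<bar>M\<bar>" by auto
      then have "\<bar>t\<bar> powr (r - 1) \<le> \<bar>M\<bar> powr (r - 1)" using C(2) by (intro powr_mono2) auto
      then have "C * (\<bar>t\<bar> powr (r - 1) + 1) \<le> C * (\<bar>M\<bar> powr (r - 1) + 1)" using C(1) by simp
      then show "\<bar>q x t\<bar> \<le> C * (\<bar>M\<bar> powr (r - 1) + 1)" using elim by (meson order_trans)
    qed
  qed
  moreover have "C * (\<bar>M\<bar> powr (r - 1) + 1) > 0" using C(1) by (simp add: add_nonneg_pos)
  ultimately show thesis using that by blast
qed

lemma primitive_increment:
  assumes c: "continuous_on UNIV (q x)" and b: "\<forall>t\<in>{-M..M}. \<bar>q x t\<bar> \<le> B"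
    and "s \<in> {-M..M}" "t \<in> {-M..M}"
  shows "\<bar>primitive q x t - primitive q x s\<bar> \<le> B * \<bar>t - s\<bar>"
proof -
  have "norm (primitive q x t - primitive q x s) \<le> B * norm (t - s)"
    by (rule field_differentiable_bound[of "{-M..M}"])
       (use assms in \<open>auto intro!: DERIV_subset[OF DERIV_primitive[of q x, OF c]]\<close>)
  then show ?thesis by simp
qed

lemma primitive_taylor:
  assumes c: "continuous_on UNIV (q x)" and l: "\<forall>s\<in>{-M..M}. \<forall>t\<in>{-M..M}. \<bar>q x s - q x t\<bar> \<le> L * \<bar>s - t\<bar>"
    and s: "s \<in> {-M..M}" and t: "t \<in> {-M..M}" and L: "L \<ge> 0"
  shows "\<bar>primitive q x t - primitive q x s - q x s * (t - s)\<bar> \<le> L * (t - s)\<^sup>2"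
proof -
  let ?k = "\<lambda>r. primitive q x r - q x s * r"
  have seg: "r \<in> {-M..M}" "\<bar>r - s\<bar> \<le> \<bar>t - s\<bar>" if "r \<in> closed_segment s t" for r
    using that s t by (auto simp: closed_segment_eq_real_ivl split: if_splits)
  have "norm (?k t - ?k s) \<le> (L * \<bar>t - s\<bar>) * norm (t - s)"
  proof (rule field_differentiable_bound[of "closed_segment s t" _ "\<lambda>r. q x r - q x s"])
    fix r assume r: "r \<in> closed_segment s t"
    show "(?k has_field_derivative q x r - q x s) (at r within closed_segment s t)"
      by (rule DERIV_subset) (auto intro!: derivative_eq_intros DERIV_primitive[of q x, OF c])
    have "\<bar>q x r - q x s\<bar> \<le> L * \<bar>r - s\<bar>" using l s seg(1)[OF r] by blast
    also have "\<dots> \<le> L * \<bar>t - s\<bar>" by (rule mult_left_mono[OF seg(2)[OF r] L])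
    finally show "norm (q x r - q x s) \<le> L * \<bar>t - s\<bar>" by simp
  qed auto
  moreover have "L * \<bar>t - s\<bar> * norm (t - s) = L * (t - s)\<^sup>2"
    by (simp add: power2_eq_square mult.assoc)
  moreover have "?k t - ?k s = primitive q x t - primitive q x s - q x s * (t - s)"
    by (simp add: algebra_simps)
  ultimately show ?thesis by (simp only: real_norm_def)
qed

section \<open>Reflections\<close>

definition reflect :: "'a::euclidean_space \<Rightarrow> 'a \<Rightarrow> 'a" where
  "reflect e x = x - (2 * (x \<bullet> e)) *\<^sub>R e"

lemma reflect_linear: "linear (reflect e)"
  unfolding reflect_def by (rule linearI) (simp_all add: inner_simps algebra_simps)

lemma reflect_inner: "norm e = 1 \<Longrightarrow> reflect e x \<bullet> y = x \<bullet> reflect e y"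
  by (simp add: reflect_def inner_simps inner_commute)

lemma reflect_involution: "norm e = 1 \<Longrightarrow> reflect e (reflect e x) = x"
  by (simp add: reflect_def inner_simps norm_eq_1)

lemma reflect_norm: "norm e = 1 \<Longrightarrow> norm (reflect e x) = norm x"
  by (metis norm_eq reflect_inner reflect_involution)

lemma reflect_inner_axis: "norm e = 1 \<Longrightarrow> reflect e x \<bullet> e = - (x \<bullet> e)"
  by (simp add: reflect_def inner_simps norm_eq_1)

lemma reflect_minus_axis: "reflect (- e) x = reflect e x"
  by (simp add: reflect_def)

lemma reflect_continuous: "continuous_on S (reflect e)"
  unfolding reflect_def by (intro continuous_intros)

text \<open>
  Unions of spheres centred at the origin, which all reflections in hyperplanes through the
  origin preserve.
\<close>

definition radial_set :: "'a::real_normed_vector set \<Rightarrow> bool" where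
  "radial_set \<Omega> \<longleftrightarrow> (\<forall>x y. norm x = norm y \<longrightarrow> (x \<in> \<Omega> \<longleftrightarrow> y \<in> \<Omega>))"

lemma reflect_mem: "radial_set \<Omega> \<Longrightarrow> norm e = 1 \<Longrightarrow> reflect e x \<in> \<Omega> \<longleftrightarrow> x \<in> \<Omega>"
  unfolding radial_set_def using reflect_norm by blast

lemma C1_on_reflect:
  assumes \<Omega>: "radial_set \<Omega>" and e: "norm e = 1" and v: "C1_on \<Omega> v"
  shows "C1_on \<Omega> (\<lambda>x. v (reflect e x))"
    and "x \<in> \<Omega> \<Longrightarrow> grad (\<lambda>x. v (reflect e x)) x = reflect e (grad v (reflect e x))"
proof -
  have D: "GDERIV (\<lambda>x. v (reflect e x)) x :> reflect e (grad v (reflect e x))" if "x \<in> \<Omega>" for x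
  proof -
    have 1: "(v has_derivative (\<lambda>h. h \<bullet> grad v (reflect e x))) (at (reflect e x))"
      using C1_onD[OF v] reflect_mem[OF \<Omega> e, of x] that unfolding gderiv_def by blast
    have 2: "(reflect e has_derivative reflect e) (at x)"
      by (rule linear_imp_has_derivative[OF reflect_linear])
    show ?thesis
      using has_derivative_compose[OF 2 1] unfolding gderiv_def by (simp add: reflect_inner[OF e])
  qed
  show "C1_on \<Omega> (\<lambda>x. v (reflect e x))"
  proof (rule C1_onI[OF D])
    show "continuous_on \<Omega> (\<lambda>x. reflect e (grad v (reflect e x)))"
      by (rule continuous_on_compose2[OF reflect_continuous[of UNIV] continuous_on_compose2[OF C1_on_grad[OF v] reflect_continuous]])
         (use reflect_mem[OF \<Omega> e] in auto)
  qed
  show "x \<in> \<Omega> \<Longrightarrow> grad (\<lambda>x. v (reflect e x)) x = reflect e (grad v (reflect e x))"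
    by (rule grad_eqI[OF D])
qed

lemma C1_on_sum:
  assumes "finite I" "\<And>j. j \<in> I \<Longrightarrow> C1_on S (v j)"
  shows "C1_on S (\<lambda>x. \<Sum>j\<in>I. c j * v j x)"
    and "x \<in> S \<Longrightarrow> grad (\<lambda>x. \<Sum>j\<in>I. c j * v j x) x = (\<Sum>j\<in>I. c j *\<^sub>R grad (v j) x)"
proof -
  have "C1_on S (\<lambda>x. \<Sum>j\<in>I. c j * v j x) \<and>
     (\<forall>x\<in>S. grad (\<lambda>x. \<Sum>j\<in>I. c j * v j x) x = (\<Sum>j\<in>I. c j *\<^sub>R grad (v j) x))"
    using assms
  proof (induction I)
    case empty
    then show ?case using C1_on_const grad_eqI[OF GDERIV_const] by auto
  next
    case (insert k I)
    let ?r = "\<lambda>x. \<Sum>j\<in>I. c j * v j x"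
    have r: "C1_on S ?r" "\<And>x. x \<in> S \<Longrightarrow> grad ?r x = (\<Sum>j\<in>I. c j *\<^sub>R grad (v j) x)"
      using insert by auto
    have k: "C1_on S (\<lambda>x. c k * v k x)" by (rule C1_on_cmult) (use insert in auto)
    have "grad (\<lambda>x. c k * v k x + ?r x) x = c k *\<^sub>R grad (v k) x + (\<Sum>j\<in>I. c j *\<^sub>R grad (v j) x)" if x: "x \<in> S" for x
    proof -
      have "v k differentiable (at x)" using insert.prems x unfolding C1_on_def by blast
      then show ?thesis
        using grad_add[of "\<lambda>x. c k * v k x" x ?r] k r x grad_cmult[of "v k" x "c k"]
        unfolding C1_on_def by auto
    qed
    then show ?case using C1_on_add[OF k r(1)] insert by simp
  qed
  then show "C1_on S (\<lambda>x. \<Sum>j\<in>I. c j * v j x)"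
    "x \<in> S \<Longrightarrow> grad (\<lambda>x. \<Sum>j\<in>I. c j * v j x) x = (\<Sum>j\<in>I. c j *\<^sub>R grad (v j) x)" by auto
qed

lemma grad_cong_open:
  assumes "open S" "x \<in> S" "\<And>y. y \<in> S \<Longrightarrow> u y = v y" "C1_on S u"
  shows "grad v x = grad u x"
  by (rule grad_eqI[OF GDERIV_cong_open[OF assms(1-3) C1_onD[OF assms(4,2)]]])

definition C2_on :: "'a::euclidean_space set \<Rightarrow> ('a \<Rightarrow> real) \<Rightarrow> bool" where
  "C2_on \<Omega> u \<longleftrightarrow> C1_on \<Omega> u \<and> (\<forall>i\<in>Basis. C1_on \<Omega> (partial_deriv i u))"

lemma Ck_on_2_C2_on: "Ck_on 2 \<Omega> u \<Longrightarrow> C2_on \<Omega> u"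
proof -
  assume "Ck_on 2 \<Omega> u"
  then have *: "Ck_on (Suc (Suc 0)) \<Omega> u" by (simp only: numeral_2_eq_2)
  have "C1_on \<Omega> u" using Ck_on_SucD[OF *] unfolding Ck_on_1_iff .
  moreover have "C1_on \<Omega> (partial_deriv i u)" if "i \<in> Basis" for i
    using * that unfolding Ck_on_1_iff[symmetric] by (meson Ck_on.simps(2))
  ultimately show ?thesis unfolding C2_on_def by blast
qed

lemma laplacian_grad: "laplacian u x = (\<Sum>i\<in>Basis. grad (partial_deriv i u) x \<bullet> i)"
  unfolding laplacian_def by (simp add: grad_inner_Basis)

text \<open>
  The Laplacian is the trace of the Hessian \<open>D\<close>. Composing with
  \<open>\<sigma>\<close> replaces \<open>D\<close> by \<open>\<sigma> D \<sigma>\<close>, and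
  since \<open>\<sigma>\<close> is self-adjoint and an involution the trace is unchanged.
\<close>

lemma C2_on_reflect:
  fixes u :: "'a::euclidean_space \<Rightarrow> real"
  assumes \<Omega>: "open \<Omega>" "radial_set \<Omega>" and e: "norm e = 1" and u: "C2_on \<Omega> u"
  shows "C2_on \<Omega> (\<lambda>x. u (reflect e x))"
    and "x \<in> \<Omega> \<Longrightarrow> laplacian (\<lambda>x. u (reflect e x)) x = laplacian u (reflect e x)"
proof -
  let ?s = "reflect e" and ?u = "\<lambda>x. u (reflect e x)"
  have u1: "C1_on \<Omega> u" and u2: "\<And>i. i \<in> Basis \<Longrightarrow> C1_on \<Omega> (partial_deriv i u)"
    using u unfolding C2_on_def by auto
  define w where "w i x = (\<Sum>j\<in>Basis. (?s i \<bullet> j) * partial_deriv j u (?s x))" for i x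
  have w: "C1_on \<Omega> (w i)" for i
    unfolding w_def by (rule C1_on_sum(1)) (auto intro: C1_on_reflect(1)[OF \<Omega>(2) e] u2)
  have gw: "grad (w i) x = (\<Sum>j\<in>Basis. (?s i \<bullet> j) *\<^sub>R ?s (grad (partial_deriv j u) (?s x)))" if "x \<in> \<Omega>" for i x
  proof -
    have "grad (w i) x = (\<Sum>j\<in>Basis. (?s i \<bullet> j) *\<^sub>R grad (\<lambda>x. partial_deriv j u (?s x)) x)"
      unfolding w_def by (rule C1_on_sum(2)[OF _ _ that]) (auto intro: C1_on_reflect(1)[OF \<Omega>(2) e] u2)
    also have "\<dots> = (\<Sum>j\<in>Basis. (?s i \<bullet> j) *\<^sub>R ?s (grad (partial_deriv j u) (?s x)))"
      by (rule sum.cong) (simp_all add: C1_on_reflect(2)[OF \<Omega>(2) e u2 that])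
    finally show ?thesis .
  qed
  have pw: "partial_deriv i ?u x = w i x" if "x \<in> \<Omega>" "i \<in> Basis" for i x
  proof -
    have "partial_deriv i ?u x = grad u (?s x) \<bullet> ?s i"
      using C1_on_reflect(2)[OF \<Omega>(2) e u1 that(1)] grad_inner_Basis[OF that(2), of ?u x]
      by (simp add: reflect_inner[OF e])
    also have "\<dots> = (\<Sum>j\<in>Basis. (grad u (?s x) \<bullet> j) * (?s i \<bullet> j))" by (rule euclidean_inner)
    also have "\<dots> = w i x" unfolding w_def
      by (rule sum.cong) (simp_all add: grad_inner_Basis)
    finally show ?thesis .
  qed
  have p1: "C1_on \<Omega> (partial_deriv i ?u)" if "i \<in> Basis" for i
    by (rule C1_on_cong_open[OF \<Omega>(1) _ w]) (simp add: pw that)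
  show "C2_on \<Omega> ?u" unfolding C2_on_def using C1_on_reflect(1)[OF \<Omega>(2) e u1] p1 by blast
  assume x: "x \<in> \<Omega>"
  let ?H = "\<lambda>j. grad (partial_deriv j u) (?s x)"
  have gp: "grad (partial_deriv i ?u) x = grad (w i) x" if "i \<in> Basis" for i
    by (rule grad_cong_open[OF \<Omega>(1) x _ w]) (simp add: pw that)
  have "laplacian ?u x = (\<Sum>i\<in>Basis. grad (w i) x \<bullet> i)"
    unfolding laplacian_grad by (rule sum.cong) (simp_all add: gp)
  also have "\<dots> = (\<Sum>i\<in>Basis. \<Sum>j\<in>Basis. (?s i \<bullet> j) * (?H j \<bullet> ?s i))"
    by (simp add: gw[OF x] inner_sum_left reflect_inner[OF e])
  also have "\<dots> = (\<Sum>j\<in>Basis. \<Sum>i\<in>Basis. (?s (?H j) \<bullet> i) * (?s j \<bullet> i))"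
  proof -
    have "(?s i \<bullet> j) * (?H j \<bullet> ?s i) = (?s (?H j) \<bullet> i) * (?s j \<bullet> i)" for i j
      by (metis inner_commute mult.commute reflect_inner[OF e])
    then show ?thesis by (subst sum.swap) simp
  qed
  also have "\<dots> = (\<Sum>j\<in>Basis. ?s (?H j) \<bullet> ?s j)"
    by (simp only: euclidean_inner[symmetric])
  also have "\<dots> = laplacian u (?s x)"
    unfolding laplacian_grad by (simp add: reflect_inner[OF e] reflect_involution[OF e])
  finally show "laplacian ?u x = laplacian u (?s x)" .
qed

text \<open>
  Differentiable maps between spaces of equal dimension preserve null sets.
\<close>

lemma AE_reflect:
  fixes \<Omega> :: "'a::euclidean_space set"
  assumes \<Omega>: "\<Omega> \<in> sets lebesgue" "radial_set \<Omega>" and e: "norm e = 1"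
    and P: "AE x in lebesgue_on \<Omega>. P x"
  shows "AE x in lebesgue_on \<Omega>. P (reflect e x)"
proof -
  have iff: "(AE x in lebesgue_on \<Omega>. Q x) \<longleftrightarrow> negligible {x. \<not> (x \<in> \<Omega> \<longrightarrow> Q x)}" for Q
  proof -
    have "(AE x in lebesgue_on \<Omega>. Q x) \<longleftrightarrow> (AE x in lebesgue. x \<in> \<Omega> \<longrightarrow> Q x)"
      using \<Omega>(1) by (simp add: AE_restrict_space_iff)
    then show ?thesis
      by (simp add: completion.AE_iff_null_sets negligible_iff_null_sets)
  qed
  have "negligible (reflect e ` {x. \<not> (x \<in> \<Omega> \<longrightarrow> P x)})"
    by (rule negligible_differentiable_image_negligible[OF order_refl])
       (use P iff in \<open>auto intro!: linear_imp_differentiable_on reflect_linear\<close>)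
  moreover have "{x. \<not> (x \<in> \<Omega> \<longrightarrow> P (reflect e x))} \<subseteq> reflect e ` {x. \<not> (x \<in> \<Omega> \<longrightarrow> P x)}"
  proof
    fix x assume "x \<in> {x. \<not> (x \<in> \<Omega> \<longrightarrow> P (reflect e x))}"
    then have "reflect e x \<in> {x. \<not> (x \<in> \<Omega> \<longrightarrow> P x)}" using reflect_mem[OF \<Omega>(2) e] by blast
    then show "x \<in> reflect e ` {x. \<not> (x \<in> \<Omega> \<longrightarrow> P x)}"
      using reflect_involution[OF e, of x] by (metis imageI)
  qed
  ultimately show ?thesis unfolding iff by (rule negligible_subset)
qed

section \<open>Weak form of the equation and cut-offs\<close>

lemma green_identity:
  fixes v \<kappa> :: "'a::euclidean_space \<Rightarrow> real"
  assumes \<Omega>: "open \<Omega>" and v: "C2_on \<Omega> v" and \<kappa>: "\<kappa> \<in> C1c \<Omega>"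
  shows "integrable (lebesgue_on \<Omega>) (\<lambda>x. grad v x \<bullet> grad \<kappa> x)"
    and "integrable (lebesgue_on \<Omega>) (\<lambda>x. laplacian v x * \<kappa> x)"
    and "(LINT x|lebesgue_on \<Omega>. grad v x \<bullet> grad \<kappa> x) = - (LINT x|lebesgue_on \<Omega>. laplacian v x * \<kappa> x)"
proof -
  have v2: "\<And>i. i \<in> Basis \<Longrightarrow> C1_on \<Omega> (partial_deriv i v)" using v unfolding C2_on_def by auto
  note ibp = C1_integration_by_parts[OF \<Omega> v2 \<kappa>]
  have eq: "(\<lambda>x. grad v x \<bullet> grad \<kappa> x) = (\<lambda>x. \<Sum>i\<in>Basis. partial_deriv i v x * (grad \<kappa> x \<bullet> i))"
    by (rule ext, subst euclidean_inner) (simp add: grad_inner_Basis)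
  have eq2: "(\<lambda>x. laplacian v x * \<kappa> x) = (\<lambda>x. \<Sum>i\<in>Basis. (grad (partial_deriv i v) x \<bullet> i) * \<kappa> x)"
    by (simp add: laplacian_grad sum_distrib_right)
  show "integrable (lebesgue_on \<Omega>) (\<lambda>x. grad v x \<bullet> grad \<kappa> x)" unfolding eq using ibp(1) by simp
  show "integrable (lebesgue_on \<Omega>) (\<lambda>x. laplacian v x * \<kappa> x)" unfolding eq2 using ibp(2) by simp
  show "(LINT x|lebesgue_on \<Omega>. grad v x \<bullet> grad \<kappa> x) = - (LINT x|lebesgue_on \<Omega>. laplacian v x * \<kappa> x)"
    unfolding eq eq2 by (simp add: ibp sum_negf)
qed

lemma weak_form:
  fixes v \<kappa> w :: "'a::euclidean_space \<Rightarrow> real"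
  assumes \<Omega>: "open \<Omega>" and v: "C2_on \<Omega> v" and \<kappa>: "\<kappa> \<in> C1c \<Omega>"
    and w: "w \<in> borel_measurable (lebesgue_on \<Omega>)" and eq: "AE x in lebesgue_on \<Omega>. - laplacian v x = w x"
  shows "(LINT x|lebesgue_on \<Omega>. grad v x \<bullet> grad \<kappa> x) = (LINT x|lebesgue_on \<Omega>. w x * \<kappa> x)"
proof -
  have "(LINT x|lebesgue_on \<Omega>. grad v x \<bullet> grad \<kappa> x) = (LINT x|lebesgue_on \<Omega>. - (laplacian v x * \<kappa> x))"
    using green_identity(3)[OF \<Omega> v \<kappa>] by simp
  also have "\<dots> = (LINT x|lebesgue_on \<Omega>. w x * \<kappa> x)"
  proof (rule integral_cong_AE)
    show "(\<lambda>x. - (laplacian v x * \<kappa> x)) \<in> borel_measurable (lebesgue_on \<Omega>)"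
      using borel_measurable_integrable[OF green_identity(2)[OF \<Omega> v \<kappa>]] by measurable
    have "\<kappa> \<in> borel_measurable (lebesgue_on \<Omega>)"
      by (rule continuous_measurable_lebesgue_on[OF \<Omega> C1_on_continuous[OF C1c_C1_on[OF \<kappa>]]])
    with w show "(\<lambda>x. w x * \<kappa> x) \<in> borel_measurable (lebesgue_on \<Omega>)" by (rule borel_measurable_times)
    show "AE x in lebesgue_on \<Omega>. - (laplacian v x * \<kappa> x) = w x * \<kappa> x"
      using eq
    proof eventually_elim
      case (elim x)
      have "- (laplacian v x * \<kappa> x) = (- laplacian v x) * \<kappa> x" by simp
      then show ?case using elim by (simp only:)
    qed
  qed
  finally show ?thesis .
qed

text \<open>
  A function of class \<open>C\<^sup>1\<close> that vanishes below \<open>\<epsilon>\<close> and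
  is within \<open>2 \<epsilon>\<close> of the identity on \<open>[0, \<infinity>)\<close>. Its
  derivative \<open>1 - (\<epsilon>/t)\<^sup>2\<close> lies between 0 and 1, hence dominates its
  own square.
\<close>

definition soft_cut :: "real \<Rightarrow> real \<Rightarrow> real" where
  "soft_cut \<epsilon> t = (if t \<le> \<epsilon> then 0 else (t - \<epsilon>)\<^sup>2 / t)"

lemma DERIV_soft_cut:
  assumes "\<epsilon> > 0" shows "(soft_cut \<epsilon> has_real_derivative (1 - (\<epsilon> / max \<epsilon> t)\<^sup>2)) (at t)"
proof -
  consider "t > \<epsilon>" | "t < \<epsilon>" | "t = \<epsilon>" by linarith
  then show ?thesis
  proof cases
    case 1
    have "((\<lambda>t. (t - \<epsilon>)\<^sup>2 / t) has_real_derivative (1 - (\<epsilon> / max \<epsilon> t)\<^sup>2)) (at t)"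
      using 1 assms by (auto intro!: derivative_eq_intros simp: max_def power2_eq_square field_simps)
    then show ?thesis
      by (rule has_field_derivative_transform_within_open[where S = "{\<epsilon><..}"])
         (use 1 in \<open>auto simp: soft_cut_def\<close>)
  next
    case 2
    have "((\<lambda>t. 0) has_real_derivative (1 - (\<epsilon> / max \<epsilon> t)\<^sup>2)) (at t)"
      using 2 assms by simp
    then show ?thesis
      by (rule has_field_derivative_transform_within_open[where S = "{..<\<epsilon>}"])
         (use 2 in \<open>auto simp: soft_cut_def\<close>)
  next
    case 3
    have "((\<lambda>h. (soft_cut \<epsilon> (\<epsilon> + h) - soft_cut \<epsilon> \<epsilon>) / h) \<longlongrightarrow> 0) (at 0)"
    proof (rule Lim_null_comparison)
      have "norm ((soft_cut \<epsilon> (\<epsilon> + h) - soft_cut \<epsilon> \<epsilon>) / h) \<le> \<bar>h\<bar> / \<epsilon>" for h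
      proof (cases "h > 0")
        case True
        have "h / (\<epsilon> + h) \<le> h / \<epsilon>" by (rule divide_left_mono) (use True assms in auto)
        then show ?thesis using True assms by (simp add: soft_cut_def power2_eq_square)
      qed (use assms in \<open>simp add: soft_cut_def divide_nonpos_pos\<close>)
      then show "\<forall>\<^sub>F h in at 0. norm ((soft_cut \<epsilon> (\<epsilon> + h) - soft_cut \<epsilon> \<epsilon>) / h) \<le> \<bar>h\<bar> / \<epsilon>" by simp
      show "((\<lambda>h. \<bar>h\<bar> / \<epsilon>) \<longlongrightarrow> 0) (at 0)"
        using assms by (auto intro!: tendsto_eq_intros)
    qed
    then show ?thesis using 3 assms by (simp add: DERIV_def)
  qed
qed

lemma soft_cut_bounds:
  assumes "\<epsilon> > 0" "t \<ge> 0"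
  shows "0 \<le> soft_cut \<epsilon> t" "soft_cut \<epsilon> t \<le> t" "t - soft_cut \<epsilon> t \<le> 2 * \<epsilon>"
proof -
  show "0 \<le> soft_cut \<epsilon> t" "soft_cut \<epsilon> t \<le> t"
    using assms by (auto simp: soft_cut_def divide_le_eq power2_eq_square intro!: mult_mono)
  have "t - (t - \<epsilon>)\<^sup>2 / t \<le> 2 * \<epsilon>" if "t > \<epsilon>"
    using that assms by (simp add: field_simps power2_eq_square)
  then show "t - soft_cut \<epsilon> t \<le> 2 * \<epsilon>" using assms by (auto simp: soft_cut_def)
qed

lemma soft_cut_deriv_bounds:
  fixes \<epsilon> :: real
  assumes "\<epsilon> > 0" shows "0 \<le> 1 - (\<epsilon> / max \<epsilon> t)\<^sup>2" "1 - (\<epsilon> / max \<epsilon> t)\<^sup>2 \<le> 1"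
proof -
  have "0 \<le> \<epsilon> / max \<epsilon> t" "\<epsilon> / max \<epsilon> t \<le> 1" using assms by (auto simp: divide_le_eq max_def)
  then have "(\<epsilon> / max \<epsilon> t)\<^sup>2 \<le> 1" by (rule power_le_one)
  then show "0 \<le> 1 - (\<epsilon> / max \<epsilon> t)\<^sup>2" "1 - (\<epsilon> / max \<epsilon> t)\<^sup>2 \<le> 1" by simp_all
qed

lemma soft_cut_deriv_continuous: "(\<epsilon>::real) > 0 \<Longrightarrow> continuous_on S (\<lambda>t. 1 - (\<epsilon> / max \<epsilon> t)\<^sup>2)"
  by (intro continuous_on_diff continuous_on_power continuous_on_divide continuous_on_const
      continuous_on_max continuous_on_id) (auto simp: max_def)

section \<open>Strict convexity\<close>

lemma strictly_convex_three_points: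
  assumes h: "strictly_convex_on S h" and S: "x \<in> S" "z \<in> S" and "x < y" "y < z"
  shows "(z - x) * h y < (z - y) * h x + (y - x) * h z"
proof -
  let ?a = "(z - y) / (z - x)" and ?b = "(y - x) / (z - x)"
  have p: "z - x > 0" using assms by simp
  have "?a * x + ?b * z = ((z - y) * x + (y - x) * z) / (z - x)" by (simp add: add_divide_distrib)
  also have "(z - y) * x + (y - x) * z = y * (z - x)" by (simp add: algebra_simps)
  finally have y: "?a * x + ?b * z = y" using p by simp
  have "?a + ?b = 1" using p by (simp add: add_divide_distrib[symmetric])
  moreover have "?a > 0" "?b > 0" "x \<noteq> z" using assms by auto
  ultimately have "h (?a * x + ?b * z) < ?a * h x + ?b * h z"
    using h S unfolding strictly_convex_on_def by blast
  then have "(z - x) * h y < (z - x) * (?a * h x + ?b * h z)" unfolding y using p by simp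
  also have "\<dots> = (z - y) * h x + (y - x) * h z" using p by (simp add: distrib_left)
  finally show ?thesis .
qed

text \<open>
  The slope of \<open>h\<close> from \<open>a\<close> to a point on the right is at least the
  slope \<open>m\<close> of the chord over \<open>[c, a]\<close>, and the slope from a point of
  \<open>[c, a]\<close> up to \<open>a\<close> is also at least \<open>m\<close>. So the
  second-order Taylor remainder of a primitive of \<open>h\<close> is bounded below by that of a
  parabola with second derivative \<open>m\<close>, on both sides of \<open>a\<close>.
\<close>

lemma strictly_convex_taylor:
  assumes h: "strictly_convex_on S h" and up: "\<And>s t. s \<in> S \<Longrightarrow> s \<le> t \<Longrightarrow> t \<in> S"
    and c: "c \<in> S" "c < a"
    and P: "\<And>r. (P has_real_derivative h r) (at r)"
    and \<xi>: "\<xi> \<ge> c - a"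
  defines "m \<equiv> (h a - h c) / (a - c)"
  shows "P (a + \<xi>) - P a - h a * \<xi> \<ge> 1/2 * m * \<xi>\<^sup>2"
proof -
  \<comment> \<open>The derivative of \<open>k\<close> has the sign of its argument, so
    \<open>k\<close> is minimal at 0.\<close>
  define k where "k \<tau> = P (a + \<tau>) - h a * \<tau> - 1/2 * m * \<tau>\<^sup>2" for \<tau>
  have k: "(k has_real_derivative (h (a + \<tau>) - h a - m * \<tau>)) (at \<tau>)" for \<tau>
    unfolding k_def by (auto intro!: derivative_eq_intros DERIV_chain2[OF P])
  have pos: "h (a + \<tau>) - h a - m * \<tau> \<ge> 0" if "\<tau> \<ge> 0" for \<tau>
  proof (cases "\<tau> = 0")
    case False
    have "a + \<tau> \<in> S" using up[OF c(1)] c(2) that by auto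
    then have "(a + \<tau> - c) * h a < \<tau> * h c + (a - c) * h (a + \<tau>)"
      using strictly_convex_three_points[OF h c(1), of "a + \<tau>" a] c(2) that False by simp
    then have "\<tau> * (h a - h c) \<le> (a - c) * (h (a + \<tau>) - h a)" by (simp add: algebra_simps)
    then show ?thesis unfolding m_def using c(2) by (simp add: field_simps)
  qed simp
  have neg: "h (a + \<tau>) - h a - m * \<tau> \<le> 0" if "\<tau> \<le> 0" "c - a \<le> \<tau>" for \<tau>
  proof (cases "\<tau> = 0 \<or> \<tau> = c - a")
    case False
    have "a \<in> S" using up[OF c(1)] c(2) by simp
    then have "(a - c) * h (a + \<tau>) < (- \<tau>) * h c + (a + \<tau> - c) * h a"
      using strictly_convex_three_points[OF h c(1), of a "a + \<tau>"] that False by simp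
    then have "(a - c) * (h (a + \<tau>) - h a) \<le> \<tau> * (h a - h c)" by (simp add: algebra_simps)
    then show ?thesis unfolding m_def using c(2) by (simp add: field_simps)
  next
    case True
    then show ?thesis unfolding m_def using c(2) by (auto simp: field_simps)
  qed
  have "k 0 \<le> k \<xi>"
  proof (cases "\<xi> \<ge> 0")
    case True
    then show ?thesis by (rule DERIV_nonneg_imp_nondecreasing) (use k pos in blast)
  next
    case False
    then have "\<xi> \<le> 0" by simp
    then show ?thesis
      by (rule DERIV_nonpos_imp_nonincreasing) (use k neg \<xi> in \<open>meson order_trans\<close>)
  qed
  then show ?thesis by (simp add: k_def)
qed

text \<open>
  Use the chord over the upper half of \<open>[b, a]\<close>: its slope exceeds the slope over
  \<open>[b, a]\<close> by \<open>h a + h b - 2 h((a + b)/2)\<close> divided by \<open>a -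
  b\<close>. The bound on \<open>\<alpha>\<close> keeps \<open>a - \<alpha> \<psi>\<close> above
  the midpoint. The term with \<open>\<epsilon>\<close> pays for replacing one factor \<open>a -
  b\<close> by \<open>\<psi>\<close>.
\<close>

lemma convexity_gain:
  assumes h: "strictly_convex_on S h" and up: "\<And>s t. s \<in> S \<Longrightarrow> s \<le> t \<Longrightarrow> t \<in> S"
    and b: "b \<in> S" "b < a"
    and P: "\<And>r. (P has_real_derivative h r) (at r)"
    and L: "\<bar>h a - h ((a + b) / 2)\<bar> \<le> L * \<bar>a - (a + b) / 2\<bar>"
    and \<psi>: "0 \<le> \<psi>" "\<psi> \<le> a - b" "a - b - \<psi> \<le> 2 * \<epsilon>" and \<alpha>: "\<bar>\<alpha>\<bar> \<le> 1/2"
  shows "P (a + - \<alpha> * \<psi>) - P a + h a * (\<alpha> * \<psi>)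
     \<ge> 1/2 * \<alpha>\<^sup>2 * ((h a - h b) * \<psi> + (h a + h b - 2 * h ((a + b) / 2)) * \<psi> - 2 * \<epsilon> * L * \<psi>)"
proof -
  define t where "t = a - b"
  define c where "c = (a + b) / 2"
  define m where "m = (h a - h c) / (a - c)"
  have t: "t > 0" "a - c = t / 2" using b by (auto simp: t_def c_def field_simps)
  have cS: "c \<in> S" "c < a" using up[OF b(1), of c] b by (auto simp: c_def field_simps)
  have mt: "m * t = 2 * (h a - h c)" unfolding m_def t(2) using t(1) by simp
  have mL: "\<bar>m\<bar> \<le> L"
  proof -
    have "\<bar>m\<bar> = \<bar>h a - h c\<bar> / (t / 2)" unfolding m_def t(2) abs_divide using t(1) by simp
    then show ?thesis using L t(1) unfolding c_def[symmetric] t(2) by (simp add: pos_divide_le_eq)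
  qed
  have "\<bar>\<alpha> * \<psi>\<bar> \<le> 1/2 * t"
    unfolding abs_mult by (rule mult_mono) (use \<alpha> \<psi> t in \<open>auto simp: t_def\<close>)
  then have \<xi>: "- \<alpha> * \<psi> \<ge> c - a" using t(2) by (simp add: abs_le_iff)
  have "P (a + - \<alpha> * \<psi>) - P a - h a * (- \<alpha> * \<psi>) \<ge> 1/2 * m * (- \<alpha> * \<psi>)\<^sup>2"
    unfolding m_def by (rule strictly_convex_taylor[OF h up cS P \<xi>])
  moreover have "1/2 * m * (- \<alpha> * \<psi>)\<^sup>2 = 1/2 * \<alpha>\<^sup>2 * (m * \<psi>\<^sup>2)" by (simp add: power_mult_distrib)
  moreover have "m * \<psi>\<^sup>2 \<ge> 2 * (h a - h c) * \<psi> - 2 * \<epsilon> * L * \<psi>"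
  proof -
    have "m * (t - \<psi>) \<le> L * (2 * \<epsilon>)"
    proof -
      have "m * (t - \<psi>) \<le> \<bar>m\<bar> * (t - \<psi>)" using \<psi> by (intro mult_right_mono) (auto simp: t_def)
      also have "\<dots> \<le> L * (2 * \<epsilon>)" using mL \<psi> by (intro mult_mono) (auto simp: t_def)
      finally show ?thesis .
    qed
    then have "m * (t - \<psi>) * \<psi> \<le> L * (2 * \<epsilon>) * \<psi>" using \<psi>(1) by (rule mult_right_mono)
    moreover have "m * \<psi>\<^sup>2 = (m * t) * \<psi> - m * (t - \<psi>) * \<psi>" by (simp add: algebra_simps power2_eq_square)
    ultimately show ?thesis unfolding mt by (simp add: mult_ac)
  qed
  then have "1/2 * \<alpha>\<^sup>2 * (m * \<psi>\<^sup>2) \<ge> 1/2 * \<alpha>\<^sup>2 * (2 * (h a - h c) * \<psi> - 2 * \<epsilon> * L * \<psi>)"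
    by (intro mult_left_mono) auto
  moreover have "2 * (h a - h c) * \<psi> = (h a - h b) * \<psi> + (h a + h b - 2 * h c) * \<psi>" by (simp add: algebra_simps)
  moreover have "h a * (- \<alpha> * \<psi>) = - (h a * (\<alpha> * \<psi>))" by simp
  ultimately show ?thesis unfolding c_def by (simp only:)
qed

section \<open>Directions in which the second variation is negative\<close>

text \<open>
  A solution \<open>u\<close> together with the constants that the estimates need. As \<open>|u|
  \<le> M\<close> and all perturbations are at most \<open>M\<close>, bounds for the
  nonlinearities on \<open>[-2 M, 2 M]\<close> suffice. The set \<open>S\<close>, on which
  \<open>h\<close> is convex, contains the values of \<open>u\<close>; it is closed under going
  up because upward perturbations leave the range of \<open>u\<close>, while downward ones stay
  above a value of \<open>u\<close> at a reflected point.
\<close>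

locale dirichlet_problem =
  fixes \<Omega> :: "'a::euclidean_space set" and f g :: "'a \<Rightarrow> real \<Rightarrow> real" and u :: "'a \<Rightarrow> real"
    and \<mu> M B L :: real and S :: "real set"
  assumes \<Omega>: "open \<Omega>" "bounded \<Omega>" "radial_set \<Omega>"
    and C2: "C2_on \<Omega> u" and cont: "continuous_on (closure \<Omega>) u"
    and bdry: "\<And>x. x \<in> frontier \<Omega> \<Longrightarrow> u x = 0"
    and carath: "caratheodory \<Omega> f" "caratheodory \<Omega> g"
    and radial: "\<And>t. radial_on \<Omega> (\<lambda>x. f x t)" "\<And>t. radial_on \<Omega> (\<lambda>x. g x t)"
    and eqn: "AE x in lebesgue_on \<Omega>. - laplacian u x = f x (u x) + \<mu> * g x (u x)"
    and up: "\<And>s t. s \<in> S \<Longrightarrow> s \<le> t \<Longrightarrow> t \<in> S" and uS: "\<And>x. x \<in> \<Omega> \<Longrightarrow> u x \<in> S"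
    and M: "M > 0" "\<And>x. x \<in> closure \<Omega> \<Longrightarrow> \<bar>u x\<bar> \<le> M"
    and B: "B > 0" and L: "L > 0"
    and bound: "AE x in lebesgue_on \<Omega>. \<forall>t\<in>{-(2*M)..2*M}. \<bar>f x t\<bar> \<le> B \<and> \<bar>g x t\<bar> \<le> B"
    and lip: "AE x in lebesgue_on \<Omega>. \<forall>s\<in>{-(2*M)..2*M}. \<forall>t\<in>{-(2*M)..2*M}.
        \<bar>g x s - g x t\<bar> \<le> L * \<bar>s - t\<bar> \<and> \<bar>(f x s + \<mu> * g x s) - (f x t + \<mu> * g x t)\<bar> \<le> L * \<bar>s - t\<bar>"
    and convex: "AE x in lebesgue_on \<Omega>. strictly_convex_on S (\<lambda>t. f x t + \<mu> * g x t)"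
begin

abbreviation \<nu> :: "'a measure" where "\<nu> \<equiv> lebesgue_on \<Omega>"

definition h :: "'a \<Rightarrow> real \<Rightarrow> real" where "h x t = f x t + \<mu> * g x t"

definition H :: "'a \<Rightarrow> real \<Rightarrow> real" where "H x t = primitive f x t + \<mu> * primitive g x t"

text \<open>
  The second-order part of the nonlinear term of the energy at \<open>u\<close>. The first-order
  part cancels against the gradient term, since \<open>u\<close> solves the equation.
\<close>

definition remainder :: "('a \<Rightarrow> real) \<Rightarrow> 'a \<Rightarrow> real" where
  "remainder \<xi> x = H x (u x + \<xi> x) - H x (u x) - h x (u x) * \<xi> x"

lemma \<Omega>m: "\<Omega> \<in> sets lebesgue" by (rule open_sets_lebesgue[OF \<Omega>(1)])

lemma uM: "x \<in> \<Omega> \<Longrightarrow> \<bar>u x\<bar> \<le> M" using M(2) closure_subset by blast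

lemma u_C1: "C1_on \<Omega> u" using C2 unfolding C2_on_def by blast

lemma cont_ae: "AE x in \<nu>. continuous_on UNIV (f x) \<and> continuous_on UNIV (g x)"
proof -
  have "AE x in \<nu>. continuous_on UNIV (f x)" "AE x in \<nu>. continuous_on UNIV (g x)"
    using carath unfolding caratheodory_def by blast+
  then show ?thesis by eventually_elim simp
qed

lemma DERIV_H: "continuous_on UNIV (f x) \<Longrightarrow> continuous_on UNIV (g x) \<Longrightarrow> (H x has_real_derivative h x t) (at t)"
  unfolding H_def h_def
  by (rule DERIV_add[OF DERIV_primitive[of f x] DERIV_cmult[OF DERIV_primitive[of g x]]])

lemma superposition_measurable:
  assumes "v \<in> borel_measurable \<nu>"
  shows "(\<lambda>x. f x (v x)) \<in> borel_measurable \<nu>" "(\<lambda>x. g x (v x)) \<in> borel_measurable \<nu>"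
    "(\<lambda>x. h x (v x)) \<in> borel_measurable \<nu>"
    "(\<lambda>x. primitive f x (v x)) \<in> borel_measurable \<nu>"
    "(\<lambda>x. primitive g x (v x)) \<in> borel_measurable \<nu>"
proof -
  show f: "(\<lambda>x. f x (v x)) \<in> borel_measurable \<nu>" and g: "(\<lambda>x. g x (v x)) \<in> borel_measurable \<nu>"
    by (rule caratheodory_measurable[OF \<Omega>m carath(1) assms], rule caratheodory_measurable[OF \<Omega>m carath(2) assms])
  show "(\<lambda>x. h x (v x)) \<in> borel_measurable \<nu>" unfolding h_def using f g by measurable
  show "(\<lambda>x. primitive f x (v x)) \<in> borel_measurable \<nu>" "(\<lambda>x. primitive g x (v x)) \<in> borel_measurable \<nu>"
    by (rule caratheodory_measurable[OF \<Omega>m caratheodory_primitive[OF \<Omega>m carath(1)] assms],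
        rule caratheodory_measurable[OF \<Omega>m caratheodory_primitive[OF \<Omega>m carath(2)] assms])
qed

lemma superposition_integrable:
  assumes v: "v \<in> borel_measurable \<nu>" and b: "\<And>x. x \<in> \<Omega> \<Longrightarrow> \<bar>v x\<bar> \<le> 2 * M"
  shows "integrable \<nu> (\<lambda>x. h x (v x))" "integrable \<nu> (\<lambda>x. g x (v x))"
    "integrable \<nu> (\<lambda>x. primitive f x (v x))"
    "integrable \<nu> (\<lambda>x. primitive g x (v x))"
proof -
  note m = superposition_measurable[OF v]
  have v2: "v x \<in> {-(2*M)..2*M}" if "x \<in> \<Omega>" for x using b[OF that] by (auto simp: abs_le_iff)
  have sp: "AE x in \<nu>. x \<in> \<Omega>" by (rule AE_I2) simp
  have fg: "AE x in \<nu>. \<bar>f x (v x)\<bar> \<le> B \<and> \<bar>g x (v x)\<bar> \<le> B"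
    using bound sp by eventually_elim (use v2 in blast)
  show "integrable \<nu> (\<lambda>x. g x (v x))"
    by (rule integrable_lebesgue_on_bounded[OF \<Omega>(1,2) m(2)]) (use fg in auto)
  moreover have "integrable \<nu> (\<lambda>x. f x (v x))"
    by (rule integrable_lebesgue_on_bounded[OF \<Omega>(1,2) m(1)]) (use fg in auto)
  ultimately show "integrable \<nu> (\<lambda>x. h x (v x))" unfolding h_def by simp
  have 0: "(0::real) \<in> {-(2*M)..2*M}" using M(1) by simp
  have p: "\<bar>primitive q x s\<bar> \<le> B * (2 * M)"
    if "continuous_on UNIV (q x)" "\<forall>t\<in>{-(2*M)..2*M}. \<bar>q x t\<bar> \<le> B" "s \<in> {-(2*M)..2*M}" for q :: "'a \<Rightarrow> real \<Rightarrow> real" and x s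
  proof -
    have "\<bar>primitive q x s\<bar> \<le> B * \<bar>s\<bar>"
      using primitive_increment[of q x, OF that(1,2) 0 that(3)] by (simp add: primitive_0)
    also have "\<dots> \<le> B * (2 * M)" by (rule mult_left_mono) (use that(3) B in auto)
    finally show ?thesis .
  qed
  have pb: "AE x in \<nu>. \<bar>primitive f x (v x)\<bar> \<le> B * (2 * M) \<and> \<bar>primitive g x (v x)\<bar> \<le> B * (2 * M)"
    using bound cont_ae sp by eventually_elim (use v2 p in blast)
  show "integrable \<nu> (\<lambda>x. primitive f x (v x))"
    by (rule integrable_lebesgue_on_bounded[OF \<Omega>(1,2) m(4)]) (use pb in auto)
  show "integrable \<nu> (\<lambda>x. primitive g x (v x))"
    by (rule integrable_lebesgue_on_bounded[OF \<Omega>(1,2) m(5)]) (use pb in auto)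
qed

lemma u_measurable: "u \<in> borel_measurable \<nu>"
  by (rule continuous_measurable_lebesgue_on[OF \<Omega>(1) C1_on_continuous[OF u_C1]])

lemma C1c_measurable: "\<xi> \<in> C1c \<Omega> \<Longrightarrow> \<xi> \<in> borel_measurable \<nu>"
  by (rule continuous_measurable_lebesgue_on[OF \<Omega>(1) C1_on_continuous[OF C1c_C1_on]])

lemma integrable_times_C1c:
  assumes w: "integrable \<nu> w" and \<xi>: "\<xi> \<in> C1c \<Omega>"
  shows "integrable \<nu> (\<lambda>x. w x * \<xi> x)"
proof -
  obtain b where b: "b > 0" "\<And>x. \<bar>\<xi> x\<bar> \<le> b" by (rule C1c_bounded[OF \<xi>]) auto
  show ?thesis
  proof (rule Bochner_Integration.integrable_bound[of _ "\<lambda>x. b * w x"])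
    show "integrable \<nu> (\<lambda>x. b * w x)" using w by simp
    show "(\<lambda>x. w x * \<xi> x) \<in> borel_measurable \<nu>"
      by (rule borel_measurable_times[OF borel_measurable_integrable[OF w] C1c_measurable[OF \<xi>]])
    show "AE x in \<nu>. norm (w x * \<xi> x) \<le> norm (b * w x)"
    proof (rule AE_I2)
      fix x show "norm (w x * \<xi> x) \<le> norm (b * w x)"
        using mult_left_mono[OF b(2)[of x], of "\<bar>w x\<bar>"] b(1) by (simp add: abs_mult mult.commute)
    qed
  qed
qed

lemma norm_grad_C1c_integrable:
  assumes \<xi>: "\<xi> \<in> C1c \<Omega>" shows "integrable \<nu> (\<lambda>x. (norm (grad \<xi> x))\<^sup>2)"
proof -
  obtain b where b: "b > 0" "\<And>x. norm (grad \<xi> x) \<le> b" by (rule C1c_bounded[OF \<xi>]) auto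
  have c: "continuous_on \<Omega> (\<lambda>x. (norm (grad \<xi> x))\<^sup>2)"
    by (intro continuous_intros C1_on_grad C1c_C1_on[OF \<xi>])
  show ?thesis
    by (rule integrable_lebesgue_on_bounded[OF \<Omega>(1,2) continuous_measurable_lebesgue_on[OF \<Omega>(1) c], of "b\<^sup>2"])
       (use b(2) in \<open>simp add: power_mono\<close>)
qed

lemma weak_equation:
  assumes "\<kappa> \<in> C1c \<Omega>"
  shows "(LINT x|\<nu>. grad u x \<bullet> grad \<kappa> x) = (LINT x|\<nu>. h x (u x) * \<kappa> x)"
  by (rule weak_form[OF \<Omega>(1) C2 assms superposition_measurable(3)[OF u_measurable]])
     (use eqn in \<open>simp add: h_def\<close>)

lemma u_reflect_measurable: "norm e = 1 \<Longrightarrow> (\<lambda>x. u (reflect e x)) \<in> borel_measurable \<nu>"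
  by (rule continuous_measurable_lebesgue_on[OF \<Omega>(1) C1_on_continuous[OF C1_on_reflect(1)[OF \<Omega>(3) _ u_C1]]])

text \<open>
  The reflected function solves the same equation because the nonlinearities are radial.
\<close>

lemma weak_equation_reflect:
  assumes e: "norm e = 1" and \<kappa>: "\<kappa> \<in> C1c \<Omega>"
  shows "(LINT x|\<nu>. grad (\<lambda>x. u (reflect e x)) x \<bullet> grad \<kappa> x) = (LINT x|\<nu>. h x (u (reflect e x)) * \<kappa> x)"
proof -
  note C2v = C2_on_reflect[OF \<Omega>(1,3) e C2]
  have sp: "AE x in \<nu>. x \<in> \<Omega>" by (rule AE_I2) simp
  have "AE x in \<nu>. - laplacian (\<lambda>x. u (reflect e x)) x = h x (u (reflect e x))"
    using AE_reflect[OF \<Omega>m \<Omega>(3) e eqn] sp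
  proof eventually_elim
    case (elim x)
    have "f (reflect e x) t = f x t" "g (reflect e x) t = g x t" for t
      using radial(1)[of t] radial(2)[of t] elim(2) reflect_mem[OF \<Omega>(3) e, of x] reflect_norm[OF e, of x]
      unfolding radial_on_def by blast+
    then show ?case using elim(1) C2v(2)[OF elim(2)] unfolding h_def by simp
  qed
  then show ?thesis
    by (rule weak_form[OF \<Omega>(1) C2v(1) \<kappa> superposition_measurable(3)[OF u_reflect_measurable[OF e]]])
qed

text \<open>
  The cut-off difference of \<open>u\<close> and its reflection, on one half of the domain. The
  difference vanishes on the boundary of the half domain: on the hyperplane since
  \<open>\<sigma>\<close> fixes it, on the rest by the boundary condition. So the cut-off has
  compact support inside.
\<close>

definition cut_difference :: "'a \<Rightarrow> real \<Rightarrow> 'a \<Rightarrow> real" where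
  "cut_difference e \<epsilon> x = (if x \<in> \<Omega> \<and> x \<bullet> e > 0 then soft_cut \<epsilon> (u x - u (reflect e x)) else 0)"

lemma half_open: "open (\<Omega> \<inter> {x. x \<bullet> e > 0})"
  by (intro open_Int \<Omega>(1) open_Collect_less continuous_intros)

text \<open>
  For the gradient inequality, \<open>\<nabla>\<psi> = \<eta>'(t) \<nabla>t\<close> with
  \<open>0 \<le> \<eta>'(t) \<le> 1\<close>.
\<close>

lemma cut_difference_C1c:
  assumes e: "norm e = 1" and \<epsilon>: "\<epsilon> > 0"
  shows "cut_difference e \<epsilon> \<in> C1c (\<Omega> \<inter> {x. x \<bullet> e > 0})"
    and "x \<in> \<Omega> \<Longrightarrow> (norm (grad (cut_difference e \<epsilon>) x))\<^sup>2
      \<le> (grad u x - grad (\<lambda>x. u (reflect e x)) x) \<bullet> grad (cut_difference e \<epsilon>) x"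
proof -
  let ?D = "\<Omega> \<inter> {x. x \<bullet> e > 0}" and ?v = "\<lambda>x. u (reflect e x)"
  define t where "t x = u x - ?v x" for x
  let ?s' = "\<lambda>x. 1 - (\<epsilon> / max \<epsilon> (t x))\<^sup>2"
  note D = half_open[of e]
  have v1: "C1_on \<Omega> ?v" by (rule C1_on_reflect(1)[OF \<Omega>(3) e u_C1])
  have t1: "C1_on \<Omega> t" unfolding t_def by (rule C1_on_diff[OF u_C1 v1])
  have G: "GDERIV (\<lambda>x. soft_cut \<epsilon> (t x)) x :> ?s' x *\<^sub>R grad t x" if "x \<in> \<Omega>" for x
    by (rule GDERIV_DERIV_compose[OF C1_onD[OF t1 that] DERIV_soft_cut[OF \<epsilon>]])
  have c1: "C1_on \<Omega> (\<lambda>x. soft_cut \<epsilon> (t x))"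
  proof (rule C1_onI[OF G])
    show "continuous_on \<Omega> (\<lambda>x. ?s' x *\<^sub>R grad t x)"
      by (intro continuous_on_scaleR C1_on_grad[OF t1]
          continuous_on_compose2[OF soft_cut_deriv_continuous[OF \<epsilon>, of UNIV] C1_on_continuous[OF t1]]) auto
  qed
  have cD: "C1_on ?D (cut_difference e \<epsilon>)"
    by (rule C1_on_cong_open[OF D _ C1_on_subset[OF c1]]) (auto simp: cut_difference_def t_def)
  let ?K = "{x \<in> closure \<Omega>. \<epsilon> \<le> t x} \<inter> {x. 0 \<le> x \<bullet> e}"
  have refl_cl: "reflect e x \<in> closure \<Omega>" if "x \<in> closure \<Omega>" for x
  proof -
    have "reflect e ` closure \<Omega> \<subseteq> closure \<Omega>"
      by (rule image_closure_subset[OF reflect_continuous closed_closure])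
         (use reflect_mem[OF \<Omega>(3) e] closure_subset in blast)
    then show ?thesis using that by blast
  qed
  have tc: "continuous_on (closure \<Omega>) t"
    unfolding t_def
    by (intro continuous_on_diff cont continuous_on_compose2[OF cont reflect_continuous]) (use refl_cl in auto)
  have "closed {x \<in> closure \<Omega>. \<epsilon> \<le> t x}"
    by (rule continuous_on_closed_Collect_le[OF continuous_on_const tc closed_closure])
  then have "compact {x \<in> closure \<Omega>. \<epsilon> \<le> t x}"
    using \<Omega>(2) by (auto simp: compact_eq_bounded_closed intro: bounded_subset[OF bounded_closure])
  then have K: "compact ?K"
    by (rule compact_Int_closed) (intro closed_Collect_le continuous_intros)
  have KD: "?K \<subseteq> ?D"
  proof
    fix x assume x: "x \<in> ?K"
    have "x \<in> \<Omega>"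
    proof (rule ccontr)
      assume "x \<notin> \<Omega>"
      then have "x \<in> frontier \<Omega>" "reflect e x \<in> frontier \<Omega>"
        using x refl_cl reflect_mem[OF \<Omega>(3) e, of x] interior_open[OF \<Omega>(1)] by (auto simp: frontier_def)
      then have "t x = 0" using bdry by (simp add: t_def)
      then show False using x \<epsilon> by simp
    qed
    moreover have "x \<bullet> e \<noteq> 0"
    proof
      assume "x \<bullet> e = 0"
      then have "t x = 0" by (simp add: t_def reflect_def)
      then show False using x \<epsilon> by simp
    qed
    ultimately show "x \<in> ?D" using x by auto
  qed
  have out: "cut_difference e \<epsilon> x = 0" if "x \<notin> ?K" for x
  proof (cases "x \<in> ?D")
    case True
    then have "x \<in> closure \<Omega>" using closure_subset by blast
    then have "t x < \<epsilon>" using that True by auto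
    then show ?thesis by (simp add: cut_difference_def soft_cut_def t_def)
  qed (auto simp: cut_difference_def)
  show mem: "cut_difference e \<epsilon> \<in> C1c ?D"
    by (rule C1cI[OF D cD K KD KD out])
  assume x: "x \<in> \<Omega>"
  have gt: "grad t x = grad u x - grad ?v x"
    unfolding t_def using u_C1 v1 x unfolding C1_on_def by (intro grad_diff) auto
  show "(norm (grad (cut_difference e \<epsilon>) x))\<^sup>2 \<le> (grad u x - grad ?v x) \<bullet> grad (cut_difference e \<epsilon>) x"
  proof (cases "x \<in> ?D")
    case True
    have "grad (cut_difference e \<epsilon>) x = grad (\<lambda>x. soft_cut \<epsilon> (t x)) x"
      by (rule grad_cong_open[OF D True _ C1_on_subset[OF c1]]) (auto simp: cut_difference_def t_def)
    also have "\<dots> = ?s' x *\<^sub>R grad t x" by (rule grad_eqI[OF G[OF x]])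
    finally have gc: "grad (cut_difference e \<epsilon>) x = ?s' x *\<^sub>R grad t x" .
    have sb: "0 \<le> ?s' x" "?s' x \<le> 1" by (rule soft_cut_deriv_bounds[OF \<epsilon>])+
    have "(norm (?s' x *\<^sub>R grad t x))\<^sup>2 = ?s' x * (?s' x * (grad t x \<bullet> grad t x))"
      unfolding power2_norm_eq_inner by simp
    also have "\<dots> \<le> 1 * (?s' x * (grad t x \<bullet> grad t x))"
      by (rule mult_right_mono[OF sb(2)]) (use sb(1) in simp)
    finally show ?thesis unfolding gc gt[symmetric] by simp
  next
    case False
    then show ?thesis using C1c_grad_outside[OF mem] by simp
  qed
qed


lemma cut_difference_bounds:
  assumes e: "norm e = 1" and \<epsilon>: "\<epsilon> > 0"
  shows "0 \<le> cut_difference e \<epsilon> x" "cut_difference e \<epsilon> x \<le> 2 * M"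
    and "x \<in> \<Omega> \<Longrightarrow> x \<bullet> e > 0 \<Longrightarrow> u x - u (reflect e x) - 2 * \<epsilon> \<le> cut_difference e \<epsilon> x"
    and "cut_difference e \<epsilon> x \<noteq> 0 \<Longrightarrow> x \<in> \<Omega> \<and> u (reflect e x) < u x \<and>
      cut_difference e \<epsilon> x \<le> u x - u (reflect e x) \<and> u x - u (reflect e x) - cut_difference e \<epsilon> x \<le> 2 * \<epsilon>"
proof -
  let ?t = "u x - u (reflect e x)"
  have tM: "?t \<le> 2 * M" if "x \<in> \<Omega>"
    using uM[OF that] uM[of "reflect e x"] that reflect_mem[OF \<Omega>(3) e, of x] by auto
  have *: "soft_cut \<epsilon> ?t = 0" if "?t \<le> 0" using that \<epsilon> by (simp add: soft_cut_def)
  show 1: "0 \<le> cut_difference e \<epsilon> x"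
    using soft_cut_bounds(1)[OF \<epsilon>, of ?t] * by (cases "?t \<ge> 0") (auto simp: cut_difference_def)
  show "cut_difference e \<epsilon> x \<le> 2 * M"
  proof (cases "x \<in> \<Omega> \<and> x \<bullet> e > 0 \<and> ?t \<ge> 0")
    case True
    then show ?thesis using soft_cut_bounds(2)[OF \<epsilon>, of ?t] tM by (auto simp: cut_difference_def)
  next
    case False
    then show ?thesis using * M(1) by (auto simp: cut_difference_def)
  qed
  show "u x - u (reflect e x) - 2 * \<epsilon> \<le> cut_difference e \<epsilon> x" if "x \<in> \<Omega>" "x \<bullet> e > 0"
    using soft_cut_bounds(3)[OF \<epsilon>, of ?t] * that \<epsilon> by (cases "?t \<ge> 0") (auto simp: cut_difference_def)
  show "x \<in> \<Omega> \<and> u (reflect e x) < u x \<and>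
      cut_difference e \<epsilon> x \<le> ?t \<and> ?t - cut_difference e \<epsilon> x \<le> 2 * \<epsilon>" if nz: "cut_difference e \<epsilon> x \<noteq> 0"
  proof -
    have x: "x \<in> \<Omega>" "x \<bullet> e > 0" using nz by (auto simp: cut_difference_def split: if_splits)
    then have "?t > 0" using nz * by (cases "?t > 0") (auto simp: cut_difference_def)
    then show ?thesis using soft_cut_bounds(2,3)[OF \<epsilon>, of ?t] x by (simp add: cut_difference_def)
  qed
qed

text \<open>
  Twice the midpoint defect of \<open>h x\<close> between the values of \<open>u\<close> at
  \<open>x\<close> and at its mirror image.
\<close>

definition convexity_defect :: "'a \<Rightarrow> 'a \<Rightarrow> real" where
  "convexity_defect e x = h x (u x) + h x (u (reflect e x)) - 2 * h x ((u x + u (reflect e x)) / 2)"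

lemma convexity_defect_pos:
  assumes e: "norm e = 1"
  shows "AE x in \<nu>. convexity_defect e x \<ge> 0 \<and> (u x \<noteq> u (reflect e x) \<longrightarrow> convexity_defect e x > 0)"
proof -
  have sp: "AE x in \<nu>. x \<in> \<Omega>" by (rule AE_I2) simp
  show ?thesis
    using convex sp
  proof eventually_elim
    case (elim x)
    have S: "u x \<in> S" "u (reflect e x) \<in> S" using uS elim(2) reflect_mem[OF \<Omega>(3) e, of x] by auto
    have "convexity_defect e x > 0" if ne: "u x \<noteq> u (reflect e x)"
    proof -
      have "h x (1/2 * u x + 1/2 * u (reflect e x)) < 1/2 * h x (u x) + 1/2 * h x (u (reflect e x))"
      proof -
        have "0 < (1/2::real)" "1/2 + 1/2 = (1::real)" by simp_all
        then show ?thesis using elim(1) S ne unfolding strictly_convex_on_def h_def by blast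
      qed
      moreover have "1/2 * u x + 1/2 * u (reflect e x) = (u x + u (reflect e x)) / 2" by simp
      ultimately have "h x ((u x + u (reflect e x)) / 2) < 1/2 * h x (u x) + 1/2 * h x (u (reflect e x))"
        by (simp only:)
      then show ?thesis unfolding convexity_defect_def by linarith
    qed
    moreover have "convexity_defect e x = 0" if "u x = u (reflect e x)"
      using that by (simp add: convexity_defect_def)
    ultimately show ?case by (cases "u x = u (reflect e x)") auto
  qed
qed

lemma reflect_superposition_integrable:
  assumes e: "norm e = 1"
  shows "integrable \<nu> (\<lambda>x. h x (u x))" "integrable \<nu> (\<lambda>x. h x (u (reflect e x)))"
    "integrable \<nu> (convexity_defect e)"
proof -
  have b: "\<bar>u x\<bar> \<le> M \<and> \<bar>u (reflect e x)\<bar> \<le> M" if "x \<in> \<Omega>" for x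
    using uM that reflect_mem[OF \<Omega>(3) e, of x] by blast
  have b2: "\<bar>u x\<bar> \<le> 2 * M \<and> \<bar>u (reflect e x)\<bar> \<le> 2 * M \<and> \<bar>(u x + u (reflect e x)) / 2\<bar> \<le> 2 * M" if "x \<in> \<Omega>" for x
    using b[OF that] M(1) by (auto simp: abs_le_iff)
  note m = u_measurable u_reflect_measurable[OF e]
  have m2: "(\<lambda>x. (u x + u (reflect e x)) / 2) \<in> borel_measurable \<nu>" using m by measurable
  show 1: "integrable \<nu> (\<lambda>x. h x (u x))"
    by (rule superposition_integrable(1)[OF m(1)]) (use b2 in blast)
  show 2: "integrable \<nu> (\<lambda>x. h x (u (reflect e x)))"
    by (rule superposition_integrable(1)[OF m(2)]) (use b2 in blast)
  have 3: "integrable \<nu> (\<lambda>x. h x ((u x + u (reflect e x)) / 2))"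
    by (rule superposition_integrable(1)[OF m2]) (use b2 in blast)
  show "integrable \<nu> (convexity_defect e)"
    unfolding convexity_defect_def using 1 2 3 by simp
qed

lemma remainder_integrable:
  assumes \<xi>: "\<xi> \<in> C1c \<Omega>" and b: "\<And>x. \<bar>\<xi> x\<bar> \<le> M"
  shows "integrable \<nu> (remainder \<xi>)"
    "integrable \<nu> (\<lambda>x. primitive g x (u x + \<xi> x))"
    "integrable \<nu> (\<lambda>x. primitive f x (u x + \<xi> x))"
    "integrable \<nu> (\<lambda>x. primitive g x (u x))"
    "integrable \<nu> (\<lambda>x. primitive f x (u x))"
    "integrable \<nu> (\<lambda>x. h x (u x) * \<xi> x)"
    "integrable \<nu> (\<lambda>x. g x (u x) * \<xi> x)"
proof -
  have vm: "(\<lambda>x. u x + \<xi> x) \<in> borel_measurable \<nu>"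
    by (rule borel_measurable_add[OF u_measurable C1c_measurable[OF \<xi>]])
  have vb: "\<bar>u x + \<xi> x\<bar> \<le> 2 * M" "\<bar>u x\<bar> \<le> 2 * M" if "x \<in> \<Omega>" for x
    using uM[OF that] b[of x] M(1) by (auto simp: abs_le_iff)
  note v = superposition_integrable[OF vm vb(1)] and w = superposition_integrable[OF u_measurable vb(2)]
  show i: "integrable \<nu> (\<lambda>x. primitive g x (u x + \<xi> x))"
    "integrable \<nu> (\<lambda>x. primitive f x (u x + \<xi> x))"
    "integrable \<nu> (\<lambda>x. primitive g x (u x))"
    "integrable \<nu> (\<lambda>x. primitive f x (u x))"
    using v(3,4) w(3,4) by auto
  show j: "integrable \<nu> (\<lambda>x. h x (u x) * \<xi> x)"
    by (rule integrable_times_C1c[OF w(1) \<xi>])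
  show "integrable \<nu> (\<lambda>x. g x (u x) * \<xi> x)"
    by (rule integrable_times_C1c[OF w(2) \<xi>])
  show "integrable \<nu> (remainder \<xi>)"
    unfolding remainder_def H_def using i j by simp
qed

lemma remainder_cut_difference:
  assumes e: "norm e = 1" and \<epsilon>: "\<epsilon> > 0" and \<alpha>: "\<bar>\<alpha>\<bar> \<le> 1/2"
  shows "AE x in \<nu>. 1/2 * \<alpha>\<^sup>2 * ((h x (u x) - h x (u (reflect e x))) * cut_difference e \<epsilon> x
      + convexity_defect e x * cut_difference e \<epsilon> x - 2 * \<epsilon> * L * cut_difference e \<epsilon> x)
    \<le> remainder (\<lambda>x. - \<alpha> * cut_difference e \<epsilon> x) x"
  using convex lip cont_ae
proof eventually_elim
  case (elim x)
  let ?\<psi> = "cut_difference e \<epsilon> x"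
  show ?case
  proof (cases "?\<psi> = 0")
    case False
    note p = cut_difference_bounds(4)[OF e \<epsilon> False]
    let ?a = "u x" and ?b = "u (reflect e x)"
    have x: "x \<in> \<Omega>" "reflect e x \<in> \<Omega>" using p reflect_mem[OF \<Omega>(3) e, of x] by auto
    have hc: "strictly_convex_on S (h x)" using elim(1) unfolding h_def by simp
    have r: "?a \<in> {-(2*M)..2*M}" "(?a + ?b) / 2 \<in> {-(2*M)..2*M}"
      using uM[OF x(1)] uM[OF x(2)] M(1) by (auto simp: abs_le_iff)
    have l: "\<bar>h x ?a - h x ((?a + ?b) / 2)\<bar> \<le> L * \<bar>?a - (?a + ?b) / 2\<bar>"
      using elim(2) r unfolding h_def by blast
    have "H x (?a + - \<alpha> * ?\<psi>) - H x ?a + h x ?a * (\<alpha> * ?\<psi>)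
      \<ge> 1/2 * \<alpha>\<^sup>2 * ((h x ?a - h x ?b) * ?\<psi> + (h x ?a + h x ?b - 2 * h x ((?a + ?b) / 2)) * ?\<psi> - 2 * \<epsilon> * L * ?\<psi>)"
      by (rule convexity_gain[OF hc up uS[OF x(2)] _ DERIV_H l cut_difference_bounds(1)[OF e \<epsilon>] _ _ \<alpha>])
         (use p elim(3) in auto)
    then show ?thesis by (simp add: remainder_def convexity_defect_def)
  qed (simp add: remainder_def)
qed

text \<open>
  The gradient term is at most \<open>\<alpha>\<^sup>2/2 \<integral> (h(u) - h(u \<circ>
  \<sigma>)) \<psi>\<close> by the two weak equations, and the same quantity is contained in the
  lower bound for the remainder. What is left is the convexity defect minus an error of order
  \<open>\<epsilon>\<close>.
\<close>

lemma energy_decrease_cut_difference: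
  assumes e: "norm e = 1" and \<epsilon>: "\<epsilon> > 0" and \<alpha>: "\<bar>\<alpha>\<bar> \<le> 1/2"
  defines "\<psi> \<equiv> cut_difference e \<epsilon>"
  shows "1/2 * \<alpha>\<^sup>2 * (LINT x|\<nu>. (norm (grad \<psi> x))\<^sup>2)
     - (LINT x|\<nu>. remainder (\<lambda>x. - \<alpha> * \<psi> x) x)
     \<le> - (1/2 * \<alpha>\<^sup>2 * ((LINT x|\<nu>. convexity_defect e x * \<psi> x) - 2 * \<epsilon> * L * (LINT x|\<nu>. \<psi> x)))"
proof -
  have \<psi>: "\<psi> \<in> C1c \<Omega>"
    unfolding \<psi>_def by (rule C1c_mono[OF cut_difference_C1c(1)[OF e \<epsilon>]]) auto
  let ?v = "\<lambda>x. u (reflect e x)"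
  let ?\<delta> = "\<lambda>x. h x (u x) - h x (?v x)"
  note hi = reflect_superposition_integrable[OF e]
  have i\<delta>: "integrable \<nu> (\<lambda>x. ?\<delta> x * \<psi> x)"
    by (rule integrable_times_C1c[OF _ \<psi>]) (use hi in simp)
  have id: "integrable \<nu> (\<lambda>x. convexity_defect e x * \<psi> x)"
    by (rule integrable_times_C1c[OF hi(3) \<psi>])
  have i\<psi>: "integrable \<nu> \<psi>"
    using integrable_times_C1c[OF finite_measure.integrable_const[OF finite_lebesgue_on[OF \<Omega>(1,2)], of 1] \<psi>] by simp
  have b: "\<bar>- \<alpha> * \<psi> x\<bar> \<le> M" for x
  proof -
    have "\<bar>- \<alpha> * \<psi> x\<bar> = \<bar>\<alpha>\<bar> * \<psi> x" using cut_difference_bounds(1)[OF e \<epsilon>, of x] by (simp add: abs_mult \<psi>_def)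
    also have "\<dots> \<le> 1/2 * (2 * M)"
      unfolding \<psi>_def by (rule mult_mono[OF \<alpha> cut_difference_bounds(2)[OF e \<epsilon>]]) (use cut_difference_bounds(1)[OF e \<epsilon>] in auto)
    finally show ?thesis by simp
  qed
  have iR: "integrable \<nu> (remainder (\<lambda>x. - \<alpha> * \<psi> x))"
    by (rule remainder_integrable(1)[OF C1c_cmult[OF \<psi>] b])
  have "(LINT x|\<nu>. (norm (grad \<psi> x))\<^sup>2) \<le> (LINT x|\<nu>. grad u x \<bullet> grad \<psi> x - grad ?v x \<bullet> grad \<psi> x)"
    by (rule integral_mono[OF norm_grad_C1c_integrable[OF \<psi>]])
       (use cut_difference_C1c(2)[OF e \<epsilon>] green_identity(1)[OF \<Omega>(1) C2 \<psi>]
          green_identity(1)[OF \<Omega>(1) C2_on_reflect(1)[OF \<Omega>(1,3) e C2] \<psi>]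
        in \<open>auto simp: \<psi>_def inner_diff_left\<close>)
  also have "\<dots> = (LINT x|\<nu>. h x (u x) * \<psi> x) - (LINT x|\<nu>. h x (?v x) * \<psi> x)"
    using green_identity(1)[OF \<Omega>(1) C2 \<psi>]
          green_identity(1)[OF \<Omega>(1) C2_on_reflect(1)[OF \<Omega>(1,3) e C2] \<psi>]
    by (simp add: weak_equation[OF \<psi>] weak_equation_reflect[OF e \<psi>])
  also have "\<dots> = (LINT x|\<nu>. ?\<delta> x * \<psi> x)"
    using integrable_times_C1c[OF hi(1) \<psi>] integrable_times_C1c[OF hi(2) \<psi>] by (simp add: left_diff_distrib)
  finally have grad: "(LINT x|\<nu>. (norm (grad \<psi> x))\<^sup>2) \<le> (LINT x|\<nu>. ?\<delta> x * \<psi> x)" .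
  have "1/2 * \<alpha>\<^sup>2 * ((LINT x|\<nu>. ?\<delta> x * \<psi> x) + (LINT x|\<nu>. convexity_defect e x * \<psi> x) - 2 * \<epsilon> * L * (LINT x|\<nu>. \<psi> x))
    = (LINT x|\<nu>. 1/2 * \<alpha>\<^sup>2 * (?\<delta> x * \<psi> x + convexity_defect e x * \<psi> x - 2 * \<epsilon> * L * \<psi> x))"
    using i\<delta> id i\<psi> by simp
  also have "\<dots> \<le> (LINT x|\<nu>. remainder (\<lambda>x. - \<alpha> * \<psi> x) x)"
    by (rule integral_mono_AE)
       (use i\<delta> id i\<psi> iR remainder_cut_difference[OF e \<epsilon> \<alpha>] in \<open>auto simp: \<psi>_def\<close>)
  finally have R: "1/2 * \<alpha>\<^sup>2 * ((LINT x|\<nu>. ?\<delta> x * \<psi> x) + (LINT x|\<nu>. convexity_defect e x * \<psi> x) - 2 * \<epsilon> * L * (LINT x|\<nu>. \<psi> x))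
    \<le> (LINT x|\<nu>. remainder (\<lambda>x. - \<alpha> * \<psi> x) x)" .
  have "1/2 * \<alpha>\<^sup>2 * (LINT x|\<nu>. (norm (grad \<psi> x))\<^sup>2) \<le> 1/2 * \<alpha>\<^sup>2 * (LINT x|\<nu>. ?\<delta> x * \<psi> x)"
    by (rule mult_left_mono[OF grad]) simp
  then show ?thesis using R by (simp add: distrib_left right_diff_distrib)
qed

text \<open>
  On the open set where \<open>t > t(x\<^sub>0)/2\<close> the cut-off is bounded below
  independently of small \<open>\<epsilon>\<close>, so the convexity defect contributes a fixed
  positive amount and the error of order \<open>\<epsilon>\<close> can be absorbed. The level
  \<open>\<epsilon>\<close> is thereby fixed before \<open>\<alpha>\<close> varies.
\<close>

lemma descent_direction:
  assumes e: "norm e = 1" and x0: "x0 \<in> \<Omega>" "x0 \<bullet> e > 0" "u (reflect e x0) < u x0"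
  obtains \<psi> c where "\<psi> \<in> C1c (\<Omega> \<inter> {x. x \<bullet> e > 0})" "\<And>x. 0 \<le> \<psi> x" "\<And>x. \<psi> x \<le> 2 * M" "\<psi> x0 > 0" "c > 0"
    "\<And>\<alpha>. \<bar>\<alpha>\<bar> \<le> 1/2 \<Longrightarrow> 1/2 * \<alpha>\<^sup>2 * (LINT x|\<nu>. (norm (grad \<psi> x))\<^sup>2)
     - (LINT x|\<nu>. remainder (\<lambda>x. - \<alpha> * \<psi> x) x) \<le> - (c * \<alpha>\<^sup>2)"
proof -
  define t where "t x = u x - u (reflect e x)" for x
  define D where "D = \<Omega> \<inter> {x. x \<bullet> e > 0}"
  have t0: "t x0 > 0" using x0 by (simp add: t_def)
  define A where "A = {x\<in>D. t x0 / 2 < t x}"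
  have D: "open D" "D \<subseteq> \<Omega>" unfolding D_def using half_open by auto
  have tc: "continuous_on \<Omega> t"
    unfolding t_def
    by (intro continuous_on_diff C1_on_continuous[OF u_C1] C1_on_continuous[OF C1_on_reflect(1)[OF \<Omega>(3) e u_C1]])
  have "open (t -` {t x0 / 2<..} \<inter> D)"
    using continuous_on_open_vimage[OF D(1), of t] continuous_on_subset[OF tc D(2)] open_greaterThan by blast
  moreover have "t -` {t x0 / 2<..} \<inter> D = A" unfolding A_def by auto
  ultimately have A: "open A" by simp
  have xA: "x0 \<in> A" using x0 t0 by (simp add: A_def D_def)
  have A\<Omega>: "A \<subseteq> \<Omega>" using D(2) by (auto simp: A_def)
  have Am: "A \<in> sets lebesgue" by (rule open_sets_lebesgue[OF A])
  have Am': "A \<in> sets \<nu>" using Am A\<Omega> \<Omega>m by (simp add: sets_restrict_space_iff)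
  note hi = reflect_superposition_integrable[OF e]
  let ?dA = "\<lambda>x. indicator A x * convexity_defect e x"
  have idA: "integrable \<nu> ?dA"
    using integrable_mult_indicator[OF Am' hi(3)] by simp
  have dA0: "AE x in \<nu>. 0 \<le> ?dA x"
    using convexity_defect_pos[OF e] by eventually_elim simp
  have "(LINT x|\<nu>. ?dA x) \<noteq> 0"
  proof
    assume "(LINT x|\<nu>. ?dA x) = 0"
    then have "AE x in \<nu>. ?dA x = 0" using integral_nonneg_eq_0_iff_AE[OF idA dA0] by simp
    then have "AE x in \<nu>. x \<notin> A"
      using convexity_defect_pos[OF e]
    proof eventually_elim
      case (elim x)
      show ?case
      proof
        assume "x \<in> A"
        then have "t x > 0" using t0 by (simp add: A_def)
        then show False using elim \<open>x \<in> A\<close> by (simp add: t_def)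
      qed
    qed
    then have "AE x in lebesgue. x \<in> \<Omega> \<longrightarrow> x \<notin> A" using \<Omega>m by (simp add: AE_restrict_space_iff)
    then have "AE x in lebesgue. x \<notin> A" by eventually_elim (use A\<Omega> in blast)
    then have "negligible A" using AE_iff_null_sets[OF Am] negligible_iff_null_sets by blast
    then show False using open_not_negligible[OF A] xA by blast
  qed
  moreover have "(LINT x|\<nu>. ?dA x) \<ge> 0" by (rule Bochner_Integration.integral_nonneg_AE[OF dA0])
  ultimately have d0: "(LINT x|\<nu>. ?dA x) > 0" by simp
  define c0 where "c0 = t x0 / 4 * (LINT x|\<nu>. ?dA x)"
  have c0: "c0 > 0" unfolding c0_def using t0 d0 by simp
  define V where "V = 2 * M * measure \<nu> \<Omega>"
  have V: "V \<ge> 0" unfolding V_def using M(1) by simp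
  \<comment> \<open>The first bound makes the cut-off at least \<open>t x0 / 4\<close> on
    \<open>A\<close>; the second makes the error at most \<open>c0 / 2\<close>.\<close>
  define \<epsilon> where "\<epsilon> = min (t x0 / 8) (c0 / (4 * (L * V + 1)))"
  have LV: "L * V + 1 > 0" using L V by (simp add: add_nonneg_pos)
  have \<epsilon>: "\<epsilon> > 0" unfolding \<epsilon>_def using t0 c0 LV by simp
  define \<psi> where "\<psi> = cut_difference e \<epsilon>"
  note \<psi>b = cut_difference_bounds[OF e \<epsilon>, folded \<psi>_def]
  have \<psi>D: "\<psi> \<in> C1c D" unfolding \<psi>_def D_def by (rule cut_difference_C1c(1)[OF e \<epsilon>])
  have \<psi>: "\<psi> \<in> C1c \<Omega>" by (rule C1c_mono[OF \<psi>D D(2)])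
  have \<psi>A: "\<psi> x \<ge> t x0 / 4" if "x \<in> A" for x
  proof -
    have "x \<in> \<Omega>" "x \<bullet> e > 0" "t x > t x0 / 2" using that by (auto simp: A_def D_def)
    moreover have "\<epsilon> \<le> t x0 / 8" unfolding \<epsilon>_def by (rule min.cobounded1)
    ultimately show ?thesis using \<psi>b(3)[of x] by (simp add: t_def)
  qed
  have id: "integrable \<nu> (\<lambda>x. convexity_defect e x * \<psi> x)"
    by (rule integrable_times_C1c[OF hi(3) \<psi>])
  have one: "integrable \<nu> (\<lambda>x. k::real)" for k
    by (rule finite_measure.integrable_const[OF finite_lebesgue_on[OF \<Omega>(1,2)]])
  have i\<psi>: "integrable \<nu> \<psi>" using integrable_times_C1c[OF one[of 1] \<psi>] by simp
  have "c0 = (LINT x|\<nu>. t x0 / 4 * ?dA x)" unfolding c0_def using idA by simp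
  also have "\<dots> \<le> (LINT x|\<nu>. convexity_defect e x * \<psi> x)"
  proof (rule integral_mono_AE[OF _ id])
    show "integrable \<nu> (\<lambda>x. t x0 / 4 * ?dA x)" using idA by simp
    show "AE x in \<nu>. t x0 / 4 * ?dA x \<le> convexity_defect e x * \<psi> x"
      using convexity_defect_pos[OF e]
    proof eventually_elim
      case (elim x)
      then have d: "convexity_defect e x \<ge> 0" by simp
      show ?case
      proof (cases "x \<in> A")
        case True
        then show ?thesis using mult_right_mono[OF \<psi>A[OF True] d] by (simp add: mult.commute)
      next
        case False
        then show ?thesis using d \<psi>b(1)[of x] by simp
      qed
    qed
  qed
  finally have I1: "c0 \<le> (LINT x|\<nu>. convexity_defect e x * \<psi> x)" .
  have "(LINT x|\<nu>. \<psi> x) \<le> (LINT x|\<nu>. 2 * M)"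
    by (rule integral_mono[OF i\<psi> one]) (rule \<psi>b(2))
  then have I2: "(LINT x|\<nu>. \<psi> x) \<le> V" by (simp add: V_def mult.commute)
  have "2 * \<epsilon> * L * (LINT x|\<nu>. \<psi> x) \<le> 2 * \<epsilon> * L * V"
    by (rule mult_left_mono[OF I2]) (use \<epsilon> L in simp)
  also have "\<dots> \<le> 2 * \<epsilon> * (L * V + 1)" using \<epsilon> by (simp add: mult.assoc)
  also have "\<dots> \<le> c0 / 2"
  proof -
    have "\<epsilon> \<le> c0 / (4 * (L * V + 1))" unfolding \<epsilon>_def by (rule min.cobounded2)
    then show ?thesis using LV by (simp add: pos_le_divide_eq mult_ac)
  qed
  finally have I3: "2 * \<epsilon> * L * (LINT x|\<nu>. \<psi> x) \<le> c0 / 2" .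
  show thesis
  proof (rule that[of \<psi> "c0 / 4"])
    show "\<psi> \<in> C1c (\<Omega> \<inter> {x. x \<bullet> e > 0})" using \<psi>D by (simp add: D_def)
    show "0 \<le> \<psi> x" "\<psi> x \<le> 2 * M" for x using \<psi>b by auto
    show "\<psi> x0 > 0" using \<psi>A[OF xA] t0 by simp
    show "c0 / 4 > 0" using c0 by simp
    fix \<alpha> :: real assume \<alpha>: "\<bar>\<alpha>\<bar> \<le> 1/2"
    have "1/2 * \<alpha>\<^sup>2 * (c0 / 2) \<le> 1/2 * \<alpha>\<^sup>2 * ((LINT x|\<nu>. convexity_defect e x * \<psi> x) - 2 * \<epsilon> * L * (LINT x|\<nu>. \<psi> x))"
      by (rule mult_left_mono) (use I1 I3 in simp_all)
    moreover have "1/2 * \<alpha>\<^sup>2 * (c0 / 2) = c0 / 4 * \<alpha>\<^sup>2" by simp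
    ultimately show "1/2 * \<alpha>\<^sup>2 * (LINT x|\<nu>. (norm (grad \<psi> x))\<^sup>2)
     - (LINT x|\<nu>. remainder (\<lambda>x. - \<alpha> * \<psi> x) x) \<le> - (c0 / 4 * \<alpha>\<^sup>2)"
      using energy_decrease_cut_difference[OF e \<epsilon> \<alpha>] unfolding \<psi>_def by linarith
  qed
qed

end

section \<open>The constraint and the reflection dichotomy\<close>

text \<open>
  A nonnegative continuous function that is positive at a point is positive on an open set,
  which is not negligible.
\<close>

lemma weighted_integral_C1c_neq_0:
  fixes w \<psi> :: "'a::euclidean_space \<Rightarrow> real"
  assumes \<Omega>: "open \<Omega>" and w: "AE x in lebesgue_on \<Omega>. w x > 0" and i: "integrable (lebesgue_on \<Omega>) (\<lambda>x. w x * \<psi> x)"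
    and \<psi>: "\<psi> \<in> C1c \<Omega>" "\<And>x. 0 \<le> \<psi> x" "\<psi> x0 > 0"
  shows "(LINT x|lebesgue_on \<Omega>. w x * \<psi> x) \<noteq> 0"
proof
  assume 0: "(LINT x|lebesgue_on \<Omega>. w x * \<psi> x) = 0"
  let ?U = "{x. 0 < \<psi> x}"
  have U: "open ?U"
    by (intro open_Collect_less continuous_on_const C1_on_continuous[OF C1c_C1_on[OF \<psi>(1)]])
  have U\<Omega>: "?U \<subseteq> \<Omega>" using C1c_outside[OF \<psi>(1)] by force
  have nn: "AE x in lebesgue_on \<Omega>. 0 \<le> w x * \<psi> x"
    using w by eventually_elim (use \<psi>(2) in simp)
  have "AE x in lebesgue_on \<Omega>. w x * \<psi> x = 0" using integral_nonneg_eq_0_iff_AE[OF i nn] 0 by simp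
  then have "AE x in lebesgue_on \<Omega>. x \<notin> ?U" using w by eventually_elim auto
  then have "AE x in lebesgue. x \<in> \<Omega> \<longrightarrow> x \<notin> ?U"
    using open_sets_lebesgue[OF \<Omega>] by (simp add: AE_restrict_space_iff)
  then have "AE x in lebesgue. x \<notin> ?U" by eventually_elim (use U\<Omega> in blast)
  then have "negligible ?U" using AE_iff_null_sets[OF open_sets_lebesgue[OF U]] negligible_iff_null_sets by blast
  then show False using open_not_negligible[OF U] \<psi>(3) by blast
qed

locale constrained_minimizer = dirichlet_problem +
  assumes uH: "u \<in> H1_0 \<Omega>" and constr: "(LINT x|lebesgue_on \<Omega>. primitive g x (u x)) = 1"
    and minimal: "\<And>v. v \<in> constraint_set \<Omega> g \<Longrightarrow> energy \<Omega> f u \<le> energy \<Omega> f v"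
    and sign: "(AE x in lebesgue_on \<Omega>. g x (u x) > 0) \<or> (AE x in lebesgue_on \<Omega>. g x (u x) < 0)"
begin

lemma energy_C1:
  assumes v: "C1_on \<Omega> v"
  shows "energy \<Omega> f v = (LINT x|\<nu>. 1/2 * (norm (grad v x))\<^sup>2 - primitive f x (v x))"
  unfolding energy_def
proof (rule integral_cong_AE)
  have m: "weak_gradient \<Omega> v \<in> borel_measurable \<nu>" "grad v \<in> borel_measurable \<nu>"
     "(\<lambda>x. primitive f x (v x)) \<in> borel_measurable \<nu>"
    using weak_gradient_measurable[OF \<Omega>(1) v] continuous_measurable_lebesgue_on[OF \<Omega>(1) C1_on_grad[OF v]]
      superposition_measurable(4)[OF continuous_measurable_lebesgue_on[OF \<Omega>(1) C1_on_continuous[OF v]]] by auto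
  show "(\<lambda>x. 1/2 * (norm (weak_gradient \<Omega> v x))\<^sup>2 - primitive f x (v x)) \<in> borel_measurable \<nu>"
    "(\<lambda>x. 1/2 * (norm (grad v x))\<^sup>2 - primitive f x (v x)) \<in> borel_measurable \<nu>"
    using m by measurable
  show "AE x in \<nu>. 1/2 * (norm (weak_gradient \<Omega> v x))\<^sup>2 - primitive f x (v x)
      = 1/2 * (norm (grad v x))\<^sup>2 - primitive f x (v x)"
    using weak_gradient_AE_grad[OF \<Omega>(1) v] by eventually_elim simp
qed

text \<open>
  Expand the energy of \<open>u + \<xi>\<close>. The mixed gradient term is \<open>\<integral>
  h(u) \<xi>\<close> by the equation, and \<open>\<mu>\<close> times the constraint may be added
  since the constraint has the same value at both functions.
\<close>

lemma second_variation:
  assumes \<xi>: "\<xi> \<in> C1c \<Omega>" and b: "\<And>x. \<bar>\<xi> x\<bar> \<le> M"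
    and c: "(LINT x|\<nu>. primitive g x (u x + \<xi> x)) = 1"
  shows "(LINT x|\<nu>. remainder \<xi> x) \<le> 1/2 * (LINT x|\<nu>. (norm (grad \<xi> x))\<^sup>2)"
proof -
  let ?v = "\<lambda>x. u x + \<xi> x"
  note ri = remainder_integrable[OF \<xi> b]
  have v1: "C1_on \<Omega> ?v" by (rule C1_on_add[OF u_C1 C1c_C1_on[OF \<xi>]])
  have "?v \<in> constraint_set \<Omega> g"
    unfolding constraint_set_def using H1_0_add_C1c[OF \<Omega>(1,2) uH u_C1 \<xi>] c by simp
  then have le: "energy \<Omega> f u \<le> energy \<Omega> f ?v" by (rule minimal)
  have "u \<in> H1 \<Omega>" using uH unfolding H1_0_def by blast
  then have dens: "integrable \<nu> (H1_density u)" using H1_C1_iff[OF \<Omega>(1) u_C1] by simp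
  have gm: "grad u \<in> borel_measurable \<nu>"
    by (rule continuous_measurable_lebesgue_on[OF \<Omega>(1) C1_on_grad[OF u_C1]])
  have gi: "integrable \<nu> (\<lambda>x. (norm (grad u x))\<^sup>2)"
    by (rule Bochner_Integration.integrable_bound[OF dens])
       (use gm in \<open>auto simp: H1_density_def\<close>)
  have ci: "integrable \<nu> (\<lambda>x. grad u x \<bullet> grad \<xi> x)"
    by (rule green_identity(1)[OF \<Omega>(1) C2 \<xi>])
  have xi: "integrable \<nu> (\<lambda>x. (norm (grad \<xi> x))\<^sup>2)" by (rule norm_grad_C1c_integrable[OF \<xi>])
  have "energy \<Omega> f ?v = (LINT x|\<nu>. (1/2 * (norm (grad u x))\<^sup>2 + grad u x \<bullet> grad \<xi> x
      + 1/2 * (norm (grad \<xi> x))\<^sup>2) - primitive f x (?v x))"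
    unfolding energy_C1[OF v1]
  proof (rule Bochner_Integration.integral_cong[OF refl])
    fix x assume "x \<in> space \<nu>"
    then have "x \<in> \<Omega>" by simp
    then have "grad ?v x = grad u x + grad \<xi> x"
      using u_C1 C1c_differentiable[OF \<xi>] unfolding C1_on_def by (intro grad_add) auto
    then show "1/2 * (norm (grad ?v x))\<^sup>2 - primitive f x (?v x) = (1/2 * (norm (grad u x))\<^sup>2 + grad u x \<bullet> grad \<xi> x
      + 1/2 * (norm (grad \<xi> x))\<^sup>2) - primitive f x (?v x)"
      by (simp add: power2_norm_eq_inner inner_add_left inner_add_right inner_commute)
  qed
  also have "\<dots> = 1/2 * (LINT x|\<nu>. (norm (grad u x))\<^sup>2) + (LINT x|\<nu>. h x (u x) * \<xi> x)
      + 1/2 * (LINT x|\<nu>. (norm (grad \<xi> x))\<^sup>2) - (LINT x|\<nu>. primitive f x (?v x))"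
    using gi ci xi ri(3) by (simp add: weak_equation[OF \<xi>])
  finally have Ev: "energy \<Omega> f ?v = \<dots>" .
  have Eu: "energy \<Omega> f u = 1/2 * (LINT x|\<nu>. (norm (grad u x))\<^sup>2) - (LINT x|\<nu>. primitive f x (u x))"
    unfolding energy_C1[OF u_C1] using gi ri(5) by simp
  have "(LINT x|\<nu>. remainder \<xi> x) = ((LINT x|\<nu>. primitive f x (?v x)) + \<mu> * (LINT x|\<nu>. primitive g x (?v x)))
     - ((LINT x|\<nu>. primitive f x (u x)) + \<mu> * (LINT x|\<nu>. primitive g x (u x))) - (LINT x|\<nu>. h x (u x) * \<xi> x)"
    unfolding remainder_def H_def using ri by simp
  then show ?thesis using le unfolding Ev Eu c constr by linarith
qed

text \<open>
  The sign of the argument matches the perturbation \<open>u - a \<psi>\<close> used for the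
  energy.
\<close>

definition constraint_change :: "('a \<Rightarrow> real) \<Rightarrow> real \<Rightarrow> real" where
  "constraint_change \<psi> a = (LINT x|\<nu>. primitive g x (u x + - a * \<psi> x) - primitive g x (u x))"

lemma scaled_bound:
  assumes "0 \<le> s" "s \<le> 2 * M" "\<bar>a\<bar> \<le> 1/2" shows "\<bar>- a * s\<bar> \<le> M"
proof -
  have "\<bar>- a * s\<bar> = \<bar>a\<bar> * s" using assms(1) by (simp add: abs_mult)
  also have "\<dots> \<le> 1/2 * (2 * M)" by (rule mult_mono) (use assms in auto)
  finally show ?thesis by simp
qed

lemma constraint_change_lipschitz:
  assumes \<psi>: "\<psi> \<in> C1c \<Omega>" "\<And>x. 0 \<le> \<psi> x" "\<And>x. \<psi> x \<le> 2 * M" and ab: "\<bar>a\<bar> \<le> 1/2" "\<bar>b\<bar> \<le> 1/2"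
  shows "\<bar>constraint_change \<psi> a - constraint_change \<psi> b\<bar> \<le> (B * (2 * M) * measure \<nu> \<Omega>) * \<bar>a - b\<bar>"
proof -
  have i: "integrable \<nu> (\<lambda>x. primitive g x (u x + - a * \<psi> x))" if "\<bar>a\<bar> \<le> 1/2" for a
    by (rule remainder_integrable(2)[OF C1c_cmult[OF \<psi>(1)] scaled_bound[OF \<psi>(2,3) that]])
  have i0: "integrable \<nu> (\<lambda>x. primitive g x (u x))"
    by (rule remainder_integrable(4)[OF C1c_cmult[OF \<psi>(1)] scaled_bound[OF \<psi>(2,3) ab(1)]])
  have sp: "AE x in \<nu>. x \<in> \<Omega>" by (rule AE_I2) simp
  have "constraint_change \<psi> a - constraint_change \<psi> b
      = (LINT x|\<nu>. primitive g x (u x + - a * \<psi> x) - primitive g x (u x + - b * \<psi> x))"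
    unfolding constraint_change_def using i[OF ab(1)] i[OF ab(2)] i0 by simp
  also have "\<bar>\<dots>\<bar> \<le> (LINT x|\<nu>. B * (2 * M) * \<bar>a - b\<bar>)"
  proof -
    let ?w = "\<lambda>x. primitive g x (u x + - a * \<psi> x) - primitive g x (u x + - b * \<psi> x)"
    have wi: "integrable \<nu> ?w" by (rule Bochner_Integration.integrable_diff[OF i[OF ab(1)] i[OF ab(2)]])
    have ki: "integrable \<nu> (\<lambda>x. B * (2 * M) * \<bar>a - b\<bar>)"
      by (rule finite_measure.integrable_const[OF finite_lebesgue_on[OF \<Omega>(1,2)]])
    have ae: "AE x in \<nu>. \<bar>?w x\<bar> \<le> B * (2 * M) * \<bar>a - b\<bar>"
      using bound cont_ae sp
    proof eventually_elim
      case (elim x)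
      have r1: "u x + - a * \<psi> x \<in> {-(2*M)..2*M}"
        using scaled_bound[OF \<psi>(2)[of x] \<psi>(3)[of x] ab(1)] uM[OF elim(3)] unfolding abs_le_iff atLeastAtMost_iff by linarith
      have r2: "u x + - b * \<psi> x \<in> {-(2*M)..2*M}"
        using scaled_bound[OF \<psi>(2)[of x] \<psi>(3)[of x] ab(2)] uM[OF elim(3)] unfolding abs_le_iff atLeastAtMost_iff by linarith
      have gb: "\<forall>t\<in>{-(2*M)..2*M}. \<bar>g x t\<bar> \<le> B" using elim(1) by blast
      have "\<bar>?w x\<bar> \<le> B * \<bar>(u x + - a * \<psi> x) - (u x + - b * \<psi> x)\<bar>"
        by (rule primitive_increment[of g x, OF conjunct2[OF elim(2)] gb r2 r1])
      also have "(u x + - a * \<psi> x) - (u x + - b * \<psi> x) = (b - a) * \<psi> x" by (simp add: algebra_simps)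
      also have "B * \<bar>(b - a) * \<psi> x\<bar> = B * (\<bar>a - b\<bar> * \<psi> x)"
        using \<psi>(2)[of x] by (simp add: abs_mult abs_minus_commute)
      also have "\<dots> \<le> B * (\<bar>a - b\<bar> * (2 * M))"
        by (intro mult_left_mono \<psi>(3)) (use B in auto)
      finally show ?case by (simp only: mult_ac)
    qed
    show ?thesis
      by (rule order_trans[OF integral_abs_bound integral_mono_AE[OF integrable_abs[OF wi] ki ae]])
  qed
  also have "\<dots> = (B * (2 * M) * measure \<nu> \<Omega>) * \<bar>a - b\<bar>" by simp
  finally show ?thesis .
qed

lemma constraint_change_expansion:
  assumes \<psi>: "\<psi> \<in> C1c \<Omega>" "\<And>x. 0 \<le> \<psi> x" "\<And>x. \<psi> x \<le> 2 * M" and a: "\<bar>a\<bar> \<le> 1/2"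
  shows "\<bar>constraint_change \<psi> a + a * (LINT x|\<nu>. g x (u x) * \<psi> x)\<bar>
    \<le> (L * (2 * M)\<^sup>2 * measure \<nu> \<Omega>) * a\<^sup>2"
proof -
  note sb = scaled_bound[OF \<psi>(2,3) a]
  note ri = remainder_integrable[OF C1c_cmult[OF \<psi>(1)] sb]
  have gi: "integrable \<nu> (\<lambda>x. a * (g x (u x) * \<psi> x))"
  proof -
    have "(\<lambda>x. a * (g x (u x) * \<psi> x)) = (\<lambda>x. - (g x (u x) * (- a * \<psi> x)))" by (rule ext) simp
    then show ?thesis using ri(7) by (simp only: Bochner_Integration.integrable_minus)
  qed
  have sp: "AE x in \<nu>. x \<in> \<Omega>" by (rule AE_I2) simp
  let ?w = "\<lambda>x. (primitive g x (u x + - a * \<psi> x) - primitive g x (u x)) + a * (g x (u x) * \<psi> x)"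
  have wi: "integrable \<nu> ?w"
    by (rule Bochner_Integration.integrable_add[OF Bochner_Integration.integrable_diff[OF ri(2,4)] gi])
  have ki: "integrable \<nu> (\<lambda>x. L * (2 * M)\<^sup>2 * a\<^sup>2)"
    by (rule finite_measure.integrable_const[OF finite_lebesgue_on[OF \<Omega>(1,2)]])
  have ae: "AE x in \<nu>. \<bar>?w x\<bar> \<le> L * (2 * M)\<^sup>2 * a\<^sup>2"
    using lip cont_ae sp
  proof eventually_elim
    case (elim x)
    have r1: "u x + - a * \<psi> x \<in> {-(2*M)..2*M}"
      using sb[of x] uM[OF elim(3)] unfolding abs_le_iff atLeastAtMost_iff by linarith
    have r2: "u x \<in> {-(2*M)..2*M}"
      using uM[OF elim(3)] M(1) unfolding abs_le_iff atLeastAtMost_iff by linarith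
    have gl: "\<forall>s\<in>{-(2*M)..2*M}. \<forall>t\<in>{-(2*M)..2*M}. \<bar>g x s - g x t\<bar> \<le> L * \<bar>s - t\<bar>"
      using elim(1) by blast
    have L0: "L \<ge> 0" using L by simp
    have "\<bar>primitive g x (u x + - a * \<psi> x) - primitive g x (u x) - g x (u x) * ((u x + - a * \<psi> x) - u x)\<bar>
        \<le> L * ((u x + - a * \<psi> x) - u x)\<^sup>2"
      by (rule primitive_taylor[of g x, OF conjunct2[OF elim(2)] gl r2 r1 L0])
    also have "(u x + - a * \<psi> x) - u x = - (a * \<psi> x)" by simp
    also have "g x (u x) * - (a * \<psi> x) = - (a * (g x (u x) * \<psi> x))" by simp
    also have "L * (- (a * \<psi> x))\<^sup>2 = L * (a\<^sup>2 * (\<psi> x)\<^sup>2)" by (simp add: power_mult_distrib)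
    also have "\<dots> \<le> L * (a\<^sup>2 * (2 * M)\<^sup>2)"
      by (intro mult_left_mono power_mono \<psi>(2,3)) (use L in auto)
    finally show ?case by (simp only: diff_minus_eq_add mult_ac)
  qed
  have "constraint_change \<psi> a + a * (LINT x|\<nu>. g x (u x) * \<psi> x) = (LINT x|\<nu>. ?w x)"
  proof -
    have "a * (LINT x|\<nu>. g x (u x) * \<psi> x) = (LINT x|\<nu>. a * (g x (u x) * \<psi> x))"
      by simp
    then show ?thesis
      unfolding constraint_change_def
      using Bochner_Integration.integral_add[OF Bochner_Integration.integrable_diff[OF ri(2,4)] gi] by simp
  qed
  also have "\<bar>\<dots>\<bar> \<le> (LINT x|\<nu>. L * (2 * M)\<^sup>2 * a\<^sup>2)"
    by (rule order_trans[OF integral_abs_bound integral_mono_AE[OF integrable_abs[OF wi] ki ae]])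
  also have "\<dots> = (L * (2 * M)\<^sup>2 * measure \<nu> \<Omega>) * a\<^sup>2" by simp
  finally show ?thesis .
qed

lemma first_variation_constraint_nonzero:
  assumes \<psi>: "\<psi> \<in> C1c \<Omega>" "\<And>x. 0 \<le> \<psi> x" "\<psi> x0 > 0" "\<And>x. \<psi> x \<le> 2 * M"
  shows "(LINT x|\<nu>. g x (u x) * \<psi> x) \<noteq> 0"
proof -
  have i: "integrable \<nu> (\<lambda>x. g x (u x) * \<psi> x)"
    by (rule integrable_times_C1c[OF superposition_integrable(2)[OF u_measurable] \<psi>(1)])
       (use uM M(1) in force)
  from sign show ?thesis
  proof
    assume "AE x in \<nu>. g x (u x) > 0"
    then show ?thesis by (rule weighted_integral_C1c_neq_0[OF \<Omega>(1) _ i \<psi>(1-3)])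
  next
    assume "AE x in \<nu>. g x (u x) < 0"
    then have "AE x in \<nu>. - g x (u x) > 0" by simp
    then have "(LINT x|\<nu>. - g x (u x) * \<psi> x) \<noteq> 0"
      by (rule weighted_integral_C1c_neq_0[OF \<Omega>(1) _ _ \<psi>(1-3)]) (use i in simp)
    then show ?thesis by simp
  qed
qed

text \<open>
  At first order the constraint changes by \<open>- a p\<close> with \<open>p = \<integral> g(u)
  \<psi> \<noteq> 0\<close>, so for a small \<open>a\<close> its values at \<open>a\<close> and
  \<open>- a\<close> have opposite signs; the intermediate value theorem gives the rest.
\<close>

lemma constraint_change_surjective_near_0:
  assumes \<psi>: "\<psi> \<in> C1c \<Omega>" "\<And>x. 0 \<le> \<psi> x" "\<psi> x0 > 0" "\<And>x. \<psi> x \<le> 2 * M"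
  obtains \<eta> where "\<eta> > 0" "\<And>y. \<bar>y\<bar> \<le> \<eta> \<Longrightarrow> \<exists>a. \<bar>a\<bar> \<le> 1/2 \<and> constraint_change \<psi> a = y"
proof -
  define p where "p = (LINT x|\<nu>. g x (u x) * \<psi> x)"
  have p: "p \<noteq> 0" unfolding p_def by (rule first_variation_constraint_nonzero[OF \<psi>])
  let ?\<gamma> = "constraint_change \<psi>"
  define C where "C = L * (2 * M)\<^sup>2 * measure \<nu> \<Omega>"
  have C: "C \<ge> 0" unfolding C_def using L by simp
  have ex: "\<bar>?\<gamma> a + a * p\<bar> \<le> C * a\<^sup>2" if "\<bar>a\<bar> \<le> 1/2" for a
    unfolding p_def C_def by (rule constraint_change_expansion[OF \<psi>(1,2,4) that])
  \<comment> \<open>For this \<open>a\<close> the quadratic error \<open>C a\<^sup>2\<close> is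
    at most half of the linear term \<open>a |p|\<close>.\<close>
  define a where "a = min (1/2) (\<bar>p\<bar> / (2 * (C + 1)))"
  have "a > 0" unfolding a_def using p C by simp
  moreover have "a \<le> 1/2" unfolding a_def by (rule min.cobounded1)
  ultimately have a: "a > 0" "a \<le> 1/2" by blast+
  have "a \<le> \<bar>p\<bar> / (2 * (C + 1))" unfolding a_def by (rule min.cobounded2)
  then have "2 * (C + 1) * a \<le> \<bar>p\<bar>" using C by (simp add: pos_le_divide_eq mult_ac)
  moreover have "C * a \<le> (C + 1) * a" using a by simp
  ultimately have Ca: "C * a \<le> \<bar>p\<bar> / 2" by linarith
  have Ca2: "C * a\<^sup>2 \<le> a * \<bar>p\<bar> / 2"
    using mult_right_mono[OF Ca, of a] a(1) by (simp add: power2_eq_square mult_ac)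
  define \<eta> where "\<eta> = a * \<bar>p\<bar> / 2"
  have \<eta>: "\<eta> > 0" using a p by (simp add: \<eta>_def)
  have e1: "\<bar>?\<gamma> a + a * p\<bar> \<le> \<eta>" "\<bar>?\<gamma> (- a) - a * p\<bar> \<le> \<eta>"
    using ex[of a] ex[of "- a"] a Ca2 by (auto simp: \<eta>_def)
  have cont: "continuous_on {-a..a} ?\<gamma>"
  proof (rule lipschitz_on_continuous_on[OF lipschitz_onI])
    fix s t assume "s \<in> {-a..a}" "t \<in> {-a..a}"
    then have "\<bar>s\<bar> \<le> 1/2" "\<bar>t\<bar> \<le> 1/2" using a by auto
    then show "dist (?\<gamma> s) (?\<gamma> t) \<le> (B * (2 * M) * measure \<nu> \<Omega>) * dist s t"
      unfolding dist_real_def by (rule constraint_change_lipschitz[OF \<psi>(1,2,4)])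
  qed (use B M(1) in simp)
  have "\<exists>s. \<bar>s\<bar> \<le> 1/2 \<and> ?\<gamma> s = y" if y: "\<bar>y\<bar> \<le> \<eta>" for y
  proof (cases "p > 0")
    case True
    have "a * p = 2 * \<eta>" using True by (simp add: \<eta>_def)
    then have "?\<gamma> a \<le> y" "y \<le> ?\<gamma> (- a)" using e1 y by (auto simp: abs_le_iff)
    then obtain s where "-a \<le> s" "s \<le> a" "?\<gamma> s = y"
      using IVT2'[OF _ _ _ cont, of y] a by auto
    then show ?thesis using a by (intro exI[of _ s]) auto
  next
    case False
    have "a * p = - (2 * \<eta>)" using False p by (simp add: \<eta>_def)
    then have "?\<gamma> (- a) \<le> y" "y \<le> ?\<gamma> a" using e1 y by (auto simp: abs_le_iff)
    then obtain s where "-a \<le> s" "s \<le> a" "?\<gamma> s = y"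
      using IVT'[OF _ _ _ cont, of y] a by auto
    then show ?thesis using a by (intro exI[of _ s]) auto
  qed
  then show thesis using that[OF \<eta>] by blast
qed

text \<open>
  At each point one of the two functions vanishes together with its gradient, so all the
  integrals in the expansion of the energy and of the constraint add up.
\<close>

lemma remainder_integral_disjoint:
  assumes \<phi>: "\<phi> \<in> C1c \<Omega>" "\<And>x. \<bar>\<phi> x\<bar> \<le> M" and \<psi>: "\<psi> \<in> C1c \<Omega>" "\<And>x. \<bar>\<psi> x\<bar> \<le> M"
    and d: "\<And>x. (\<phi> x = 0 \<and> grad \<phi> x = 0) \<or> (\<psi> x = 0 \<and> grad \<psi> x = 0)"
  shows "\<bar>\<phi> x + \<psi> x\<bar> \<le> M"
    "(LINT x|\<nu>. remainder (\<lambda>x. \<phi> x + \<psi> x) x) = (LINT x|\<nu>. remainder \<phi> x) + (LINT x|\<nu>. remainder \<psi> x)"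
    "(LINT x|\<nu>. (norm (grad (\<lambda>x. \<phi> x + \<psi> x) x))\<^sup>2) = (LINT x|\<nu>. (norm (grad \<phi> x))\<^sup>2) + (LINT x|\<nu>. (norm (grad \<psi> x))\<^sup>2)"
    "(LINT x|\<nu>. primitive g x (u x + (\<phi> x + \<psi> x)))
      = 1 + (LINT x|\<nu>. primitive g x (u x + \<phi> x) - primitive g x (u x)) + (LINT x|\<nu>. primitive g x (u x + \<psi> x) - primitive g x (u x))"
proof -
  note r1 = remainder_integrable[OF \<phi>] and r2 = remainder_integrable[OF \<psi>]
  show "\<bar>\<phi> x + \<psi> x\<bar> \<le> M" using d[of x] \<phi>(2)[of x] \<psi>(2)[of x] by auto
  have "(LINT x|\<nu>. remainder (\<lambda>x. \<phi> x + \<psi> x) x) = (LINT x|\<nu>. remainder \<phi> x + remainder \<psi> x)"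
  proof (rule Bochner_Integration.integral_cong[OF refl])
    fix x show "remainder (\<lambda>x. \<phi> x + \<psi> x) x = remainder \<phi> x + remainder \<psi> x"
      using d[of x] by (elim disjE) (simp_all add: remainder_def)
  qed
  then show "(LINT x|\<nu>. remainder (\<lambda>x. \<phi> x + \<psi> x) x) = (LINT x|\<nu>. remainder \<phi> x) + (LINT x|\<nu>. remainder \<psi> x)"
    using r1(1) r2(1) by simp
  have ga: "grad (\<lambda>x. \<phi> x + \<psi> x) x = grad \<phi> x + grad \<psi> x" for x
    by (rule grad_add[OF C1c_differentiable[OF \<phi>(1)] C1c_differentiable[OF \<psi>(1)]])
  have "(LINT x|\<nu>. (norm (grad (\<lambda>x. \<phi> x + \<psi> x) x))\<^sup>2) = (LINT x|\<nu>. (norm (grad \<phi> x))\<^sup>2 + (norm (grad \<psi> x))\<^sup>2)"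
  proof (rule Bochner_Integration.integral_cong[OF refl])
    fix x show "(norm (grad (\<lambda>x. \<phi> x + \<psi> x) x))\<^sup>2 = (norm (grad \<phi> x))\<^sup>2 + (norm (grad \<psi> x))\<^sup>2"
      unfolding ga using d[of x] by (elim disjE) simp_all
  qed
  then show "(LINT x|\<nu>. (norm (grad (\<lambda>x. \<phi> x + \<psi> x) x))\<^sup>2) = (LINT x|\<nu>. (norm (grad \<phi> x))\<^sup>2) + (LINT x|\<nu>. (norm (grad \<psi> x))\<^sup>2)"
    using norm_grad_C1c_integrable[OF \<phi>(1)] norm_grad_C1c_integrable[OF \<psi>(1)] by simp
  have "(LINT x|\<nu>. primitive g x (u x + (\<phi> x + \<psi> x)))
    = (LINT x|\<nu>. primitive g x (u x) + (primitive g x (u x + \<phi> x) - primitive g x (u x)) + (primitive g x (u x + \<psi> x) - primitive g x (u x)))"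
  proof (rule Bochner_Integration.integral_cong[OF refl])
    fix x show "primitive g x (u x + (\<phi> x + \<psi> x))
      = primitive g x (u x) + (primitive g x (u x + \<phi> x) - primitive g x (u x)) + (primitive g x (u x + \<psi> x) - primitive g x (u x))"
      using d[of x] by (elim disjE) simp_all
  qed
  then show "(LINT x|\<nu>. primitive g x (u x + (\<phi> x + \<psi> x)))
      = 1 + (LINT x|\<nu>. primitive g x (u x + \<phi> x) - primitive g x (u x)) + (LINT x|\<nu>. primitive g x (u x + \<psi> x) - primitive g x (u x))"
    using r1(2,4) r2(2,4) constr by simp
qed

text \<open>
  Otherwise there are descent directions \<open>\<psi>1\<close> and \<open>\<psi>2\<close> on
  the two halves. Take a small step \<open>\<beta> \<noteq> 0\<close> along
  \<open>\<psi>2\<close> and restore the constraint by a step \<open>\<alpha>\<close> along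
  \<open>\<psi>1\<close>. The supports are disjoint, so the changes of energy add up: the step
  along \<open>\<psi>1\<close> does not raise the energy and the one along
  \<open>\<psi>2\<close> lowers it.
\<close>

lemma reflection_dichotomy:
  assumes e: "norm e = 1"
  shows "(\<forall>x\<in>\<Omega>. x \<bullet> e > 0 \<longrightarrow> u x \<le> u (reflect e x)) \<or> (\<forall>x\<in>\<Omega>. x \<bullet> (- e) > 0 \<longrightarrow> u x \<le> u (reflect (- e) x))"
proof (rule ccontr)
  assume "\<not> ?thesis"
  then have n: "\<not> (\<forall>x\<in>\<Omega>. x \<bullet> e > 0 \<longrightarrow> u x \<le> u (reflect e x))"
    "\<not> (\<forall>x\<in>\<Omega>. x \<bullet> (- e) > 0 \<longrightarrow> u x \<le> u (reflect (- e) x))" by blast+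
  obtain x1 where x1: "x1 \<in> \<Omega>" "x1 \<bullet> e > 0" "u (reflect e x1) < u x1"
    using n(1) unfolding not_le[symmetric] by blast
  obtain x2 where x2: "x2 \<in> \<Omega>" "x2 \<bullet> (- e) > 0" "u (reflect (- e) x2) < u x2"
    using n(2) unfolding not_le[symmetric] by blast
  have e': "norm (- e) = 1" using e by simp
  obtain \<psi>1 c1 where p1: "\<psi>1 \<in> C1c (\<Omega> \<inter> {x. x \<bullet> e > 0})" "\<And>x. 0 \<le> \<psi>1 x" "\<And>x. \<psi>1 x \<le> 2 * M" "\<psi>1 x1 > 0" "c1 > 0"
    "\<And>\<alpha>. \<bar>\<alpha>\<bar> \<le> 1/2 \<Longrightarrow> 1/2 * \<alpha>\<^sup>2 * (LINT x|\<nu>. (norm (grad \<psi>1 x))\<^sup>2)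
     - (LINT x|\<nu>. remainder (\<lambda>x. - \<alpha> * \<psi>1 x) x) \<le> - (c1 * \<alpha>\<^sup>2)"
    by (rule descent_direction[OF e x1]) (rule that; assumption)
  obtain \<psi>2 c2 where p2: "\<psi>2 \<in> C1c (\<Omega> \<inter> {x. x \<bullet> (- e) > 0})" "\<And>x. 0 \<le> \<psi>2 x" "\<And>x. \<psi>2 x \<le> 2 * M" "\<psi>2 x2 > 0" "c2 > 0"
    "\<And>\<alpha>. \<bar>\<alpha>\<bar> \<le> 1/2 \<Longrightarrow> 1/2 * \<alpha>\<^sup>2 * (LINT x|\<nu>. (norm (grad \<psi>2 x))\<^sup>2)
     - (LINT x|\<nu>. remainder (\<lambda>x. - \<alpha> * \<psi>2 x) x) \<le> - (c2 * \<alpha>\<^sup>2)"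
    by (rule descent_direction[OF e' x2]) (rule that; assumption)
  have q1: "\<psi>1 \<in> C1c \<Omega>" and q2: "\<psi>2 \<in> C1c \<Omega>" using C1c_mono[OF p1(1)] C1c_mono[OF p2(1)] by auto
  obtain \<eta> where \<eta>: "\<eta> > 0" "\<And>y. \<bar>y\<bar> \<le> \<eta> \<Longrightarrow> \<exists>a. \<bar>a\<bar> \<le> 1/2 \<and> constraint_change \<psi>1 a = y"
    by (rule constraint_change_surjective_near_0[OF q1 p1(2,4,3)]) (rule that; assumption)
  define C where "C = B * (2 * M) * measure \<nu> \<Omega>"
  have C: "C \<ge> 0" unfolding C_def using B M(1) by simp
  \<comment> \<open>Small enough that the change of the constraint along \<open>\<psi>2\<close>
    can be compensated along \<open>\<psi>1\<close>.\<close>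
  define \<beta> where "\<beta> = min (1/2) (\<eta> / (C + 1))"
  have \<beta>: "\<beta> > 0" unfolding \<beta>_def using \<eta>(1) C by simp
  have \<beta>2: "\<beta> \<le> 1/2" unfolding \<beta>_def by (rule min.cobounded1)
  have "\<beta> \<le> \<eta> / (C + 1)" unfolding \<beta>_def by (rule min.cobounded2)
  then have "(C + 1) * \<beta> \<le> \<eta>" using C by (simp add: pos_le_divide_eq mult_ac)
  moreover have "C * \<beta> \<le> (C + 1) * \<beta>" using \<beta> by simp
  ultimately have "C * \<beta> \<le> \<eta>" by linarith
  moreover have "\<bar>constraint_change \<psi>2 \<beta> - constraint_change \<psi>2 0\<bar> \<le> C * \<bar>\<beta> - 0\<bar>"
    unfolding C_def by (rule constraint_change_lipschitz[OF q2 p2(2,3)]) (use \<beta> \<beta>2 in auto)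
  moreover have "constraint_change \<psi>2 0 = 0" by (simp add: constraint_change_def)
  ultimately have "\<bar>- constraint_change \<psi>2 \<beta>\<bar> \<le> \<eta>" using \<beta> by simp
  then obtain \<alpha> where \<alpha>: "\<bar>\<alpha>\<bar> \<le> 1/2" "constraint_change \<psi>1 \<alpha> = - constraint_change \<psi>2 \<beta>"
    using \<eta>(2) by blast
  have \<beta>': "\<bar>\<beta>\<bar> \<le> 1/2" using \<beta> \<beta>2 by simp
  let ?\<phi> = "\<lambda>x. - \<alpha> * \<psi>1 x" and ?\<psi> = "\<lambda>x. - \<beta> * \<psi>2 x"
  have g: "grad ?\<phi> x = (- \<alpha>) *\<^sub>R grad \<psi>1 x" "grad ?\<psi> x = (- \<beta>) *\<^sub>R grad \<psi>2 x" for x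
    using grad_cmult[OF C1c_differentiable[OF q1], of "- \<alpha>" x] grad_cmult[OF C1c_differentiable[OF q2], of "- \<beta>" x]
    by auto
  have d: "(?\<phi> x = 0 \<and> grad ?\<phi> x = 0) \<or> (?\<psi> x = 0 \<and> grad ?\<psi> x = 0)" for x
  proof (cases "x \<bullet> e > 0")
    case True
    then have "x \<notin> \<Omega> \<inter> {x. x \<bullet> (- e) > 0}" by simp
    then show ?thesis using C1c_outside[OF p2(1)] C1c_grad_outside[OF p2(1)] g by simp
  next
    case False
    then have "x \<notin> \<Omega> \<inter> {x. x \<bullet> e > 0}" by simp
    then show ?thesis using C1c_outside[OF p1(1)] C1c_grad_outside[OF p1(1)] g by simp
  qed
  note dj = remainder_integral_disjoint[OF C1c_cmult[OF q1] scaled_bound[OF p1(2,3) \<alpha>(1)]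
      C1c_cmult[OF q2] scaled_bound[OF p2(2,3) \<beta>'] d]
  have "(LINT x|\<nu>. primitive g x (u x + (?\<phi> x + ?\<psi> x))) = 1"
    using dj(4) \<alpha>(2) unfolding constraint_change_def by simp
  then have "(LINT x|\<nu>. remainder (\<lambda>x. ?\<phi> x + ?\<psi> x) x) \<le> 1/2 * (LINT x|\<nu>. (norm (grad (\<lambda>x. ?\<phi> x + ?\<psi> x) x))\<^sup>2)"
    by (rule second_variation[OF C1c_add[OF C1c_cmult[OF q1] C1c_cmult[OF q2]] dj(1)])
  moreover have "(LINT x|\<nu>. (norm (grad ?\<phi> x))\<^sup>2) = \<alpha>\<^sup>2 * (LINT x|\<nu>. (norm (grad \<psi>1 x))\<^sup>2)"
    "(LINT x|\<nu>. (norm (grad ?\<psi> x))\<^sup>2) = \<beta>\<^sup>2 * (LINT x|\<nu>. (norm (grad \<psi>2 x))\<^sup>2)"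
    unfolding g by (simp_all add: power_mult_distrib)
  ultimately have "0 \<le> - (c1 * \<alpha>\<^sup>2) - c2 * \<beta>\<^sup>2"
    using p1(6)[OF \<alpha>(1)] p2(6)[OF \<beta>'] dj(2,3) by (simp add: distrib_left)
  moreover have "c1 * \<alpha>\<^sup>2 \<ge> 0" "c2 * \<beta>\<^sup>2 > 0" using p1(5) p2(5) \<beta> by simp_all
  ultimately show False by linarith
qed

end

section \<open>From the dichotomy to axial symmetry\<close>

text \<open>
  The sign convention is that \<open>u\<close> is larger on the side away from \<open>e\<close>.
  The property for \<open>e\<close> and for \<open>- e\<close> concerns the same reflection with
  the two halves exchanged.
\<close>

definition dominates :: "('a::euclidean_space \<Rightarrow> real) \<Rightarrow> 'a set \<Rightarrow> 'a \<Rightarrow> bool" where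
  "dominates u \<Omega> e \<longleftrightarrow> (\<forall>x\<in>\<Omega>. x \<bullet> e > 0 \<longrightarrow> u x \<le> u (reflect e x))"

lemma dominates_both_symmetric:
  assumes \<Omega>: "radial_set \<Omega>" and e: "norm e = 1" and d: "dominates u \<Omega> e" "dominates u \<Omega> (- e)" and x: "x \<in> \<Omega>"
  shows "u (reflect e x) = u x"
proof -
  have le: "u y \<le> u (reflect e y)" if "y \<in> \<Omega>" "y \<bullet> e \<noteq> 0" for y
  proof (cases "y \<bullet> e > 0")
    case True
    then show ?thesis using d(1) that unfolding dominates_def by blast
  next
    case False
    then have "y \<bullet> (- e) > 0" using that by simp
    then show ?thesis using d(2) that unfolding dominates_def reflect_minus_axis by blast
  qed
  show ?thesis
  proof (cases "x \<bullet> e = 0")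
    case True
    then show ?thesis by (simp add: reflect_def)
  next
    case False
    have "u (reflect e x) \<le> u (reflect e (reflect e x))"
      by (rule le) (use x reflect_mem[OF \<Omega> e, of x] reflect_inner_axis[OF e, of x] False in auto)
    then show ?thesis using le[OF x False] reflect_involution[OF e, of x] by simp
  qed
qed

text \<open>
  For fixed \<open>x\<close> the condition \<open>x \<bullet> e > 0\<close> is open, but on its
  boundary the inequality holds trivially as \<open>\<sigma>\<close> fixes \<open>x\<close>; so
  the set is a union of two closed sets.
\<close>

lemma dominates_closed:
  fixes u :: "'a::euclidean_space \<Rightarrow> real" and c :: "real \<Rightarrow> 'a"
  assumes \<Omega>: "radial_set \<Omega>" and u: "continuous_on \<Omega> u" and c: "continuous_on UNIV c" "\<And>\<theta>. norm (c \<theta>) = 1"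
  shows "closed {\<theta>. dominates u \<Omega> (c \<theta>)}"
proof -
  have "closed {\<theta>. x \<bullet> c \<theta> > 0 \<longrightarrow> u x \<le> u (reflect (c \<theta>) x)}" if x: "x \<in> \<Omega>" for x
  proof -
    have eq: "{\<theta>. x \<bullet> c \<theta> > 0 \<longrightarrow> u x \<le> u (reflect (c \<theta>) x)}
        = {\<theta>. x \<bullet> c \<theta> \<le> 0} \<union> {\<theta>. u x \<le> u (reflect (c \<theta>) x)}" by auto
    have "continuous_on UNIV (\<lambda>\<theta>. reflect (c \<theta>) x)"
      unfolding reflect_def by (intro continuous_intros c(1))
    then have "continuous_on UNIV (\<lambda>\<theta>. u (reflect (c \<theta>) x))"
      by (rule continuous_on_compose2[OF u]) (use reflect_mem[OF \<Omega> c(2)] x in auto)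
    then have "closed {\<theta>. u x \<le> u (reflect (c \<theta>) x)}"
      by (intro closed_Collect_le continuous_on_const)
    moreover have "closed {\<theta>. x \<bullet> c \<theta> \<le> 0}"
      by (intro closed_Collect_le continuous_on_const continuous_on_inner c(1))
    ultimately show ?thesis unfolding eq by (rule closed_Un[rotated])
  qed
  moreover have "{\<theta>. dominates u \<Omega> (c \<theta>)} = (\<Inter>x\<in>\<Omega>. {\<theta>. x \<bullet> c \<theta> > 0 \<longrightarrow> u x \<le> u (reflect (c \<theta>) x)})"
    unfolding dominates_def by auto
  ultimately show ?thesis by auto
qed

text \<open>
  On the half circle from \<open>a\<close> to \<open>- a\<close> the two closed sets of angles
  for \<open>e\<close> and for \<open>- e\<close> cover everything, and both are nonempty since
  they exchange roles between the two endpoints. By connectedness they meet.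
\<close>

lemma symmetric_direction_on_circle:
  fixes u :: "'a::euclidean_space \<Rightarrow> real"
  assumes \<Omega>: "radial_set \<Omega>" and u: "continuous_on \<Omega> u"
    and d: "\<And>e. norm e = 1 \<Longrightarrow> dominates u \<Omega> e \<or> dominates u \<Omega> (- e)"
    and ab: "norm a = 1" "norm b = 1" "a \<bullet> b = 0"
  obtains e where "norm e = 1" "e \<in> span {a, b}" "dominates u \<Omega> e" "dominates u \<Omega> (- e)"
proof -
  define c where "c \<theta> = cos \<theta> *\<^sub>R a + sin \<theta> *\<^sub>R b" for \<theta> :: real
  have cc: "continuous_on UNIV c" "continuous_on UNIV (\<lambda>\<theta>. - c \<theta>)"
    unfolding c_def by (intro continuous_intros)+
  have cn: "norm (c \<theta>) = 1" for \<theta>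
  proof -
    have "c \<theta> \<bullet> c \<theta> = (cos \<theta>)\<^sup>2 + (sin \<theta>)\<^sup>2"
      using ab unfolding c_def by (simp add: inner_simps inner_commute norm_eq_1 power2_eq_square)
    then show ?thesis by (simp add: norm_eq_1)
  qed
  let ?A = "{\<theta>. dominates u \<Omega> (c \<theta>)}" and ?B = "{\<theta>. dominates u \<Omega> (- c \<theta>)}"
  have cA: "closed ?A" by (rule dominates_closed[OF \<Omega> u cc(1) cn])
  have cB: "closed ?B" by (rule dominates_closed[OF \<Omega> u cc(2)]) (simp add: cn)
  have cov: "{0..pi} \<subseteq> ?A \<union> ?B" using d[OF cn] by auto
  have ends: "c 0 = a" "c pi = - a" by (simp_all add: c_def)
  have "0 \<in> {0..pi}" "pi \<in> {0..pi}" by auto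
  moreover have "dominates u \<Omega> a \<or> dominates u \<Omega> (- a)" by (rule d[OF ab(1)])
  moreover have "dominates u \<Omega> a \<Longrightarrow> 0 \<in> ?A \<and> pi \<in> ?B" "dominates u \<Omega> (- a) \<Longrightarrow> pi \<in> ?A \<and> 0 \<in> ?B"
    by (simp_all add: ends)
  ultimately have "?A \<inter> {0..pi} \<noteq> {}" "?B \<inter> {0..pi} \<noteq> {}" by blast+
  moreover have "connected {0..pi}" by (rule connected_Icc)
  ultimately have "?A \<inter> ?B \<inter> {0..pi} \<noteq> {}" using cA cB cov unfolding connected_closed by blast
  then obtain \<theta> where \<theta>: "dominates u \<Omega> (c \<theta>)" "dominates u \<Omega> (- c \<theta>)" by blast
  have "c \<theta> \<in> span {a, b}" unfolding c_def by (intro span_add span_scale span_base) auto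
  then show thesis by (rule that[OF cn _ \<theta>])
qed

lemma exists_orthogonal_unit:
  fixes B :: "'a::euclidean_space set"
  assumes "finite B" "card B < DIM('a)"
  obtains a where "norm a = 1" "\<And>y. y \<in> B \<Longrightarrow> a \<bullet> y = 0"
proof -
  have "dim B \<le> card B" using assms(1) dim_le_card' by blast
  then have "dim B < DIM('a)" using assms(2) by simp
  then obtain x where x: "x \<noteq> 0" "\<And>y. y \<in> span B \<Longrightarrow> orthogonal x y"
    using orthogonal_to_subspace_exists by blast
  show thesis
  proof (rule that[of "x /\<^sub>R norm x"])
    show "norm (x /\<^sub>R norm x) = 1" using x(1) by simp
    fix y assume "y \<in> B"
    then have "x \<bullet> y = 0" using x(2) span_base unfolding orthogonal_def by blast
    then show "(x /\<^sub>R norm x) \<bullet> y = 0" by simp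
  qed
qed

text \<open>
  As long as fewer than \<open>N - 1\<close> directions are chosen, their orthogonal complement
  contains a great circle, and this circle contains a further symmetric direction.
\<close>

lemma symmetric_orthonormal_family:
  fixes u :: "'a::euclidean_space \<Rightarrow> real"
  assumes \<Omega>: "radial_set \<Omega>" and u: "continuous_on \<Omega> u"
    and d: "\<And>e. norm e = 1 \<Longrightarrow> dominates u \<Omega> e \<or> dominates u \<Omega> (- e)"
    and k: "k + 1 \<le> DIM('a)"
  shows "\<exists>B. finite B \<and> card B = k \<and> pairwise orthogonal B \<and> (\<forall>b\<in>B. norm b = 1 \<and> dominates u \<Omega> b \<and> dominates u \<Omega> (- b))"
  using k
proof (induction k)
  case 0
  then show ?case by (intro exI[of _ "{}"]) auto
next
  case (Suc k)
  then obtain B where B: "finite B" "card B = k" "pairwise orthogonal B"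
      "\<And>b. b \<in> B \<Longrightarrow> norm b = 1 \<and> dominates u \<Omega> b \<and> dominates u \<Omega> (- b)" by auto
  obtain a where a: "norm a = 1" "\<And>y. y \<in> B \<Longrightarrow> a \<bullet> y = 0"
    by (rule exists_orthogonal_unit[OF B(1)]) (use B(2) Suc.prems in auto)
  have ci: "card (insert a B) \<le> Suc (card B)" by (rule card_insert_le_m1) auto
  obtain b where b: "norm b = 1" "\<And>y. y \<in> insert a B \<Longrightarrow> b \<bullet> y = 0"
    by (rule exists_orthogonal_unit[of "insert a B"]) (use B(1,2) Suc.prems ci in auto)
  have "a \<bullet> b = 0" using b(2)[of a] by (simp add: inner_commute)
  then obtain e where e: "norm e = 1" "e \<in> span {a, b}" "dominates u \<Omega> e" "dominates u \<Omega> (- e)"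
    using symmetric_direction_on_circle[OF \<Omega> u d a(1) b(1)] by blast
  have eB: "e \<bullet> y = 0" if "y \<in> B" for y
  proof -
    have yab: "y \<bullet> a = 0" "y \<bullet> b = 0" using a(2)[of y] b(2)[of y] that by (simp_all add: inner_commute)
    have "orthogonal y e"
      by (rule orthogonal_to_span[OF e(2)]) (use yab in \<open>auto simp: orthogonal_def\<close>)
    then show ?thesis by (simp add: orthogonal_def inner_commute)
  qed
  have "e \<notin> B" using eB[of e] e(1) by auto
  then have "card (insert e B) = Suc k" using B(1,2) by simp
  moreover have "pairwise orthogonal (insert e B)"
    using B(3) eB by (auto simp: pairwise_insert orthogonal_def inner_commute)
  ultimately show ?case
    by (intro exI[of _ "insert e B"]) (use B e in auto)
qed

text \<open>
  Let \<open>e\<close> span the line orthogonal to \<open>N - 1\<close> orthonormal symmetric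
  directions. The product \<open>T\<close> of their reflections fixes \<open>e\<close> and is
  \<open>-1\<close> on its orthogonal complement. For \<open>c\<close> orthogonal to
  \<open>e\<close>, \<open>T\<close> exchanges the halves of \<open>c\<close> and commutes with
  the reflection in the direction \<open>c\<close>, so the dichotomy for \<open>c\<close>
  becomes symmetry. Finally, if an orthogonal map \<open>R\<close> fixes \<open>e\<close>, then
  \<open>R x - x\<close> is orthogonal to \<open>e\<close>, and the reflection in this direction
  takes \<open>x\<close> to \<open>R x\<close>.
\<close>

lemma axially_symmetric_if_dominates:
  fixes u :: "'a::euclidean_space \<Rightarrow> real"
  assumes \<Omega>: "radial_set \<Omega>" and u: "continuous_on \<Omega> u"
    and d: "\<And>e. norm e = 1 \<Longrightarrow> dominates u \<Omega> e \<or> dominates u \<Omega> (- e)"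
  shows "axially_symmetric_on \<Omega> u"
proof -
  have "DIM('a) - 1 + 1 \<le> DIM('a)" using DIM_positive[where 'a='a] by linarith
  then obtain B where B: "finite B" "card B = DIM('a) - 1" "pairwise orthogonal B"
      "\<And>b. b \<in> B \<Longrightarrow> norm b = 1 \<and> dominates u \<Omega> b \<and> dominates u \<Omega> (- b)"
    using symmetric_orthonormal_family[OF \<Omega> u d, of "DIM('a) - 1"] by metis
  obtain e where e: "norm e = 1" "\<And>y. y \<in> B \<Longrightarrow> e \<bullet> y = 0"
    by (rule exists_orthogonal_unit[OF B(1)]) (use B(2) DIM_positive[where 'a='a] in auto)
  have eB: "e \<notin> B" using e by force
  have oi: "pairwise orthogonal (insert e B)"
    using B(3) e(2) by (auto simp: pairwise_insert orthogonal_def inner_commute)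
  have n1: "\<And>b. b \<in> insert e B \<Longrightarrow> norm b = 1" using B(4) e(1) by auto
  have "independent (insert e B)"
    by (rule pairwise_orthogonal_independent[OF oi]) (use n1 in force)
  moreover have "card (insert e B) = DIM('a)" using B(1,2) eB DIM_positive[where 'a='a] by simp
  ultimately have sp: "UNIV \<subseteq> span (insert e B)" by (intro card_ge_dim_independent) auto
  have expand: "x = (x \<bullet> e) *\<^sub>R e + (\<Sum>b\<in>B. (x \<bullet> b) *\<^sub>R b)" for x
  proof -
    have "x \<in> span (insert e B)" using sp by blast
    then have "(\<Sum>b\<in>insert e B. (x \<bullet> b) *\<^sub>R b) = x"
      by (intro orthonormal_basis_expand[OF oi n1]) (use B(1) in simp_all)
    then show ?thesis using B(1) eB by simp
  qed
  define T where "T x = (2 * (x \<bullet> e)) *\<^sub>R e - x" for x :: 'a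
  \<comment> \<open>Partial products of the reflections, by induction on the set of
    directions.\<close>
  have sub: "x - 2 *\<^sub>R (\<Sum>b\<in>B'. (x \<bullet> b) *\<^sub>R b) \<in> \<Omega> \<and> u (x - 2 *\<^sub>R (\<Sum>b\<in>B'. (x \<bullet> b) *\<^sub>R b)) = u x"
    if "B' \<subseteq> B" "x \<in> \<Omega>" for B' x
    using finite_subset[OF that(1) B(1)] that
  proof (induction B')
    case (insert b B')
    let ?y = "x - 2 *\<^sub>R (\<Sum>b\<in>B'. (x \<bullet> b) *\<^sub>R b)"
    have y: "?y \<in> \<Omega>" "u ?y = u x" using insert by auto
    have b: "norm b = 1" "dominates u \<Omega> b" "dominates u \<Omega> (- b)" using B(4) insert.prems by auto
    have "(\<Sum>c\<in>B'. (x \<bullet> c) *\<^sub>R c) \<bullet> b = 0"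
      unfolding inner_sum_left
    proof (rule sum.neutral, rule ballI)
      fix c assume c: "c \<in> B'"
      then have "c \<noteq> b" "c \<in> B" "b \<in> B" using insert by auto
      then have "c \<bullet> b = 0" using B(3) unfolding pairwise_def orthogonal_def by blast
      then show "(x \<bullet> c) *\<^sub>R c \<bullet> b = 0" by simp
    qed
    then have yb: "?y \<bullet> b = x \<bullet> b" by (simp add: inner_diff_left)
    have r: "reflect b ?y = x - 2 *\<^sub>R (\<Sum>c\<in>insert b B'. (x \<bullet> c) *\<^sub>R c)"
      unfolding reflect_def yb using insert by (simp add: scaleR_add_right)
    show ?case
      using y reflect_mem[OF \<Omega> b(1), of ?y] dominates_both_symmetric[OF \<Omega> b y(1)] unfolding r by simp
  qed simp
  have T: "T x \<in> \<Omega>" "u (T x) = u x" if "x \<in> \<Omega>" for x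
  proof -
    have "T x = x - 2 *\<^sub>R (\<Sum>b\<in>B. (x \<bullet> b) *\<^sub>R b)"
    proof -
      have "(\<Sum>b\<in>B. (x \<bullet> b) *\<^sub>R b) = x - (x \<bullet> e) *\<^sub>R e" using expand[of x] by (metis add_diff_cancel_left')
      then have "x - 2 *\<^sub>R (\<Sum>b\<in>B. (x \<bullet> b) *\<^sub>R b) = x - 2 *\<^sub>R (x - (x \<bullet> e) *\<^sub>R e)"
        by (simp only:)
      also have "\<dots> = T x" unfolding T_def by (simp add: scaleR_diff_right scaleR_2)
      finally show ?thesis by (rule sym)
    qed
    then show "T x \<in> \<Omega>" "u (T x) = u x" using sub[OF order_refl that] by auto
  qed
  have flip: "dominates u \<Omega> (- c)" if c: "norm c = 1" "c \<bullet> e = 0" "dominates u \<Omega> c" for c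
    unfolding dominates_def reflect_minus_axis
  proof (intro ballI impI)
    fix x assume x: "x \<in> \<Omega>" "0 < x \<bullet> (- c)"
    have "T x \<bullet> c = - (x \<bullet> c)" using c(2) by (simp add: T_def inner_simps inner_commute)
    then have "u (T x) \<le> u (reflect c (T x))" using c(3) T(1)[OF x(1)] x(2) unfolding dominates_def by auto
    also have "reflect c (T x) = T (reflect c x)"
      using c(2) unfolding reflect_def T_def by (simp add: inner_simps inner_commute algebra_simps)
    also have "u (T (reflect c x)) = u (reflect c x)" by (rule T(2)) (use x(1) reflect_mem[OF \<Omega> c(1)] in simp)
    finally show "u x \<le> u (reflect c x)" using T(2)[OF x(1)] by simp
  qed
  have sym: "u (reflect c x) = u x" if c: "norm c = 1" "c \<bullet> e = 0" and x: "x \<in> \<Omega>" for c x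
  proof (rule dominates_both_symmetric[OF \<Omega> c(1) _ _ x])
    have c': "norm (- c) = 1" "- c \<bullet> e = 0" using c by auto
    show "dominates u \<Omega> c" "dominates u \<Omega> (- c)" using d[OF c(1)] flip[OF c] flip[OF c'] by auto
  qed
  show ?thesis
    unfolding axially_symmetric_on_def
  proof (intro exI[of _ e] conjI allI impI ballI)
    show "e \<noteq> 0" using e(1) by auto
    fix R x assume R: "orthogonal_transformation R \<and> (\<forall>y\<in>span {e}. R y = y)" and x: "x \<in> \<Omega>"
    have Re: "R e = e" using R span_base by blast
    have ip: "R v \<bullet> R w = v \<bullet> w" for v w using R unfolding orthogonal_transformation_def by blast
    show "u (R x) = u x"
    proof (cases "R x = x")
      case False
      let ?d = "R x - x"
      have dn: "norm ?d \<noteq> 0" using False by simp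
      have "R x \<bullet> e = x \<bullet> e" using ip[of x e] Re by simp
      then have de: "?d \<bullet> e = 0" by (simp add: inner_diff_left)
      define c where "c = ?d /\<^sub>R norm ?d"
      have c: "norm c = 1" "c \<bullet> e = 0" using dn de by (simp_all add: c_def)
      have "?d \<bullet> ?d = - (2 * (x \<bullet> ?d))"
        using ip[of x x] by (simp add: inner_simps inner_commute)
      then have xd: "2 * (x \<bullet> ?d) = - (norm ?d * norm ?d)" by (simp add: dot_square_norm power2_eq_square)
      have "reflect c x = x - (2 * (x \<bullet> ?d) / (norm ?d * norm ?d)) *\<^sub>R ?d"
        unfolding reflect_def c_def by (simp add: divide_inverse mult_ac)
      also have "\<dots> = R x" unfolding xd using dn by simp
      finally show ?thesis using sym[OF c x] by simp
    qed simp
  qed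
qed

section \<open>Axial symmetry of constrained minimizers\<close>

lemma ball_or_annulus_properties:
  assumes "ball_or_annulus \<Omega>"
  shows "open \<Omega>" "bounded \<Omega>" "radial_set \<Omega>"
proof -
  from assms consider R where "\<Omega> = ball 0 R" | R1 R2 where "\<Omega> = {x. R1 < norm x \<and> norm x < R2}"
    unfolding ball_or_annulus_def by blast
  then have "open \<Omega> \<and> bounded \<Omega> \<and> radial_set \<Omega>"
  proof cases
    case 1
    then show ?thesis by (auto simp: radial_set_def)
  next
    case (2 R1 R2)
    have "open \<Omega>" unfolding 2 by (intro open_Collect_conj open_Collect_less continuous_intros)
    moreover have "bounded \<Omega>" unfolding 2 by (rule bounded_subset[OF bounded_ball[of 0 R2]]) auto
    ultimately show ?thesis unfolding 2 by (auto simp: radial_set_def)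
  qed
  then show "open \<Omega>" "bounded \<Omega>" "radial_set \<Omega>" by auto
qed

lemma minimizer_axially_symmetric:
  fixes \<Omega> :: "'a::euclidean_space set" and u :: "'a \<Rightarrow> real"
  assumes dom: "ball_or_annulus \<Omega>"
    and carath: "\<forall>q\<in>{f, g}. caratheodory \<Omega> q"
    and radial: "\<forall>q\<in>{f, g}. \<forall>t. radial_on \<Omega> (\<lambda>x. q x t)"
    and growth: "\<forall>q\<in>{f, g}. subcritical_growth \<Omega> q"
    and lipschitz: "\<forall>q\<in>{f, g}. locally_lipschitz \<Omega> q"
    and regular: "Ck_on 2 \<Omega> u" "continuous_on (closure \<Omega>) u"
    and minimizer: "u \<in> constraint_set \<Omega> g"
      "\<forall>v\<in>constraint_set \<Omega> g. energy \<Omega> f u \<le> energy \<Omega> f v"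
    and multiplier: "solves_dirichlet \<Omega> (\<lambda>x t. f x t + \<mu> * g x t) u"
    and sign: "(AE x in lebesgue_on \<Omega>. g x (u x) > 0) \<or> (AE x in lebesgue_on \<Omega>. g x (u x) < 0)"
    and up: "\<And>s t. s \<in> S \<Longrightarrow> s \<le> t \<Longrightarrow> t \<in> S" and uS: "\<And>x. x \<in> \<Omega> \<Longrightarrow> u x \<in> S"
    and convex: "AE x in lebesgue_on \<Omega>. strictly_convex_on S (\<lambda>t. f x t + \<mu> * g x t)"
  shows "axially_symmetric_on \<Omega> u"
proof -
  note \<Omega> = ball_or_annulus_properties[OF dom]
  have "bounded (u ` closure \<Omega>)"
    using \<Omega>(2) regular(2) by (intro compact_imp_bounded compact_continuous_image) auto
  then obtain M where M: "M > 0" "\<And>x. x \<in> closure \<Omega> \<Longrightarrow> \<bar>u x\<bar> \<le> M"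
    unfolding bounded_pos by auto
  obtain Bf where Bf: "Bf > 0" "AE x in lebesgue_on \<Omega>. \<forall>t\<in>{-(2*M)..2*M}. \<bar>f x t\<bar> \<le> Bf"
    using subcritical_growth_bounded[of \<Omega> f] growth by blast
  obtain Bg where Bg: "Bg > 0" "AE x in lebesgue_on \<Omega>. \<forall>t\<in>{-(2*M)..2*M}. \<bar>g x t\<bar> \<le> Bg"
    using subcritical_growth_bounded[of \<Omega> g] growth by blast
  have M2: "2 * M > 0" using M(1) by simp
  obtain Lf where Lf: "Lf > 0" "AE x in lebesgue_on \<Omega>. \<forall>s\<in>{-(2*M)..2*M}. \<forall>t\<in>{-(2*M)..2*M}. \<bar>f x s - f x t\<bar> \<le> Lf * \<bar>s - t\<bar>"
    using lipschitz M2 unfolding locally_lipschitz_def by blast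
  obtain Lg where Lg: "Lg > 0" "AE x in lebesgue_on \<Omega>. \<forall>s\<in>{-(2*M)..2*M}. \<forall>t\<in>{-(2*M)..2*M}. \<bar>g x s - g x t\<bar> \<le> Lg * \<bar>s - t\<bar>"
    using lipschitz M2 unfolding locally_lipschitz_def by blast
  define L where "L = Lf + \<bar>\<mu>\<bar> * Lg + Lg"
  have L: "L > 0" unfolding L_def using Lf(1) Lg(1) by (simp add: add_nonneg_pos)
  have bound: "AE x in lebesgue_on \<Omega>. \<forall>t\<in>{-(2*M)..2*M}. \<bar>f x t\<bar> \<le> max Bf Bg \<and> \<bar>g x t\<bar> \<le> max Bf Bg"
    using Bf(2) Bg(2) by eventually_elim (auto simp: le_max_iff_disj)
  have lip: "AE x in lebesgue_on \<Omega>. \<forall>s\<in>{-(2*M)..2*M}. \<forall>t\<in>{-(2*M)..2*M}.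
        \<bar>g x s - g x t\<bar> \<le> L * \<bar>s - t\<bar> \<and> \<bar>(f x s + \<mu> * g x s) - (f x t + \<mu> * g x t)\<bar> \<le> L * \<bar>s - t\<bar>"
    using Lf(2) Lg(2)
  proof eventually_elim
    case (elim x)
    show ?case
    proof (intro ballI)
      fix s t assume st: "s \<in> {-(2*M)..2*M}" "t \<in> {-(2*M)..2*M}"
      have 1: "\<bar>f x s - f x t\<bar> \<le> Lf * \<bar>s - t\<bar>" and 2: "\<bar>g x s - g x t\<bar> \<le> Lg * \<bar>s - t\<bar>"
        using elim st by blast+
      have 3: "\<bar>\<mu> * g x s - \<mu> * g x t\<bar> \<le> \<bar>\<mu>\<bar> * (Lg * \<bar>s - t\<bar>)"
        unfolding right_diff_distrib[symmetric] abs_mult by (rule mult_left_mono[OF 2]) simp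
      have 4: "L * \<bar>s - t\<bar> = Lf * \<bar>s - t\<bar> + \<bar>\<mu>\<bar> * (Lg * \<bar>s - t\<bar>) + Lg * \<bar>s - t\<bar>"
        unfolding L_def by (simp add: algebra_simps)
      have 5: "Lf * \<bar>s - t\<bar> \<ge> 0" "\<bar>\<mu>\<bar> * (Lg * \<bar>s - t\<bar>) \<ge> 0" "Lg * \<bar>s - t\<bar> \<ge> 0"
        using Lf(1) Lg(1) by simp_all
      show "\<bar>g x s - g x t\<bar> \<le> L * \<bar>s - t\<bar> \<and> \<bar>(f x s + \<mu> * g x s) - (f x t + \<mu> * g x t)\<bar> \<le> L * \<bar>s - t\<bar>"
        using 1 2 3 5 unfolding 4 by linarith
    qed
  qed
  interpret constrained_minimizer \<Omega> f g u \<mu> M "max Bf Bg" L S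
  proof
    show "open \<Omega>" "bounded \<Omega>" "radial_set \<Omega>" by (rule \<Omega>)+
    show "C2_on \<Omega> u" by (rule Ck_on_2_C2_on[OF regular(1)])
    show "continuous_on (closure \<Omega>) u" by (rule regular(2))
    show "u x = 0" if "x \<in> frontier \<Omega>" for x using multiplier that unfolding solves_dirichlet_def by blast
    show "caratheodory \<Omega> f" "caratheodory \<Omega> g" using carath by auto
    show "radial_on \<Omega> (\<lambda>x. f x t)" "radial_on \<Omega> (\<lambda>x. g x t)" for t using radial by auto
    show "AE x in lebesgue_on \<Omega>. - laplacian u x = f x (u x) + \<mu> * g x (u x)"
      using multiplier unfolding solves_dirichlet_def by blast
    show "t \<in> S" if "s \<in> S" "s \<le> t" for s t by (rule up[OF that])
    show "u x \<in> S" if "x \<in> \<Omega>" for x by (rule uS[OF that])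
    show "0 < M" by (rule M(1))
    show "\<bar>u x\<bar> \<le> M" if "x \<in> closure \<Omega>" for x by (rule M(2)[OF that])
    show "0 < max Bf Bg" using Bf(1) by simp
    show "0 < L" by (rule L)
    show "u \<in> H1_0 \<Omega>" "(LINT x|lebesgue_on \<Omega>. primitive g x (u x)) = 1"
      using minimizer(1) unfolding constraint_set_def by auto
    show "energy \<Omega> f u \<le> energy \<Omega> f v" if "v \<in> constraint_set \<Omega> g" for v
      using minimizer(2) that by blast
  qed (rule bound lip convex sign)+
  show ?thesis
  proof (rule axially_symmetric_if_dominates[OF \<Omega>(3)])
    show "continuous_on \<Omega> u" by (rule continuous_on_subset[OF regular(2) closure_subset])
    show "dominates u \<Omega> e \<or> dominates u \<Omega> (- e)" if "norm e = 1" for e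
      using reflection_dichotomy[OF that] unfolding dominates_def .
  qed
qed

theorem theorem2p7:
  fixes \<Omega> :: "'a::euclidean_space set"
    and f g :: "'a \<Rightarrow> real \<Rightarrow> real"
    and u\<^sub>0 :: "'a \<Rightarrow> real"
    and \<mu> :: real
  assumes dim: "DIM('a) \<ge> 2"
    and dom: "ball_or_annulus \<Omega>"
    and carath: "\<forall>q\<in>{f, g}. caratheodory \<Omega> q"
    and radial: "\<forall>q\<in>{f, g}. \<forall>t. radial_on \<Omega> (\<lambda>x. q x t)"
    and growth: "\<forall>q\<in>{f, g}. subcritical_growth \<Omega> q"
    and lipschitz: "\<forall>q\<in>{f, g}. locally_lipschitz \<Omega> q"
    and regular: "Ck_on 2 \<Omega> u\<^sub>0" "continuous_on (closure \<Omega>) u\<^sub>0"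
    and minimizer: "u\<^sub>0 \<in> constraint_set \<Omega> g"
      "\<forall>v\<in>constraint_set \<Omega> g. energy \<Omega> f u\<^sub>0 \<le> energy \<Omega> f v"
    and nonzero: "\<not> (AE x in lebesgue_on \<Omega>. g x (u\<^sub>0 x) = 0)"
    and multiplier: "solves_dirichlet \<Omega> (\<lambda>x t. f x t + \<mu> * g x t) u\<^sub>0"
    and sign: "(AE x in lebesgue_on \<Omega>. g x (u\<^sub>0 x) > 0) \<or> (AE x in lebesgue_on \<Omega>. g x (u\<^sub>0 x) < 0)"
  shows "((AE x in lebesgue_on \<Omega>. strictly_convex_on UNIV (\<lambda>t. f x t + \<mu> * g x t))
           \<longrightarrow> axially_symmetric_on \<Omega> u\<^sub>0) \<and>
         ((\<forall>x\<in>\<Omega>. u\<^sub>0 x \<ge> 0) \<and>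
          (AE x in lebesgue_on \<Omega>. strictly_convex_on {0..} (\<lambda>t. f x t + \<mu> * g x t))
           \<longrightarrow> axially_symmetric_on \<Omega> u\<^sub>0)"
proof -
  note main = minimizer_axially_symmetric[OF dom carath radial growth lipschitz regular minimizer multiplier sign]
  show ?thesis
  proof (intro conjI impI)
    assume "AE x in lebesgue_on \<Omega>. strictly_convex_on UNIV (\<lambda>t. f x t + \<mu> * g x t)"
    then show "axially_symmetric_on \<Omega> u\<^sub>0" by (rule main[rotated 2]) auto
  next
    assume a: "(\<forall>x\<in>\<Omega>. u\<^sub>0 x \<ge> 0) \<and> (AE x in lebesgue_on \<Omega>. strictly_convex_on {0..} (\<lambda>t. f x t + \<mu> * g x t))"
    show "axially_symmetric_on \<Omega> u\<^sub>0" by (rule main[of "{0..}"]) (use a in auto)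
  qed
qed

end
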